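(* Let $I\subset K[x_1,\ldots,x_n]$ be a graded prime ideal of dimension $m<n$. Then, as sets, $\mathrm{gT}(I)=\mathcal{W}_n^m$.
   Context: $K$ is an algebraically closed field of characteristic $0$ with trivial valuation; $\dim I$ is the Krull dimension of $K[x_1,\ldots,x_n]/I$. Each $g=(g_{ij})\in\mathrm{GL}_n(K)$ acts by $x_i\mapsto\sum_j g_{ij}x_j$. For $f=\sum_\nu a_\nu x^\nu$ and $\omega\in\mathbb{R}^n$, $\mathrm{in}_\omega(f)$ is the sum of the terms with $\omega\cdot\nu$ minimal, and $T(I)=\{\omega:\mathrm{in}_\omega(f)\text{ is not a monomial for every }f\in I\}$. The generic tropical variety $\mathrm{gT}(I)$ is the set equal to $T(g(I))$ for all $g$ in a non-empty Zariski-open subset of $\mathrm{GL}_n(K)$ (it exists). The generic tropical fan $\mathcal{W}_n$ consists of the cones $C_A=\{\omega\in\mathbb{R}^n:\omega_i=\min_k\omega_k\text{ for all }i\in A\}$ for nonempty $A\subset\{1,\ldots,n\}$ ($\dim C_A=n-|A|+1$), and $\mathcal{W}_n^m$ is its $m$-skeleton (cones of dimension at most $m$); as a set it is the set of $\omega$ whose minimal coordinate is attained at least $n-m+1$ times. *)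

theory Defs
  imports "HOL-Library.Poly_Mapping" "HOL-Library.Extended_Nat" "HOL-Computational_Algebra.Polynomial"
begin

(* Polynomials over 'k: finitely supported maps from monomials (exponent vectors
   nat \<Rightarrow>\<^sub>0 nat) to coefficients.  K[x_1..x_n] is the subring P n of polynomials
   only involving the variables x_0,...,x_{n-1} (0-based indexing). *)
type_synonym 'k mpoly = "(nat \<Rightarrow>\<^sub>0 nat) \<Rightarrow>\<^sub>0 'k"

definition var :: "nat \<Rightarrow> 'k::comm_ring_1 mpoly" where
  "var i = Poly_Mapping.single (Poly_Mapping.single i 1) 1"

definition P :: "nat \<Rightarrow> 'k::comm_ring_1 mpoly set" where
  "P n = {f. \<forall>\<nu>\<in>Poly_Mapping.keys f. Poly_Mapping.keys \<nu> \<subseteq> {..<n}}"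

definition is_ideal :: "nat \<Rightarrow> 'k::comm_ring_1 mpoly set \<Rightarrow> bool" where
  "is_ideal n I \<longleftrightarrow> I \<subseteq> P n \<and> 0 \<in> I \<and> (\<forall>f\<in>I. \<forall>g\<in>I. f + g \<in> I)
      \<and> (\<forall>f\<in>I. \<forall>h\<in>P n. h * f \<in> I)"

definition is_prime_ideal :: "nat \<Rightarrow> 'k::comm_ring_1 mpoly set \<Rightarrow> bool" where
  "is_prime_ideal n I \<longleftrightarrow> is_ideal n I \<and> 1 \<notin> I
      \<and> (\<forall>f\<in>P n. \<forall>g\<in>P n. f * g \<in> I \<longrightarrow> f \<in> I \<or> g \<in> I)"

definition mdeg :: "(nat \<Rightarrow>\<^sub>0 nat) \<Rightarrow> nat" where
  "mdeg \<nu> = (\<Sum>i\<in>Poly_Mapping.keys \<nu>. Poly_Mapping.lookup \<nu> i)"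

definition homog_comp :: "nat \<Rightarrow> 'k::comm_ring_1 mpoly \<Rightarrow> 'k mpoly" where
  "homog_comp d f = (\<Sum>\<nu>\<in>{\<nu>\<in>Poly_Mapping.keys f. mdeg \<nu> = d}. Poly_Mapping.single \<nu> (Poly_Mapping.lookup f \<nu>))"

definition graded_ideal :: "nat \<Rightarrow> 'k::comm_ring_1 mpoly set \<Rightarrow> bool" where
  "graded_ideal n I \<longleftrightarrow> is_ideal n I \<and> (\<forall>f\<in>I. \<forall>d. homog_comp d f \<in> I)"

definition krull_dim :: "nat \<Rightarrow> 'k::comm_ring_1 mpoly set \<Rightarrow> enat" where
  "krull_dim n I = Sup {enat d | d. \<exists>Q :: nat \<Rightarrow> 'k mpoly set.
      (\<forall>k\<le>d. is_prime_ideal n (Q k) \<and> I \<subseteq> Q k) \<and> (\<forall>k<d. Q k \<subset> Q (Suc k))}"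

definition subst :: "(nat \<Rightarrow> 'k::comm_ring_1 mpoly) \<Rightarrow> 'k mpoly \<Rightarrow> 'k mpoly" where
  "subst s f = (\<Sum>\<nu>\<in>Poly_Mapping.keys f. Poly_Mapping.single 0 (Poly_Mapping.lookup f \<nu>) * (\<Prod>i\<in>Poly_Mapping.keys \<nu>. s i ^ Poly_Mapping.lookup \<nu> i))"

definition GL :: "nat \<Rightarrow> (nat \<Rightarrow> nat \<Rightarrow> 'k::field) set" where
  "GL n = {g. (\<forall>i j. (n \<le> i \<or> n \<le> j) \<longrightarrow> g i j = 0) \<and>
      (\<exists>h. \<forall>i<n. \<forall>j<n. (\<Sum>k<n. g i k * h k j) = (if i = j then 1 else 0))}"

definition act :: "nat \<Rightarrow> (nat \<Rightarrow> nat \<Rightarrow> 'k::field) \<Rightarrow> 'k mpoly set \<Rightarrow> 'k mpoly set" where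
  "act n g I = subst (\<lambda>i. \<Sum>j<n. Poly_Mapping.single 0 (g i j) * var j) ` I"

definition eval_mat :: "(((nat \<times> nat) \<Rightarrow>\<^sub>0 nat) \<Rightarrow>\<^sub>0 'k::comm_ring_1) \<Rightarrow> (nat \<Rightarrow> nat \<Rightarrow> 'k) \<Rightarrow> 'k" where
  "eval_mat p g = (\<Sum>\<mu>\<in>Poly_Mapping.keys p. Poly_Mapping.lookup p \<mu> * (\<Prod>ij\<in>Poly_Mapping.keys \<mu>. g (fst ij) (snd ij) ^ Poly_Mapping.lookup \<mu> ij))"

definition zariski_open_GL :: "nat \<Rightarrow> (nat \<Rightarrow> nat \<Rightarrow> 'k::field) set \<Rightarrow> bool" where
  "zariski_open_GL n U \<longleftrightarrow> (\<exists>F. U = {g\<in>GL n. \<exists>p\<in>F. eval_mat p g \<noteq> 0})"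

definition Rn :: "nat \<Rightarrow> (nat \<Rightarrow> real) set" where
  "Rn n = {\<omega>. \<forall>i\<ge>n. \<omega> i = 0}"

definition wdeg :: "(nat \<Rightarrow> real) \<Rightarrow> (nat \<Rightarrow>\<^sub>0 nat) \<Rightarrow> real" where
  "wdeg \<omega> \<nu> = (\<Sum>i\<in>Poly_Mapping.keys \<nu>. \<omega> i * real (Poly_Mapping.lookup \<nu> i))"

definition init_form :: "(nat \<Rightarrow> real) \<Rightarrow> 'k::comm_ring_1 mpoly \<Rightarrow> 'k mpoly" where
  "init_form \<omega> f = (\<Sum>\<nu>\<in>{\<nu>\<in>Poly_Mapping.keys f. \<forall>\<mu>\<in>Poly_Mapping.keys f. wdeg \<omega> \<nu> \<le> wdeg \<omega> \<mu>}.
       Poly_Mapping.single \<nu> (Poly_Mapping.lookup f \<nu>))"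

definition is_monomial :: "'k::comm_ring_1 mpoly \<Rightarrow> bool" where
  "is_monomial f \<longleftrightarrow> card (Poly_Mapping.keys f) = 1"

definition trop :: "nat \<Rightarrow> 'k::comm_ring_1 mpoly set \<Rightarrow> (nat \<Rightarrow> real) set" where
  "trop n I = {\<omega>\<in>Rn n. \<forall>f\<in>I. \<not> is_monomial (init_form \<omega> f)}"

definition gtrop :: "nat \<Rightarrow> 'k::field mpoly set \<Rightarrow> (nat \<Rightarrow> real) set" where
  "gtrop n I = (THE S. \<exists>U. zariski_open_GL n U \<and> U \<noteq> {} \<and> (\<forall>g\<in>U. trop n (act n g I) = S))"

definition cone :: "nat \<Rightarrow> nat set \<Rightarrow> (nat \<Rightarrow> real) set" where
  "cone n A = {\<omega>\<in>Rn n. \<forall>i\<in>A. \<omega> i = Min (\<omega> ` {..<n})}"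

(* m-skeleton of the generic tropical fan: union of cones of dimension n-|A|+1 \<le> m *)
definition W_skel :: "nat \<Rightarrow> nat \<Rightarrow> (nat \<Rightarrow> real) set" where
  "W_skel n m = \<Union>{cone n A | A. A \<noteq> {} \<and> A \<subseteq> {..<n} \<and> n - card A + 1 \<le> m}"

end

theory Submission
  imports Defs "Jordan_Normal_Form.Determinant"
begin

text \<open>Let \<open>J = g(I)\<close> for generic \<open>g\<close>. The only genericity needed is that for every set \<open>D\<close> of \<open>m\<close> coordinates
  \<open>J + (x\<^sub>i | i \<in> D)\<close> contains a power of the irrelevant ideal: by Noether normalization with linear forms this holds
  for some \<open>g\<close>, and it is an open condition on \<open>g\<close>.

  If the minimum of \<open>\<omega>\<close> is attained at most \<open>n - m\<close> times, choose \<open>D\<close> among the coordinates of non-minimal weight and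
  \<open>i\<close> of minimal weight: \<open>J\<close> contains a form \<open>x\<^sub>i\<^sup>N + h\<close> with every term of \<open>h\<close> divisible by some \<open>x\<^sub>k\<close>, \<open>k \<in> D\<close>, and its
  initial form is \<open>x\<^sub>i\<^sup>N\<close>.

  If the minimum is attained more often and some \<open>f \<in> J\<close> had a monomial \<open>x\<^sup>\<nu>\<close> as initial form, then rewriting by \<open>f\<close> and
  by the finiteness relations for the sets \<open>D\<close> containing all coordinates of non-minimal weight would show that modulo
  \<open>J\<close> the polynomials of degree at most \<open>d\<close> are spanned by \<open>O(d\<^sup>m\<^sup>-\<^sup>1)\<close> monomials. A chain of primes of length \<open>m\<close> over \<open>I\<close>
  however yields \<open>m\<close> algebraically independent elements modulo \<open>I\<close>, so the growth is at least of order \<open>d\<^sup>m\<close>.\<close>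

text \<open>Krull dimension enters in both directions. Normalization gives some set D of variables
  over which the quotient is finite; that at most m variables suffice is seen by building a chain of
  primes of length \<open>card D\<close> once these variables satisfy no relation. The determinant
  trick keeps the remaining variables independent each time one variable is adjoined to a prime of
  that chain. Real weights alone do not make rewriting terminate. All relations used are
  homogeneous, so only the finitely many monomials of one degree occur, and the weight can rise only
  finitely often. The gain from d^m to d^(m-1) comes from one coordinate: fewer than m coordinates
  have non-minimal weight, so a set D of size m has room for one more index i, and the exponent of
  x_i stays bounded because each factor x_i helps to complete the initial monomial.
  \<open>gtrop\<close> is a definite description, so uniqueness is part of the claim: two non-empty
  open sets of matrices meet, as a line through a point of each shows.\<close>

abbreviation keys :: "('a \<Rightarrow>\<^sub>0 'b::zero) \<Rightarrow> 'a set" where "keys \<equiv> Poly_Mapping.keys"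
abbreviation lookup :: "('a \<Rightarrow>\<^sub>0 'b::zero) \<Rightarrow> 'a \<Rightarrow> 'b" where "lookup \<equiv> Poly_Mapping.lookup"
abbreviation single :: "'a \<Rightarrow> 'b \<Rightarrow> ('a \<Rightarrow>\<^sub>0 'b::zero)" where "single \<equiv> Poly_Mapping.single"

section \<open>Evaluation homomorphisms\<close>

lemma lookup_single': "lookup (single k v) k' = (if k = k' then v else 0)"
  by (simp add: lookup_single)

lemma keys_plus_nat: "keys (\<nu> + \<mu>) = keys \<nu> \<union> keys (\<mu> :: 'x \<Rightarrow>\<^sub>0 nat)"
  by (auto simp: in_keys_iff lookup_add)

lemma poly_mapping_sum_single: "(\<Sum>\<nu>\<in>keys f. single \<nu> (lookup f \<nu>)) = f"
  by (rule poly_mapping_eqI) (auto simp: lookup_sum lookup_single' in_keys_iff)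

lemma lookup_const_mult: "lookup (single 0 c * f) \<nu> = c * lookup f \<nu>"
  for f :: "'a::comm_monoid_add \<Rightarrow>\<^sub>0 'k::comm_ring_1"
  by (simp add: mult_map_scale_conv_mult[symmetric] Poly_Mapping.map.rep_eq when_def)

lemma single_add_split: "b \<in> keys \<nu> \<Longrightarrow> \<nu> = single b 1 + (\<nu> - single b 1)" for \<nu> :: "nat \<Rightarrow>\<^sub>0 nat"
  by (intro poly_mapping_eqI) (auto simp: lookup_add lookup_minus lookup_single' in_keys_iff)

lemma keys_multE:
  assumes "\<nu> \<in> keys (f * g)"
  obtains a b where "a \<in> keys f" "b \<in> keys g" "\<nu> = a + b"
  using assms keys_mult[of f g] by auto

definition monom_val :: "('x \<Rightarrow> 'b::comm_ring_1) \<Rightarrow> ('x \<Rightarrow>\<^sub>0 nat) \<Rightarrow> 'b" where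
  "monom_val s \<nu> = (\<Prod>i\<in>keys \<nu>. s i ^ lookup \<nu> i)"

text \<open>One evaluation with a coefficient map \<open>c\<close> covers three uses:
  \<open>subst\<close> (coefficients become constants), \<open>eval_mat\<close> (coefficients
  unchanged, indeterminates are matrix entries), and restriction to a line (coefficients become
  constant univariate polynomials).\<close>

definition pev :: "('k::comm_ring_1 \<Rightarrow> 'b::comm_ring_1) \<Rightarrow> ('x \<Rightarrow> 'b) \<Rightarrow> (('x \<Rightarrow>\<^sub>0 nat) \<Rightarrow>\<^sub>0 'k) \<Rightarrow> 'b" where
  "pev c s f = (\<Sum>\<nu>\<in>keys f. c (lookup f \<nu>) * monom_val s \<nu>)"

lemma monom_val_superset:
  assumes "finite K" "keys \<nu> \<subseteq> K"
  shows "monom_val s \<nu> = (\<Prod>i\<in>K. s i ^ lookup \<nu> i)"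
  unfolding monom_val_def by (rule prod.mono_neutral_left) (use assms in \<open>auto simp: in_keys_iff\<close>)

lemma monom_val_add: "monom_val s (\<nu> + \<mu>) = monom_val s \<nu> * monom_val s \<mu>"
proof -
  let ?K = "keys \<nu> \<union> keys \<mu>"
  show ?thesis
    using monom_val_superset[of ?K "\<nu> + \<mu>" s] monom_val_superset[of ?K \<nu> s] monom_val_superset[of ?K \<mu> s]
    by (simp add: keys_plus_nat lookup_add power_add prod.distrib)
qed

lemma monom_val_0 [simp]: "monom_val s 0 = 1"
  by (simp add: monom_val_def)

lemma monom_val_single: "monom_val s (single i k) = s i ^ k"
  using monom_val_superset[of "{i}" "single i k" s] by (simp add: lookup_single')

lemma pev_superset:
  assumes "finite K" "keys f \<subseteq> K" "c 0 = 0"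
  shows "pev c s f = (\<Sum>\<nu>\<in>K. c (lookup f \<nu>) * monom_val s \<nu>)"
  unfolding pev_def by (rule sum.mono_neutral_left) (use assms in \<open>auto simp: in_keys_iff\<close>)

lemma pev_single: "c 0 = 0 \<Longrightarrow> pev c s (single \<nu> a) = c a * monom_val s \<nu>"
  using pev_superset[of "{\<nu>}" "single \<nu> a" c s] by (simp add: lookup_single')

lemma pev_add:
  assumes "comm_ring_hom c"
  shows "pev c s (f + g) = pev c s f + pev c s g"
proof -
  interpret c: comm_ring_hom c by fact
  let ?K = "keys f \<union> keys g"
  have "keys (f + g) \<subseteq> ?K" by (rule keys_add)
  then show ?thesis
    using pev_superset[of ?K "f + g" c s] pev_superset[of ?K f c s] pev_superset[of ?K g c s]
    by (simp add: lookup_add c.hom_add distrib_right sum.distrib)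
qed

lemma pev_sum:
  assumes "comm_ring_hom c"
  shows "pev c s (\<Sum>i\<in>A. F i) = (\<Sum>i\<in>A. pev c s (F i))"
  by (induction A rule: infinite_finite_induct) (auto simp: pev_add[OF assms], auto simp: pev_def)

lemma pev_hom:
  assumes "comm_ring_hom c"
  shows "comm_ring_hom (pev c s :: (('x \<Rightarrow>\<^sub>0 nat) \<Rightarrow>\<^sub>0 'k::comm_ring_1) \<Rightarrow> 'b::comm_ring_1)"
proof -
  interpret c: comm_ring_hom c by fact
  have mult: "pev c s (f * g) = pev c s f * pev c s g" for f g :: "('x \<Rightarrow>\<^sub>0 nat) \<Rightarrow>\<^sub>0 'k"
  proof -
    have "f * g = (\<Sum>\<nu>\<in>keys f. \<Sum>\<mu>\<in>keys g. single (\<nu> + \<mu>) (lookup f \<nu> * lookup g \<mu>))"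
    proof -
      have "f * g = (\<Sum>\<nu>\<in>keys f. single \<nu> (lookup f \<nu>)) * (\<Sum>\<mu>\<in>keys g. single \<mu> (lookup g \<mu>))"
        by (simp only: poly_mapping_sum_single)
      then show ?thesis by (simp add: sum_product mult_single)
    qed
    then show ?thesis
      by (simp add: pev_sum[OF assms] pev_single c.hom_mult monom_val_add pev_def[of c s f] pev_def[of c s g]
          sum_product algebra_simps)
  qed
  have one: "pev c s 1 = 1"
    by (metis c.hom_one c.hom_zero monom_val_0 mult_1 pev_single single_one)
  show ?thesis
    by unfold_locales (auto simp: pev_add[OF assms] mult one, auto simp: pev_def)
qed

lemma id_ring_hom: "comm_ring_hom (\<lambda>x. x)"
  by unfold_locales auto

lemma const_hom: "comm_ring_hom (single 0 :: 'k::comm_ring_1 \<Rightarrow> (('x::comm_monoid_add) \<Rightarrow>\<^sub>0 'k))"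
  by unfold_locales (auto simp: single_add mult_single)

lemma comm_ring_hom_compose:
  "comm_ring_hom f \<Longrightarrow> comm_ring_hom g \<Longrightarrow> comm_ring_hom (\<lambda>x. f (g x))"
  unfolding comm_ring_hom_def Ring_Hom.ring_hom_def semiring_hom_def comm_monoid_add_hom_def monoid_add_hom_def
    zero_hom_def semigroup_add_hom_def plus_hom_def monoid_mult_hom_def one_hom_def semigroup_mult_hom_def times_hom_def
  by auto

lemma single_eq_monom:
  "single \<nu> a = single 0 a * monom_val (\<lambda>i. single (single i 1) 1) \<nu>"
proof -
  have p: "(single (single i 1) (1::'b::comm_ring_1)) ^ k = single (single i k) 1" for k and i :: 'a
    by (induction k) (auto simp: mult_single single_add[symmetric])
  have "(\<Prod>i\<in>K. single (single i (lookup \<nu> i)) (1::'b)) = single (\<Sum>i\<in>K. single i (lookup \<nu> i)) 1" for K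
    by (induction K rule: infinite_finite_induct) (auto simp: mult_single)
  then show ?thesis
    unfolding monom_val_def p by (simp add: mult_single poly_mapping_sum_single)
qed

lemma hom_monom_val:
  assumes "comm_ring_hom h" shows "h (monom_val s \<nu>) = monom_val (\<lambda>i. h (s i)) \<nu>"
proof -
  interpret h: comm_ring_hom h by fact
  show ?thesis by (simp add: monom_val_def h.hom_prod h.hom_power)
qed

text \<open>Every polynomial is a sum of constants times products of variables. Agreement is asked
  only on variables occurring in \<open>f\<close>, because linear substitutions behave well only on
  the first n variables.\<close>

lemma hom_ext:
  assumes "comm_ring_hom h" "comm_ring_hom h'"
    and "\<And>a. h (single 0 a) = h' (single 0 a)"
    and "\<And>\<nu> i. \<nu> \<in> keys f \<Longrightarrow> i \<in> keys \<nu> \<Longrightarrow> h (single (single i 1) 1) = h' (single (single i 1) 1)"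
  shows "h f = h' (f :: ('x \<Rightarrow>\<^sub>0 nat) \<Rightarrow>\<^sub>0 'k::comm_ring_1)"
proof -
  interpret h: comm_ring_hom h by fact
  interpret h': comm_ring_hom h' by fact
  have "h (single \<nu> (lookup f \<nu>)) = h' (single \<nu> (lookup f \<nu>))" if "\<nu> \<in> keys f" for \<nu>
    apply (subst (1 2) single_eq_monom)
    unfolding h.hom_mult h'.hom_mult hom_monom_val[OF assms(1)] hom_monom_val[OF assms(2)] assms(3)
    using assms(4)[OF that] by (simp add: monom_val_def)
  then have "(\<Sum>\<nu>\<in>keys f. h (single \<nu> (lookup f \<nu>))) = (\<Sum>\<nu>\<in>keys f. h' (single \<nu> (lookup f \<nu>)))"
    by simp
  then show ?thesis
    unfolding h.hom_sum[symmetric] h'.hom_sum[symmetric] poly_mapping_sum_single .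
qed

lemma pev_const [simp]: "c 0 = 0 \<Longrightarrow> pev c s (single 0 a) = c a"
  by (simp add: pev_single)

lemma pev_var [simp]: "c 0 = 0 \<Longrightarrow> c 1 = 1 \<Longrightarrow> pev c s (single (single i (Suc 0)) 1) = s i"
  by (simp add: pev_single monom_val_single)

lemma hom_pev:
  assumes "comm_ring_hom h" "comm_ring_hom c"
  shows "h (pev c s f) = pev (\<lambda>a. h (c a)) (\<lambda>i. h (s i)) f"
proof -
  interpret h: comm_ring_hom h by fact
  interpret c: comm_ring_hom c by fact
  show ?thesis
    by (rule hom_ext[OF comm_ring_hom_compose[OF assms(1) pev_hom[OF assms(2)]]
          pev_hom[OF comm_ring_hom_compose[OF assms]]]) auto
qed

lemma subst_eq_pev: "subst s = pev (single 0) s"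
  by (rule ext) (simp add: subst_def pev_def monom_val_def)

lemma eval_mat_eq_pev: "eval_mat p g = pev (\<lambda>x. x) (\<lambda>ij. g (fst ij) (snd ij)) p"
  by (simp add: eval_mat_def pev_def monom_val_def)

interpretation subst: comm_ring_hom "subst s" for s
  unfolding subst_eq_pev by (rule pev_hom[OF const_hom])

lemma eval_mat_hom: "comm_ring_hom (\<lambda>p. eval_mat p g)"
  unfolding eval_mat_eq_pev by (rule pev_hom[OF id_ring_hom])

lemma subst_const [simp]: "subst s (single 0 a) = single 0 a"
  by (simp add: subst_eq_pev)

lemma subst_var [simp]: "subst s (var i) = s i"
  unfolding subst_eq_pev var_def by simp

lemma subst_ext:
  assumes "comm_ring_hom h" "\<And>a. h (single 0 a) = single 0 a"
    and "\<And>\<nu> i. \<nu> \<in> keys f \<Longrightarrow> i \<in> keys \<nu> \<Longrightarrow> h (var i) = s i"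
  shows "h f = subst s f"
  by (rule hom_ext[OF assms(1) subst.comm_ring_hom_axioms])
    (use assms(2,3) in \<open>simp_all flip: var_def del: One_nat_def\<close>)

lemma subst_subst: "subst t (subst s f) = subst (\<lambda>i. subst t (s i)) f"
  by (rule subst_ext[OF comm_ring_hom_compose[OF subst.comm_ring_hom_axioms subst.comm_ring_hom_axioms]]) auto

lemma subst_id: "(\<And>\<nu> i. \<nu> \<in> keys f \<Longrightarrow> i \<in> keys \<nu> \<Longrightarrow> s i = var i) \<Longrightarrow> subst s f = f"
  by (rule subst_ext[OF id_ring_hom, symmetric]) auto

section \<open>Subrings of polynomials and gradings\<close>

text \<open>Arbitrary sets of variables are needed besides initial segments: coordinate subrings for
  a set D, and the tails of a list of elements in the chain argument.\<close>

definition PV :: "nat set \<Rightarrow> 'k::comm_ring_1 mpoly set" where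
  "PV V = {f. \<forall>\<nu>\<in>keys f. keys \<nu> \<subseteq> V}"

lemma P_eq_PV: "P n = PV {..<n}"
  by (simp add: P_def PV_def)

lemma PV_mono: "V \<subseteq> V' \<Longrightarrow> PV V \<subseteq> PV V'"
  unfolding PV_def by blast

lemma PV_0 [simp]: "0 \<in> PV V" and PV_const [simp]: "single 0 c \<in> PV V" and PV_1 [simp]: "1 \<in> PV V"
  by (auto simp: PV_def)

lemma PV_single: "keys \<nu> \<subseteq> V \<Longrightarrow> single \<nu> c \<in> PV V"
  by (auto simp: PV_def)

lemma PV_var [simp]: "i \<in> V \<Longrightarrow> var i \<in> PV V"
  unfolding var_def by (rule PV_single) auto

lemma PV_add: "f \<in> PV V \<Longrightarrow> g \<in> PV V \<Longrightarrow> f + g \<in> PV V"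
  unfolding PV_def using keys_add[of f g] by blast

lemma PV_uminus: "f \<in> PV V \<Longrightarrow> - f \<in> PV V"
  unfolding PV_def by (simp add: keys_minus)

lemma PV_minus: "f \<in> PV V \<Longrightarrow> g \<in> PV V \<Longrightarrow> f - g \<in> PV V"
  unfolding PV_def using keys_diff[of f g] by blast

lemma PV_mult: "f \<in> PV V \<Longrightarrow> g \<in> PV V \<Longrightarrow> f * g \<in> PV V"
  unfolding PV_def by (auto elim!: keys_multE simp: keys_plus_nat) blast+

lemma PV_sum: "(\<And>i. i \<in> A \<Longrightarrow> F i \<in> PV V) \<Longrightarrow> (\<Sum>i\<in>A. F i) \<in> PV V"
  by (induction A rule: infinite_finite_induct) (auto intro: PV_add)

lemma PV_prod: "(\<And>i. i \<in> A \<Longrightarrow> F i \<in> PV V) \<Longrightarrow> (\<Prod>i\<in>A. F i) \<in> PV V"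
  by (induction A rule: infinite_finite_induct) (auto intro: PV_mult)

lemma PV_power: "f \<in> PV V \<Longrightarrow> f ^ k \<in> PV V"
  by (induction k) (auto intro: PV_mult)

lemma PV_subst:
  assumes "f \<in> PV V" "\<And>i. i \<in> V \<Longrightarrow> s i \<in> PV V'"
  shows "subst s f \<in> PV V'"
  unfolding subst_def
  by (intro PV_sum PV_mult PV_prod PV_power) (use assms in \<open>auto simp: PV_def[of V]\<close>)

lemma mdeg_superset: "finite K \<Longrightarrow> keys \<nu> \<subseteq> K \<Longrightarrow> mdeg \<nu> = (\<Sum>i\<in>K. lookup \<nu> i)"
  unfolding mdeg_def by (rule sum.mono_neutral_left) (auto simp: in_keys_iff)

lemma mdeg_add: "mdeg (\<nu> + \<mu>) = mdeg \<nu> + mdeg \<mu>"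
  using mdeg_superset[of "keys \<nu> \<union> keys \<mu>"] by (simp add: keys_plus_nat lookup_add sum.distrib)

lemma mdeg_0 [simp]: "mdeg 0 = 0" by (simp add: mdeg_def)

lemma mdeg_single [simp]: "mdeg (single i k) = k"
  using mdeg_superset[of "{i}" "single i k"] by (simp add: lookup_single')

lemma mdeg_eq_0: "mdeg \<nu> = 0 \<longleftrightarrow> \<nu> = 0"
  by (auto simp: mdeg_def in_keys_iff intro: poly_mapping_eqI)

lemma lookup_le_mdeg: "lookup \<nu> i \<le> mdeg \<nu>"
  unfolding mdeg_def
  by (cases "i \<in> keys \<nu>") (auto simp: in_keys_iff intro: member_le_sum)

definition homog :: "nat \<Rightarrow> 'k::comm_ring_1 mpoly \<Rightarrow> bool" where
  "homog d f \<longleftrightarrow> (\<forall>\<nu>\<in>keys f. mdeg \<nu> = d)"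

lemma lookup_homog_comp: "lookup (homog_comp d f) \<nu> = (if mdeg \<nu> = d then lookup f \<nu> else 0)"
  unfolding homog_comp_def by (auto simp: lookup_sum lookup_single' in_keys_iff)

lemma homog_homog_comp [simp]: "homog d (homog_comp d f)"
  by (auto simp: homog_def in_keys_iff lookup_homog_comp split: if_splits)

lemma homog_comp_homog: "homog d f \<Longrightarrow> homog_comp d f = f"
  by (rule poly_mapping_eqI) (auto simp: lookup_homog_comp homog_def in_keys_iff)

lemma homog_comp_homog_neq: "homog d f \<Longrightarrow> e \<noteq> d \<Longrightarrow> homog_comp e f = 0"
  by (rule poly_mapping_eqI) (auto simp: lookup_homog_comp homog_def in_keys_iff)

lemma homog_comp_eq_0: "d \<notin> mdeg ` keys f \<Longrightarrow> homog_comp d f = 0"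
  by (rule poly_mapping_eqI) (metis imageI in_keys_iff lookup_homog_comp lookup_zero)

lemma homog_comp_sum: "homog_comp d (\<Sum>i\<in>A. F i) = (\<Sum>i\<in>A. homog_comp d (F i))"
  by (rule poly_mapping_eqI) (auto simp: lookup_homog_comp lookup_sum)

lemma PV_homog_comp: "f \<in> PV V \<Longrightarrow> homog_comp d f \<in> PV V"
  by (auto simp: PV_def in_keys_iff lookup_homog_comp split: if_splits)

lemma sum_homog_comp: "(\<Sum>d\<in>mdeg ` keys f. homog_comp d f) = f"
  by (rule poly_mapping_eqI) (auto simp: lookup_homog_comp lookup_sum in_keys_iff)

lemma homog_0 [simp]: "homog d 0" and homog_const [simp]: "homog 0 (single 0 c)"
  and homog_1 [simp]: "homog 0 1"
  by (auto simp: homog_def)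

lemma homog_single [simp]: "homog (mdeg \<nu>) (single \<nu> c)"
  by (auto simp: homog_def)

lemma homog_var [simp]: "homog (Suc 0) (var i)"
  by (auto simp: homog_def var_def)

lemma homog_add: "homog d f \<Longrightarrow> homog d g \<Longrightarrow> homog d (f + g)"
  unfolding homog_def using keys_add[of f g] by blast

lemma homog_minus: "homog d f \<Longrightarrow> homog d g \<Longrightarrow> homog d (f - g)"
  unfolding homog_def using keys_diff[of f g] by blast

lemma homog_mult: "homog d f \<Longrightarrow> homog e g \<Longrightarrow> homog (d + e) (f * g)"
  unfolding homog_def by (auto elim!: keys_multE simp: mdeg_add)

lemma homog_sum: "(\<And>i. i \<in> A \<Longrightarrow> homog d (F i)) \<Longrightarrow> homog d (\<Sum>i\<in>A. F i)"
  by (induction A rule: infinite_finite_induct) (auto intro: homog_add)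

lemma homog_power: "homog d f \<Longrightarrow> homog (k * d) (f ^ k)"
  by (induction k) (auto intro: homog_mult)

lemma homog_prod: "(\<And>i. i \<in> A \<Longrightarrow> homog (d i) (F i)) \<Longrightarrow> homog (\<Sum>i\<in>A. d i) (\<Prod>i\<in>A. F i)"
  by (induction A rule: infinite_finite_induct) (auto intro: homog_mult)

lemma homog_subst:
  assumes "homog d f" "\<And>i. homog 1 (s i)"
  shows "homog d (subst s f)"
  unfolding subst_def
proof (rule homog_sum)
  fix \<nu> assume "\<nu> \<in> keys f"
  then have d: "mdeg \<nu> = d" using assms(1) by (simp add: homog_def)
  have "homog (0 + (\<Sum>i\<in>keys \<nu>. lookup \<nu> i * 1)) (single 0 (lookup f \<nu>) * (\<Prod>i\<in>keys \<nu>. s i ^ lookup \<nu> i))"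
    by (intro homog_mult homog_prod homog_power assms homog_const)
  then show "homog d (single 0 (lookup f \<nu>) * (\<Prod>i\<in>keys \<nu>. s i ^ lookup \<nu> i))"
    using d by (simp add: mdeg_def)
qed

lemma homog_comp_subst:
  assumes "\<And>i. homog 1 (s i)"
  shows "homog_comp d (subst s f) = subst s (homog_comp d f)"
proof -
  have "homog_comp d (subst s f) = (\<Sum>e\<in>mdeg ` keys f. homog_comp d (subst s (homog_comp e f)))"
    by (subst (1) sum_homog_comp[of f, symmetric]) (simp only: subst.hom_sum homog_comp_sum)
  also have "\<dots> = (\<Sum>e\<in>mdeg ` keys f. if e = d then subst s (homog_comp d f) else 0)"
    by (rule sum.cong)
       (use homog_comp_homog[OF homog_subst[OF homog_homog_comp assms]] homog_comp_homog_neq[OF homog_subst[OF homog_homog_comp assms]] in auto)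
  also have "\<dots> = (if d \<in> mdeg ` keys f then subst s (homog_comp d f) else 0)"
    by (simp add: sum.delta)
  also have "\<dots> = subst s (homog_comp d f)"
  proof (cases "d \<in> mdeg ` keys f")
    case False
    then show ?thesis by (simp add: homog_comp_eq_0)
  qed simp
  finally show ?thesis .
qed

section \<open>Setting variables to zero\<close>

text \<open>The retraction modulo the variables in \<open>D\<close>: equal images mean congruence
  modulo the ideal generated by these variables. As an endomorphism of the same ring it avoids
  forming quotients or sums of ideals.\<close>

definition zap :: "nat set \<Rightarrow> 'k::comm_ring_1 mpoly \<Rightarrow> 'k mpoly" where
  "zap D = subst (\<lambda>i. if i \<in> D then 0 else var i)"

interpretation zap: comm_ring_hom "zap D" for D
  unfolding zap_def by (rule subst.comm_ring_hom_axioms)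

lemma zap_const [simp]: "zap D (single 0 a) = single 0 a"
  by (simp add: zap_def)

lemma zap_var [simp]: "zap D (var i) = (if i \<in> D then 0 else var i)"
  by (simp add: zap_def)

lemma zap_single: "zap D (single \<nu> a) = (if keys \<nu> \<inter> D = {} then single \<nu> a else 0)"
proof (cases "keys \<nu> \<inter> D = {}")
  case True
  then have "zap D (single \<nu> a) = single \<nu> a"
    unfolding zap_def by (intro subst_id) (auto split: if_splits)
  then show ?thesis using True by simp
next
  case False
  then obtain i where "i \<in> keys \<nu>" "i \<in> D" by blast
  then have "monom_val (\<lambda>i. if i \<in> D then (0::'a mpoly) else var i) \<nu> = 0"
    unfolding monom_val_def by (intro prod_zero) (auto simp: in_keys_iff power_0_left)
  then show ?thesis using False
    by (simp add: zap_def subst_eq_pev pev_single)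
qed

lemma lookup_zap: "lookup (zap D f) \<nu> = (if keys \<nu> \<inter> D = {} then lookup f \<nu> else 0)"
proof -
  have *: "lookup (zap D (single \<mu> (lookup f \<mu>))) \<nu>
      = (if \<mu> = \<nu> then (if keys \<nu> \<inter> D = {} then lookup f \<nu> else 0) else 0)" for \<mu>
    by (simp add: zap_single lookup_single')
  have "zap D f = (\<Sum>\<mu>\<in>keys f. zap D (single \<mu> (lookup f \<mu>)))"
    unfolding zap.hom_sum[symmetric] poly_mapping_sum_single ..
  then have "lookup (zap D f) \<nu> = (\<Sum>\<mu>\<in>keys f. if \<mu> = \<nu> then (if keys \<nu> \<inter> D = {} then lookup f \<nu> else 0) else 0)"
    by (simp only: lookup_sum *)
  also have "\<dots> = (if keys \<nu> \<inter> D = {} then lookup f \<nu> else 0)"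
    by (auto simp: sum.delta in_keys_iff)
  finally show ?thesis .
qed

lemma zap_eq_0_iff: "zap D f = 0 \<longleftrightarrow> (\<forall>\<nu>\<in>keys f. keys \<nu> \<inter> D \<noteq> {})"
  by (auto simp: poly_mapping_eq_iff fun_eq_iff lookup_zap in_keys_iff)

lemma zap_PV: "f \<in> PV V \<Longrightarrow> zap D f \<in> PV (V - D)"
  by (auto simp: PV_def in_keys_iff lookup_zap split: if_splits) (auto simp: in_keys_iff)

lemma homog_zap: "homog d f \<Longrightarrow> homog d (zap D f)"
  by (auto simp: homog_def in_keys_iff lookup_zap split: if_splits)

lemma homog_comp_zap: "homog_comp d (zap D f) = zap D (homog_comp d f)"
  by (rule poly_mapping_eqI) (simp add: lookup_homog_comp lookup_zap)

lemma zap_zap: "zap D (zap E f) = zap (D \<union> E) f"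
  by (rule poly_mapping_eqI) (auto simp: lookup_zap)

lemma zap_id:
  assumes "f \<in> PV V" "V \<inter> D = {}"
  shows "zap D f = f"
proof (rule poly_mapping_eqI)
  fix \<nu>
  show "lookup (zap D f) \<nu> = lookup f \<nu>"
  proof (cases "\<nu> \<in> keys f")
    case True
    then have "keys \<nu> \<inter> D = {}" using assms by (auto simp: PV_def)
    then show ?thesis by (simp add: lookup_zap)
  qed (simp add: lookup_zap in_keys_iff)
qed

section \<open>Ideals and chains of primes\<close>

lemma ideal_PV: "is_ideal n J \<Longrightarrow> f \<in> J \<Longrightarrow> f \<in> PV {..<n}"
  by (auto simp: is_ideal_def P_eq_PV)

lemma ideal_0: "is_ideal n J \<Longrightarrow> 0 \<in> J"
  and ideal_add: "is_ideal n J \<Longrightarrow> f \<in> J \<Longrightarrow> g \<in> J \<Longrightarrow> f + g \<in> J"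
  and ideal_mult: "is_ideal n J \<Longrightarrow> h \<in> PV {..<n} \<Longrightarrow> f \<in> J \<Longrightarrow> h * f \<in> J"
  by (auto simp: is_ideal_def P_eq_PV)

lemma ideal_mult_right: "is_ideal n J \<Longrightarrow> f \<in> J \<Longrightarrow> h \<in> PV {..<n} \<Longrightarrow> f * h \<in> J"
  using ideal_mult[of n J h f] by (simp add: mult.commute)

lemma ideal_uminus: "is_ideal n J \<Longrightarrow> f \<in> J \<Longrightarrow> - f \<in> J"
  using ideal_mult[of n J "- 1" f] by (simp add: PV_uminus)

lemma ideal_minus: "is_ideal n J \<Longrightarrow> f \<in> J \<Longrightarrow> g \<in> J \<Longrightarrow> f - g \<in> J"
  using ideal_add[of n J f "- g"] ideal_uminus[of n J g] by simp

lemma ideal_sum: "is_ideal n J \<Longrightarrow> (\<And>i. i \<in> A \<Longrightarrow> F i \<in> J) \<Longrightarrow> (\<Sum>i\<in>A. F i) \<in> J"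
  by (induction A rule: infinite_finite_induct) (auto intro: ideal_add ideal_0)

lemma prime_is_ideal: "is_prime_ideal n Q \<Longrightarrow> is_ideal n Q"
  by (simp add: is_prime_ideal_def)

lemma prime_idealD:
  "is_prime_ideal n Q \<Longrightarrow> f \<in> PV {..<n} \<Longrightarrow> g \<in> PV {..<n} \<Longrightarrow> f * g \<in> Q \<Longrightarrow> f \<in> Q \<or> g \<in> Q"
  by (simp add: is_prime_ideal_def P_eq_PV)

lemma ideal_adjoin:
  assumes J: "is_ideal n J" and f: "f \<in> PV {..<n}"
  defines "K \<equiv> {a + h * f | a h. a \<in> J \<and> h \<in> PV {..<n}}"
  shows "is_ideal n K" "J \<subseteq> K" "f \<in> K"
proof -
  show "is_ideal n K"
    unfolding is_ideal_def
  proof (intro conjI ballI)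
    show "K \<subseteq> P n"
      using f ideal_PV[OF J] by (auto simp: K_def P_eq_PV intro!: PV_add PV_mult)
    show "0 \<in> K"
      unfolding K_def using ideal_0[OF J] by (intro CollectI exI[of _ 0]) simp
    fix x assume "x \<in> K"
    then obtain a h where x: "x = a + h * f" "a \<in> J" "h \<in> PV {..<n}" by (auto simp: K_def)
    { fix y assume "y \<in> K"
      then obtain b k where y: "y = b + k * f" "b \<in> J" "k \<in> PV {..<n}" by (auto simp: K_def)
      show "x + y \<in> K"
        unfolding K_def using x y ideal_add[OF J] PV_add[of h _ k]
        by (intro CollectI exI[of _ "a + b"] exI[of _ "h + k"]) (auto simp: algebra_simps) }
    { fix y :: "'a mpoly" assume "y \<in> P n"
      then have "y * a \<in> J" "y * h \<in> PV {..<n}" "y * x = y * a + (y * h) * f"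
        using x ideal_mult[OF J, of y a] PV_mult[of y _ h] by (simp_all add: P_eq_PV distrib_left mult.assoc)
      then show "y * x \<in> K" unfolding K_def by blast }
  qed
  show "J \<subseteq> K"
    unfolding K_def by (force intro: exI[of _ 0])
  show "f \<in> K"
    unfolding K_def using ideal_0[OF J] by (intro CollectI exI[of _ 0] exI[of _ 1]) simp
qed

section \<open>Division by a variable, and algebraic independence from chains of primes\<close>

text \<open>The condition on \<open>keys q\<close> transfers every bound on supports from
  \<open>f\<close> to the quotient: the variables that occur, the exponent of the variable
  \<open>j\<close>, and the total degree.\<close>

lemma var_div:
  obtains q where "f = var j * q + zap {j} f" "\<And>\<nu>. \<nu> \<in> keys q \<Longrightarrow> \<nu> + single j 1 \<in> keys f"
proof -
  let ?S = "{\<nu>\<in>keys f. j \<in> keys \<nu>}"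
  define q where "q = (\<Sum>\<nu>\<in>?S. single (\<nu> - single j 1) (lookup f \<nu>))"
  have sub: "\<nu> - single j 1 + single j 1 = \<nu>" if "j \<in> keys \<nu>" for \<nu> :: "nat \<Rightarrow>\<^sub>0 nat"
    using that by (intro poly_mapping_eqI) (auto simp: lookup_add lookup_minus lookup_single' in_keys_iff)
  have "var j * q = (\<Sum>\<nu>\<in>?S. single \<nu> (lookup f \<nu>))"
    unfolding q_def var_def sum_distrib_left mult_single
    by (intro sum.cong) (auto simp: add.commute[of "single j 1"] sub simp del: One_nat_def)
  moreover have "lookup (\<Sum>\<nu>\<in>?S. single \<nu> (lookup f \<nu>)) \<mu> + lookup (zap {j} f) \<mu> = lookup f \<mu>" for \<mu>
    by (auto simp: lookup_sum lookup_zap lookup_single' sum.delta in_keys_iff)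
  ultimately have "f = var j * q + zap {j} f"
    by (intro poly_mapping_eqI) (simp add: lookup_add)
  moreover have "\<nu> + single j 1 \<in> keys f" if \<nu>: "\<nu> \<in> keys q" for \<nu>
  proof -
    obtain \<mu> where "\<mu> \<in> ?S" "\<nu> \<in> keys (single (\<mu> - single j 1) (lookup f \<mu>))"
      using subsetD[OF keys_sum \<nu>[unfolded q_def]] by (elim UN_E) 
    then show ?thesis using sub[of \<mu>] by (auto split: if_splits)
  qed
  ultimately show ?thesis using that by blast
qed

lemma PV_var_div:
  assumes "f \<in> PV V" "\<And>\<nu>. \<nu> \<in> keys q \<Longrightarrow> \<nu> + single j 1 \<in> keys f"
  shows "q \<in> PV V"
  unfolding PV_def
proof (intro CollectI ballI)
  fix \<nu> assume "\<nu> \<in> keys q"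
  then have "keys (\<nu> + single j 1) \<subseteq> V" using assms by (auto simp: PV_def)
  then show "keys \<nu> \<subseteq> V" by (simp add: keys_plus_nat)
qed

text \<open>If \<^term>\<open>f k\<close> separates \<^term>\<open>Q k\<close> from its successor in a chain of primes, then a relation
  modulo \<^term>\<open>Q j\<close> can be divided by the lowest variable until its constant coefficient is nonzero; that
  coefficient is then a relation of the later elements modulo the next prime.\<close>

lemma chain_alg_indep:
  fixes Q :: "nat \<Rightarrow> 'k::field mpoly set"
  assumes prime: "\<And>k. k \<le> d \<Longrightarrow> is_prime_ideal n (Q k)"
    and step: "\<And>k. k < d \<Longrightarrow> Q k \<subseteq> Q (Suc k)"
    and f: "\<And>k. k < d \<Longrightarrow> f k \<in> Q (Suc k) - Q k"
    and p: "j \<le> d" "p \<in> PV {j..<d}" "subst f p \<in> Q j"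
  shows "p = 0"
  using p
proof (induction arbitrary: p rule: inc_induct)
  case base
  have "p = single 0 (lookup p 0)"
    using base.prems(1) by (intro poly_mapping_eqI) (auto simp: PV_def lookup_single' in_keys_iff)
  then have c: "single 0 (lookup p 0) \<in> Q d" 
    using base.prems(2) by (metis subst_const)
  show ?case
  proof (rule ccontr)
    assume "p \<noteq> 0"
    with \<open>p = _\<close> have "lookup p 0 \<noteq> 0" by (metis single_zero)
    with ideal_mult[OF prime_is_ideal[OF prime[of d]] PV_const c, of "inverse (lookup p 0)"]
    have "1 \<in> Q d" by (simp add: mult_single)
    with prime[of d] show False by (simp add: is_prime_ideal_def)
  qed
next
  case (step j)
  have fPV: "f i \<in> PV {..<n}" if "i < d" for i
    using f[OF that] ideal_PV[OF prime_is_ideal[OF prime[of "Suc i"]]] that by auto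
  have "\<And>p. (\<forall>\<nu>\<in>keys p. lookup \<nu> j < e) \<Longrightarrow> p \<in> PV {j..<d} \<Longrightarrow> subst f p \<in> Q j \<Longrightarrow> p = 0" for e
  proof (induction e)
    case 0
    then show ?case by (intro poly_mapping_eqI) (auto simp: in_keys_iff)
  next
    case (Suc e)
    obtain q where q: "p = var j * q + zap {j} p" "\<And>\<nu>. \<nu> \<in> keys q \<Longrightarrow> \<nu> + single j 1 \<in> keys p"
      using var_div[of p j] by blast
    have qPV: "q \<in> PV {j..<d}"
      using PV_var_div[OF Suc.prems(2) q(2)] .
    have "lookup \<nu> j < e" if "\<nu> \<in> keys q" for \<nu>
      using Suc.prems(1) q(2)[OF that] by (fastforce simp: lookup_add)
    note IH = Suc.IH[OF _ qPV]
    have sq: "subst f q \<in> PV {..<n}"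
      using fPV by (intro PV_subst[OF qPV]) auto
    have Qj: "is_ideal n (Q j)" "is_ideal n (Q (Suc j))" using prime step by (auto intro: prime_is_ideal)
    have "f j \<in> Q (Suc j)" using f[of j] step by auto
    then have "f j * subst f q \<in> Q (Suc j)" by (intro ideal_mult_right[OF Qj(2)] sq)
    moreover have e: "subst f p = f j * subst f q + subst f (zap {j} p)"
      by (subst (1) q(1)) (simp add: subst.hom_add subst.hom_mult)
    moreover have "subst f p \<in> Q (Suc j)" using Suc.prems step assms(2)[of j] by auto
    ultimately have "subst f (zap {j} p) \<in> Q (Suc j)"
      using ideal_minus[OF Qj(2)] by (metis add_diff_cancel_left')
    moreover have "{j..<d} - {j} = {Suc j..<d}" by auto
    ultimately have z: "zap {j} p = 0"
      using step.IH zap_PV[OF Suc.prems(2), of "{j}"] by simp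
    then have "f j * subst f q \<in> Q j" using e Suc.prems(3) by simp
    \<comment> \<open>Here primality cancels \<open>f j\<close>, which lies outside
      \<open>Q j\<close>. The quotient \<open>q\<close> has smaller exponents in the variable
      \<open>j\<close>, so the inner induction applies.\<close>
    then have "subst f q \<in> Q j"
      using prime_idealD[OF prime[of j] _ sq] f[of j] fPV[of j] step by auto
    then have "q = 0" using IH \<open>\<And>\<nu>. \<nu> \<in> keys q \<Longrightarrow> lookup \<nu> j < e\<close> by blast
    with q(1) z show ?case by simp
  qed
  moreover have "\<forall>\<nu>\<in>keys p. lookup \<nu> j < Suc (\<Sum>\<nu>\<in>keys p. lookup \<nu> j)"
    using member_le_sum[of _ "keys p" "\<lambda>\<nu>. lookup \<nu> j"] by (auto simp: less_Suc_eq_le)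
  ultimately show ?case
    using step.prems by blast
qed

section \<open>Linear dependence modulo an ideal\<close>

text \<open>Gaussian elimination by induction on the equations: if some unknown \<open>a0\<close>
  has a nonzero coefficient in the new equation, it is solved for and substituted into the remaining
  ones.\<close>

lemma homogeneous_system_nontrivial_solution:
  fixes M :: "'a \<Rightarrow> 'b \<Rightarrow> 'k::field"
  assumes "finite B" "finite A" "card B < card A"
  shows "\<exists>c. (\<exists>a\<in>A. c a \<noteq> 0) \<and> (\<forall>b\<in>B. (\<Sum>a\<in>A. c a * M a b) = 0)"
  using assms
proof (induction B arbitrary: A M rule: finite_induct)
  case empty
  then obtain a where "a \<in> A" by fastforce
  then show ?case by (intro exI[of _ "\<lambda>_. 1"]) auto
next
  case (insert b B)
  show ?case
  proof (cases "\<forall>a\<in>A. M a b = 0")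
    case True
    have "card B < card A" using insert by simp
    from insert.IH[OF insert.prems(1) this, of M] True show ?thesis by auto
  next
    case False
    then obtain a0 where a0: "a0 \<in> A" "M a0 b \<noteq> 0" by blast
    let ?A = "A - {a0}"
    define r where "r a = M a b / M a0 b" for a
    have "card B < card ?A" using insert a0 by simp
    from insert.IH[OF _ this, of "\<lambda>a b'. M a b' - r a * M a0 b'"] insert.prems
    obtain c where c: "\<exists>a\<in>?A. c a \<noteq> 0"
      "\<And>b'. b' \<in> B \<Longrightarrow> (\<Sum>a\<in>?A. c a * (M a b' - r a * M a0 b')) = 0" by auto
    define c' where "c' a = (if a = a0 then - (\<Sum>a\<in>?A. c a * r a) else c a)" for a
    have s: "(\<Sum>a\<in>A. c' a * M a b') = (\<Sum>a\<in>?A. c a * (M a b' - r a * M a0 b'))" for b'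
    proof -
      have "(\<Sum>a\<in>A. c' a * M a b') = c' a0 * M a0 b' + (\<Sum>a\<in>?A. c' a * M a b')"
        using a0 insert.prems by (intro sum.remove) auto
      also have "(\<Sum>a\<in>?A. c' a * M a b') = (\<Sum>a\<in>?A. c a * M a b')"
        by (intro sum.cong) (auto simp: c'_def)
      also have "c' a0 * M a0 b' = - (\<Sum>a\<in>?A. c a * r a * M a0 b')"
        by (simp add: c'_def sum_distrib_right)
      finally show ?thesis by (simp add: algebra_simps sum_subtractf)
    qed
    have "(\<Sum>a\<in>A. c' a * M a b) = 0"
      unfolding s using a0 by (intro sum.neutral) (auto simp: r_def)
    moreover have "\<exists>a\<in>A. c' a \<noteq> 0" using c(1) by (auto simp: c'_def)
    ultimately show ?thesis using c(2) s by (intro exI[of _ c']) auto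
  qed
qed

text \<open>Modulo \<open>J\<close> all the \<open>F a\<close> lie in the span of the monomials in
  \<open>B\<close>, which are fewer than the \<open>F a\<close>.\<close>

lemma dependent_mod_ideal:
  fixes F :: "'a \<Rightarrow> 'k::field mpoly"
  assumes J: "is_ideal n J" and AB: "finite B" "finite A" "card B < card A"
    and F: "\<And>a. a \<in> A \<Longrightarrow> \<exists>j\<in>J. keys (F a - j) \<subseteq> B"
  shows "\<exists>c. (\<exists>a\<in>A. c a \<noteq> 0) \<and> (\<Sum>a\<in>A. single 0 (c a) * F a) \<in> J"
proof -
  from F obtain j where j: "\<And>a. a \<in> A \<Longrightarrow> j a \<in> J" "\<And>a. a \<in> A \<Longrightarrow> keys (F a - j a) \<subseteq> B" by metis
  from homogeneous_system_nontrivial_solution[OF AB, of "\<lambda>a. lookup (F a - j a)"]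
  obtain c where c: "\<exists>a\<in>A. c a \<noteq> 0" "\<And>b. b \<in> B \<Longrightarrow> (\<Sum>a\<in>A. c a * lookup (F a - j a) b) = 0" by blast
  have "lookup (\<Sum>a\<in>A. single 0 (c a) * (F a - j a)) \<nu> = (\<Sum>a\<in>A. c a * lookup (F a - j a) \<nu>)" for \<nu>
    by (simp only: lookup_sum lookup_const_mult)
  also have "\<dots> \<nu> = 0" for \<nu>
    using c(2)[of \<nu>] j(2) by (cases "\<nu> \<in> B") (auto simp: in_keys_iff subset_iff intro!: sum.neutral)
  finally have "(\<Sum>a\<in>A. single 0 (c a) * (F a - j a)) = 0"
    by (intro poly_mapping_eqI) simp
  then have "(\<Sum>a\<in>A. single 0 (c a) * F a) = (\<Sum>a\<in>A. single 0 (c a) * j a)"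
    by (simp add: algebra_simps sum_subtractf)
  also have "\<dots> \<in> J" by (intro ideal_sum[OF J] ideal_mult[OF J] j) auto
  finally show ?thesis using c(1) by blast
qed

section \<open>Chains of primes from finiteness over a coordinate subring\<close>

text \<open>Zorn's lemma: an ideal maximal among those over \<open>J\<close> that avoid
  \<open>W\<close> is prime. Adjoining either of two elements outside it produces an element of
  \<open>W\<close>; if their product were in the ideal, so would be the product of these two
  elements of \<open>W\<close>.\<close>

lemma prime_avoiding_multiplicative_set:
  fixes J :: "'k::comm_ring_1 mpoly set"
  assumes J: "is_ideal n J" and W: "1 \<in> W" "\<And>u v. u \<in> W \<Longrightarrow> v \<in> W \<Longrightarrow> u * v \<in> W"
    and JW: "J \<inter> W = {}"
  shows "\<exists>Q. is_prime_ideal n Q \<and> J \<subseteq> Q \<and> Q \<inter> W = {}"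
proof -
  define S where "S = {K. is_ideal n K \<and> J \<subseteq> K \<and> K \<inter> W = {}}"
  have "\<exists>M\<in>S. \<forall>X\<in>S. M \<subseteq> X \<longrightarrow> X = M"
  proof (rule subset_Zorn_nonempty)
    show "S \<noteq> {}" using J JW by (auto simp: S_def)
  next
    fix C assume ne: "C \<noteq> {}" and "subset.chain S C"
    then have C: "\<And>K. K \<in> C \<Longrightarrow> is_ideal n K \<and> J \<subseteq> K \<and> K \<inter> W = {}"
      and lin: "\<And>K L. K \<in> C \<Longrightarrow> L \<in> C \<Longrightarrow> K \<subseteq> L \<or> L \<subseteq> K"
      unfolding subset.chain_def S_def by blast+
    have "f + g \<in> \<Union>C" if "f \<in> K" "g \<in> L" "K \<in> C" "L \<in> C" for f g K L
      using lin[OF that(3,4)] that ideal_add[of n K f g] ideal_add[of n L f g] C by blast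
    moreover have "h * f \<in> \<Union>C" if "f \<in> K" "K \<in> C" "h \<in> P n" for f h K
      using that C[of K] ideal_mult[of n K h f] by (metis P_eq_PV UnionI)
    ultimately have "is_ideal n (\<Union>C)"
      unfolding is_ideal_def
    proof (intro conjI)
      show "\<Union>C \<subseteq> P n" using C unfolding is_ideal_def by blast
      show "0 \<in> \<Union>C" using C ne ideal_0 by blast
    qed blast+
    then show "\<Union>C \<in> S" unfolding S_def using C ne by auto
  qed
  then obtain M where M: "M \<in> S" and max: "\<And>X. X \<in> S \<Longrightarrow> M \<subseteq> X \<Longrightarrow> X = M" by blast
  have MI: "is_ideal n M" "J \<subseteq> M" "M \<inter> W = {}" using M by (auto simp: S_def)
  have meets: "\<exists>a h. a \<in> M \<and> h \<in> PV {..<n} \<and> a + h * f \<in> W" if f: "f \<in> PV {..<n}" "f \<notin> M" for f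
  proof (rule ccontr)
    assume "\<not> ?thesis"
    then have "{a + h * f | a h. a \<in> M \<and> h \<in> PV {..<n}} \<in> S"
      unfolding S_def using ideal_adjoin[OF MI(1) f(1)] MI(2) by blast
    from max[OF this ideal_adjoin(2)[OF MI(1) f(1)]] ideal_adjoin(3)[OF MI(1) f(1)] f(2)
    show False by simp
  qed
  have "f \<in> M \<or> g \<in> M" if fg: "f \<in> PV {..<n}" "g \<in> PV {..<n}" "f * g \<in> M" for f g
  proof (rule ccontr)
    assume "\<not> ?thesis"
    then obtain a h b k where 1: "a \<in> M" "h \<in> PV {..<n}" "a + h * f \<in> W"
      and 2: "b \<in> M" "k \<in> PV {..<n}" "b + k * g \<in> W"
      using meets fg by metis
    have "(a + h * f) * (b + k * g) = (b + k * g) * a + (h * f) * b + (h * k) * (f * g)"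
      by (simp add: algebra_simps)
    also have "\<dots> \<in> M"
      by (intro ideal_add[OF MI(1)] ideal_mult[OF MI(1)] PV_mult PV_add 1 2 fg ideal_PV[OF MI(1)])
    finally show False using W(2)[OF 1(3) 2(3)] MI(3) by blast
  qed
  moreover have "1 \<notin> M" using MI(3) W(1) by blast
  ultimately show ?thesis
    using MI by (auto simp: is_prime_ideal_def P_eq_PV)
qed

lemma det_in_PV:
  assumes A: "A \<in> carrier_mat t t" and "\<And>i j. i < t \<Longrightarrow> j < t \<Longrightarrow> A $$ (i, j) \<in> PV V"
  shows "det A \<in> PV V"
  unfolding det_def'[OF A]
proof (intro PV_sum PV_mult PV_prod)
  fix p assume "p \<in> {p. p permutes {0..<t}}"
  then show "A $$ (i, p i) \<in> PV V" if "i \<in> {0..<t}" for i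
    using assms(2) that permutes_in_image by fastforce
  show "of_int (sign p) \<in> PV V"
    by (cases p rule: sign_cases) (auto intro: PV_uminus)
qed

text \<open>The quotient by \<open>J\<close> is a finite module over the polynomial ring in
  \<open>D\<close>. Listing 1 as the first generator lets the determinant trick put the determinant
  itself into \<open>J\<close>.\<close>

definition fin_gen_over :: "nat \<Rightarrow> 'k::comm_ring_1 mpoly set \<Rightarrow> nat set \<Rightarrow> bool" where
  "fin_gen_over n J D \<longleftrightarrow> (\<exists>t (e :: nat \<Rightarrow> 'k mpoly). t > 0 \<and> e 0 = 1 \<and> (\<forall>i<t. e i \<in> PV {..<n}) \<and>
     (\<forall>f\<in>PV {..<n}. \<exists>a. (\<forall>i<t. a i \<in> PV D) \<and> f - (\<Sum>i<t. a i * e i) \<in> J))"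

text \<open>The polynomial ring in \<open>D\<close> embeds into the quotient by \<open>J\<close>;
  together with \<open>fin_gen_over\<close> this is a Noether normalization.\<close>

definition vars_indep :: "'k::comm_ring_1 mpoly set \<Rightarrow> nat set \<Rightarrow> bool" where
  "vars_indep J D \<longleftrightarrow> (\<forall>f\<in>J. f \<in> PV D \<longrightarrow> f = 0)"

lemma fin_gen_overE:
  assumes "fin_gen_over n J D"
  obtains t and e :: "nat \<Rightarrow> 'k::comm_ring_1 mpoly" where "t > 0" "e 0 = 1" "\<And>i. i < t \<Longrightarrow> e i \<in> PV {..<n}"
    "\<And>f. f \<in> PV {..<n} \<Longrightarrow> \<exists>a. (\<forall>i<t. a i \<in> PV D) \<and> f - (\<Sum>i<t. a i * e i) \<in> J"
proof -
  from assms obtain t and e :: "nat \<Rightarrow> 'k mpoly" where "t > 0 \<and> e 0 = 1 \<and> (\<forall>i<t. e i \<in> PV {..<n}) \<and>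
     (\<forall>f\<in>PV {..<n}. \<exists>a. (\<forall>i<t. a i \<in> PV D) \<and> f - (\<Sum>i<t. a i * e i) \<in> J)"
    unfolding fin_gen_over_def by (elim exE)
  then show thesis by (intro that[of t e]) simp_all
qed

lemma fin_gen_over_mono:
  fixes J :: "'k::comm_ring_1 mpoly set"
  assumes "fin_gen_over n J D" "J \<subseteq> J'"
  shows "fin_gen_over n J' D"
proof -
  obtain t and e :: "nat \<Rightarrow> 'k mpoly" where te: "t > 0" "e 0 = 1" "\<And>i. i < t \<Longrightarrow> e i \<in> PV {..<n}"
    "\<And>f. f \<in> PV {..<n} \<Longrightarrow> \<exists>a. (\<forall>i<t. a i \<in> PV D) \<and> f - (\<Sum>i<t. a i * e i) \<in> J"
    by (rule fin_gen_overE[OF assms(1)]) (rule that)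
  show ?thesis
    unfolding fin_gen_over_def
  proof (rule exI[of _ t], rule exI[of _ e], intro conjI ballI)
    fix f :: "'k mpoly" assume "f \<in> PV {..<n}"
    from te(4)[OF this] assms(2)
    show "\<exists>a. (\<forall>i<t. a i \<in> PV D) \<and> f - (\<Sum>i<t. a i * e i) \<in> J'" by (meson subsetD)
  qed (use te in auto)
qed

text \<open>Multiplication by \<^term>\<open>s\<close> on the generators gives a matrix \<open>A\<close> over the polynomial ring in \<open>D\<close>. By
  the determinant trick \<open>det (w - x\<^sub>b A)\<close> lies in \<open>J\<close>, so it vanishes; its value at \<open>x\<^sub>b = 0\<close> is a power of \<open>w\<close>.\<close>

lemma var_not_unit_mod:
  fixes J :: "'k::field mpoly set"
  assumes J: "is_ideal n J" and D: "D \<subseteq> {..<n}" and gen: "fin_gen_over n J D" and indep: "vars_indep J D"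
    and b: "b \<in> D" and s: "s \<in> PV {..<n}" and w: "w \<in> PV (D - {b})" and ws: "w - var b * s \<in> J"
  shows "w = 0"
proof -
  obtain t and e :: "nat \<Rightarrow> 'k mpoly" where t: "t > 0" "e 0 = 1" "\<And>i. i < t \<Longrightarrow> e i \<in> PV {..<n}"
    and g: "\<And>f. f \<in> PV {..<n} \<Longrightarrow> \<exists>a. (\<forall>i<t. a i \<in> PV D) \<and> f - (\<Sum>i<t. a i * e i) \<in> J"
    by (rule fin_gen_overE[OF gen]) (rule that)
  have "\<exists>a. \<forall>i<t. (\<forall>j<t. a i j \<in> PV D) \<and> s * e i - (\<Sum>j<t. a i j * e j) \<in> J"
    using g[OF PV_mult[OF s t(3)]] by metis
  then obtain a where a: "\<And>i j. i < t \<Longrightarrow> j < t \<Longrightarrow> a i j \<in> PV D"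
    and aJ: "\<And>i. i < t \<Longrightarrow> s * e i - (\<Sum>j<t. a i j * e j) \<in> J" by blast
  define M where "M = mat t t (\<lambda>(i, j). (if i = j then w else 0) - var b * a i j)"
  have M: "M \<in> carrier_mat t t" by (simp add: M_def)
  have MPV: "M $$ (i, j) \<in> PV D" if "i < t" "j < t" for i j
    using that a b w PV_mono[of "D - {b}" D] by (auto simp: M_def intro!: PV_minus PV_mult PV_uminus)
  have wn: "var b \<in> PV {..<n}" using b D by auto
  have row: "(\<Sum>j<t. M $$ (i, j) * e j) \<in> J" if i: "i < t" for i
  proof -
    have "(\<Sum>j<t. M $$ (i, j) * e j) = (\<Sum>j<t. (if j = i then w * e i else 0)) - var b * (\<Sum>j<t. a i j * e j)"
      unfolding sum_distrib_left sum_subtractf[symmetric] using i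
      by (intro sum.cong) (auto simp: M_def algebra_simps)
    also have "\<dots> = (w - var b * s) * e i + var b * (s * e i - (\<Sum>j<t. a i j * e j))"
      using i by (simp add: sum.delta algebra_simps)
    also have "\<dots> \<in> J"
      by (intro ideal_add[OF J] ideal_mult[OF J] ideal_mult_right[OF J] ws aJ i t wn)
    finally show ?thesis .
  qed
  have adjPV: "adj_mat M $$ (0, k) \<in> PV {..<n}" if k: "k < t" for k
  proof -
    have "mat_delete M k 0 $$ (i, j) \<in> PV {..<n}" if "i < t - 1" "j < t - 1" for i j
      using that M k MPV PV_mono[OF D] by (auto simp: mat_delete_def)
    moreover have "mat_delete M k 0 \<in> carrier_mat (t - 1) (t - 1)"
      using M by (rule mat_delete_carrier)
    ultimately have "det (mat_delete M k 0) \<in> PV {..<n}" by (intro det_in_PV)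
    then show ?thesis
      using M k t(1) by (auto simp: adj_mat_def cofactor_def intro!: PV_mult PV_power PV_uminus)
  qed
  \<comment> \<open>Row 0 of the identity for the adjugate, applied to the vector of generators:
    since \<open>e 0 = 1\<close>, the left side is \<open>det M\<close>, and the right side combines
    the rows already known to lie in \<open>J\<close>.\<close>
  have "det M = (\<Sum>j<t. (det M \<cdot>\<^sub>m 1\<^sub>m t) $$ (0, j) * e j)"
    using t(1,2) by (subst sum.remove[of _ 0]) (auto intro!: sum.neutral)
  also have "\<dots> = (\<Sum>j<t. (\<Sum>k<t. adj_mat M $$ (0, k) * M $$ (k, j)) * e j)"
    unfolding adj_mat(3)[OF M, symmetric] using adj_mat(1)[OF M] M t(1)
    by (intro sum.cong) (auto simp: scalar_prod_def atLeast0LessThan intro!: sum.cong)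
  also have "\<dots> = (\<Sum>k<t. adj_mat M $$ (0, k) * (\<Sum>j<t. M $$ (k, j) * e j))"
    unfolding sum_distrib_left sum_distrib_right by (subst sum.swap) (simp add: mult.assoc)
  also have "\<dots> \<in> J" by (intro ideal_sum[OF J] ideal_mult[OF J] row adjPV) auto
  finally have "det M = 0"
    using det_in_PV[OF M MPV] indep unfolding vars_indep_def by blast
  then have "det (map_mat (zap {b}) M) = 0" by (simp add: zap.hom_det)
  moreover have "zap {b} w = w" using w by (intro zap_id[of _ "D - {b}"]) auto
  then have "map_mat (zap {b}) M = w \<cdot>\<^sub>m 1\<^sub>m t"
    by (intro eq_matI) (auto simp: M_def zap.hom_minus zap.hom_mult)
  ultimately have "w ^ t = 0" by simp
  then show ?thesis by simp
qed

text \<open>Induction on \<open>D\<close>. A prime \<open>Q0\<close> over \<open>J\<close> that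
  avoids all nonzero polynomials in the variables of \<open>D\<close> starts the chain, and x_b is
  adjoined to it. Finiteness over the other variables persists by setting x_b to zero in the
  coefficients. Independence persists by \<open>var_not_unit_mod\<close>: a relation free of x_b in
  the larger ideal is a multiple of x_b modulo \<open>Q0\<close>. The chain is strict at its start
  because x_b is not in \<open>Q0\<close>.\<close>

lemma exists_prime_chain:
  fixes J :: "'k::field mpoly set"
  assumes "D \<subseteq> {..<n}" "is_ideal n J" "fin_gen_over n J D" "vars_indep J D"
  shows "\<exists>Q :: nat \<Rightarrow> 'k mpoly set. (\<forall>k\<le>card D. is_prime_ideal n (Q k) \<and> J \<subseteq> Q k)
      \<and> (\<forall>k<card D. Q k \<subset> Q (Suc k))"
  using finite_subset[OF assms(1) finite_lessThan] assms
proof (induction D arbitrary: J rule: finite_induct)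
  case empty
  \<comment> \<open>For empty \<open>D\<close> the avoided set consists of the nonzero constants, so
    independence just says that \<open>J\<close> is proper.\<close>
  have "J \<inter> (PV {} - {0}) = {}" using empty by (auto simp: vars_indep_def)
  from prime_avoiding_multiplicative_set[OF empty(2) _ _ this] obtain Q
    where "is_prime_ideal n Q" "J \<subseteq> Q" by (auto intro: PV_mult)
  then show ?case by (intro exI[of _ "\<lambda>_. Q"]) auto
next
  case (insert b D)
  note J = insert.prems(2)
  have "J \<inter> (PV (insert b D) - {0}) = {}" using insert.prems by (auto simp: vars_indep_def)
  from prime_avoiding_multiplicative_set[OF J _ _ this] obtain Q0
    where Q0: "is_prime_ideal n Q0" "J \<subseteq> Q0" "Q0 \<inter> (PV (insert b D) - {0}) = {}" by (auto intro: PV_mult)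
  note Q0I = prime_is_ideal[OF Q0(1)]
  have bn: "b < n" "D \<subseteq> {..<n}" using insert.prems by auto
  define J1 where "J1 = {a + h * var b | a h. a \<in> Q0 \<and> h \<in> PV {..<n}}"
  have vb: "(var b :: 'k mpoly) \<in> PV {..<n}" using bn by auto
  note J1 = ideal_adjoin[OF Q0I vb, folded J1_def]
  have Q0gen: "fin_gen_over n Q0 (insert b D)"
    by (rule fin_gen_over_mono[OF insert.prems(3) Q0(2)])
  have Q0ind: "vars_indep Q0 (insert b D)" using Q0(3) by (auto simp: vars_indep_def)
  have "fin_gen_over n J1 D"
  proof -
    obtain t and e :: "nat \<Rightarrow> 'k mpoly" where t: "t > 0" "e 0 = 1" "\<And>i. i < t \<Longrightarrow> e i \<in> PV {..<n}"
      and g: "\<And>f. f \<in> PV {..<n} \<Longrightarrow> \<exists>a. (\<forall>i<t. a i \<in> PV (insert b D)) \<and> f - (\<Sum>i<t. a i * e i) \<in> Q0"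
      by (rule fin_gen_overE[OF Q0gen]) (rule that)
    have "\<exists>a. (\<forall>i<t. a i \<in> PV D) \<and> f - (\<Sum>i<t. a i * e i) \<in> J1" if f: "f \<in> PV {..<n}" for f
    proof -
      obtain a where a: "\<And>i. i < t \<Longrightarrow> a i \<in> PV (insert b D)" "f - (\<Sum>i<t. a i * e i) \<in> Q0"
        using g[OF f] by blast
      have "zap {b} (a i) \<in> PV D" if "i < t" for i
        using zap_PV[OF a(1)[OF that], of "{b}"] insert.hyps by simp
      moreover have "(a i - zap {b} (a i)) * e i \<in> J1" if i: "i < t" for i
      proof -
        obtain q where q: "a i = var b * q + zap {b} (a i)" "\<And>\<nu>. \<nu> \<in> keys q \<Longrightarrow> \<nu> + single b 1 \<in> keys (a i)"
          using var_div[of "a i" b] by blast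
        have "q \<in> PV {..<n}"
          using PV_var_div[OF a(1)[OF i] q(2)] PV_mono[OF insert.prems(1)] by auto
        then have "var b * q * e i \<in> J1"
          by (intro ideal_mult_right[OF J1(1)] J1(3) t(3) i)
        then show ?thesis by (subst (1) q(1)) simp
      qed
      then have "(\<Sum>i<t. (a i - zap {b} (a i)) * e i) \<in> J1" by (intro ideal_sum[OF J1(1)]) auto
      then have "(f - (\<Sum>i<t. a i * e i)) + (\<Sum>i<t. (a i - zap {b} (a i)) * e i) \<in> J1"
        using a(2) J1(2) by (intro ideal_add[OF J1(1)]) auto
      then have "f - (\<Sum>i<t. zap {b} (a i) * e i) \<in> J1"
        by (simp add: algebra_simps sum_subtractf)
      ultimately show ?thesis by (intro exI[of _ "\<lambda>i. zap {b} (a i)"]) auto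
    qed
    then show ?thesis
      unfolding fin_gen_over_def using t by (intro exI[of _ t] exI[of _ e]) simp
  qed
  moreover have "vars_indep J1 D"
    unfolding vars_indep_def
  proof (intro ballI impI)
    fix f assume "f \<in> J1" and f: "f \<in> PV D"
    then obtain a h where h: "f = a + h * var b" "a \<in> Q0" "h \<in> PV {..<n}" by (auto simp: J1_def)
    then have "f - var b * h \<in> Q0" by (simp add: mult.commute)
    with var_not_unit_mod[OF Q0I insert.prems(1) Q0gen Q0ind insertI1 h(3), of f] f insert.hyps
    show "f = 0" by simp
  qed
  ultimately obtain Q where Q: "\<forall>k\<le>card D. is_prime_ideal n (Q k) \<and> J1 \<subseteq> Q k" "\<forall>k<card D. Q k \<subset> Q (Suc k)"
    using insert.IH[OF bn(2) J1(1)] by blast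
  have "var b \<notin> Q0"
  proof
    assume "var b \<in> Q0"
    then have "var b = (0 :: 'k mpoly)" using Q0ind by (auto simp: vars_indep_def)
    then have "lookup (var b :: 'k mpoly) (single b 1) = 0" by (simp only: lookup_zero)
    then show False by (simp add: var_def)
  qed
  then have "Q0 \<subset> Q 0" using Q(1) J1(2,3) by blast
  then show ?case
    using Q Q0 J1(2) insert.hyps
    by (intro exI[of _ "case_nat Q0 Q"]) (auto split: nat.splits simp: less_Suc_eq_le subset_iff)
qed

section \<open>Linear changes of coordinates\<close>

definition lin :: "nat \<Rightarrow> (nat \<Rightarrow> nat \<Rightarrow> 'k::field) \<Rightarrow> nat \<Rightarrow> 'k mpoly" where
  "lin n g i = (\<Sum>j<n. single 0 (g i j) * var j)"

lemma act_eq: "act n g I = subst (lin n g) ` I"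
  unfolding act_def lin_def ..

lemma lin_PV: "lin n g i \<in> PV {..<n}"
  unfolding lin_def by (intro PV_sum PV_mult) auto

lemma homog_lin: "homog 1 (lin n g i)"
  unfolding lin_def using homog_mult[OF homog_const homog_var] by (intro homog_sum) auto

lemma subst_lin_PV: "f \<in> PV {..<n} \<Longrightarrow> subst (lin n g) f \<in> PV {..<n}"
  by (rule PV_subst) (auto intro: lin_PV)

lemma homog_subst_lin: "homog d f \<Longrightarrow> homog d (subst (lin n g) f)"
  by (rule homog_subst[OF _ homog_lin])

lemma zap_lin: "zap D (lin n g i) = (\<Sum>j\<in>{..<n} - D. single 0 (g i j) * var j)"
proof -
  have "zap D (lin n g i) = (\<Sum>j<n. single 0 (g i j) * (if j \<in> D then 0 else var j))"
    unfolding lin_def by (simp add: zap.hom_sum zap.hom_mult)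
  also have "\<dots> = (\<Sum>j\<in>{..<n} - D. single 0 (g i j) * var j)"
    by (intro sum.mono_neutral_cong_right) auto
  finally show ?thesis .
qed

text \<open>Entries outside the n by n block are set to zero because membership in
  \<open>GL n\<close> demands it.\<close>

definition matmul :: "nat \<Rightarrow> (nat \<Rightarrow> nat \<Rightarrow> 'k::field) \<Rightarrow> (nat \<Rightarrow> nat \<Rightarrow> 'k) \<Rightarrow> nat \<Rightarrow> nat \<Rightarrow> 'k" where
  "matmul n g h i j = (if i < n \<and> j < n then (\<Sum>k<n. g i k * h k j) else 0)"

definition one_mat_fun :: "nat \<Rightarrow> nat \<Rightarrow> nat \<Rightarrow> 'k::field" where
  "one_mat_fun n i j = (if i < n \<and> i = j then 1 else 0)"

text \<open>Matrices act on variables by their rows, so applying \<open>g\<close> first and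
  \<open>h\<close> second gives the product in the order g h.\<close>

lemma subst_lin_subst_lin:
  assumes "f \<in> PV {..<n}"
  shows "subst (lin n h) (subst (lin n g) f) = subst (lin n (matmul n g h)) f"
  unfolding subst_subst
proof (rule subst_ext[OF subst.comm_ring_hom_axioms])
  fix \<nu> i assume "\<nu> \<in> keys f" "i \<in> keys \<nu>"
  then have i: "i < n" using assms by (auto simp: PV_def)
  have "subst (lin n h) (lin n g i) = (\<Sum>k<n. \<Sum>j<n. single 0 (g i k * h k j) * var j)"
    by (simp add: lin_def[of n g] subst.hom_sum subst.hom_mult)
      (simp add: lin_def sum_distrib_left mult.assoc[symmetric] mult_single)
  also have "\<dots> = (\<Sum>j<n. \<Sum>k<n. single 0 (g i k * h k j) * var j)"
    by (rule sum.swap)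
  also have "\<dots> = lin n (matmul n g h) i"
  proof -
    interpret c: comm_ring_hom "single 0 :: 'a \<Rightarrow> 'a mpoly" by (rule const_hom)
    show ?thesis using i by (simp add: lin_def[of n "matmul n g h"] matmul_def c.hom_sum sum_distrib_right)
  qed
  finally show "subst (\<lambda>i. subst (lin n h) (lin n g i)) (var i) = lin n (matmul n g h) i" by simp
qed simp

lemma subst_lin_one: "f \<in> PV {..<n} \<Longrightarrow> subst (lin n (one_mat_fun n)) f = f"
proof (rule subst_id)
  fix \<nu> i assume f: "f \<in> PV {..<n}" "\<nu> \<in> keys f" "i \<in> keys \<nu>"
  then have i: "i < n" by (auto simp: PV_def)
  have "lin n (one_mat_fun n) i = (\<Sum>j<n. if j = i then var j else (0 :: 'a mpoly))"
    unfolding lin_def using i by (intro sum.cong) (auto simp: one_mat_fun_def)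
  then show "lin n (one_mat_fun n) i = (var i :: 'a mpoly)" using i by simp
qed

lemma GL_zero: "g \<in> GL n \<Longrightarrow> n \<le> i \<or> n \<le> j \<Longrightarrow> g i j = 0"
  by (auto simp: GL_def)

lemma GL_I:
  assumes "\<And>i j. n \<le> i \<or> n \<le> j \<Longrightarrow> g i j = 0"
    and "\<And>i j. i < n \<Longrightarrow> j < n \<Longrightarrow> (\<Sum>k<n. g i k * h k j) = (if i = j then 1 else 0)"
  shows "g \<in> GL n"
  unfolding GL_def using assms by blast

definition jmat :: "nat \<Rightarrow> (nat \<Rightarrow> nat \<Rightarrow> 'k) \<Rightarrow> 'k mat" where
  "jmat n g = mat n n (\<lambda>(i, j). g i j)"

lemma jmat_carrier [simp]: "jmat n g \<in> carrier_mat n n"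
  by (simp add: jmat_def)

lemma jmat_mult_eq_1_iff:
  "jmat n g * jmat n h = 1\<^sub>m n \<longleftrightarrow>
    (\<forall>i<n. \<forall>j<n. (\<Sum>k<n. g i k * h k j) = (if i = j then 1 else (0 :: 'k::field)))"
  by (auto simp: jmat_def mat_eq_iff scalar_prod_def atLeast0LessThan)

lemma GL_inverse:
  assumes g: "g \<in> GL n"
  obtains h where "h \<in> GL n" "matmul n g h = one_mat_fun n" "matmul n h g = one_mat_fun n"
proof -
  from g obtain h0 where h0: "\<forall>i<n. \<forall>j<n. (\<Sum>k<n. g i k * h0 k j) = (if i = j then 1 else 0)"
    unfolding GL_def by blast
  define h where "h i j = (if i < n \<and> j < n then h0 i j else 0)" for i j
  have gh: "\<forall>i<n. \<forall>j<n. (\<Sum>k<n. g i k * h k j) = (if i = j then 1 else 0)"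
    using h0 by (simp add: h_def)
  then have "jmat n h * jmat n g = 1\<^sub>m n"
    by (intro mat_mult_left_right_inverse[of "jmat n g"]) (auto simp: jmat_mult_eq_1_iff)
  then have hg: "\<forall>i<n. \<forall>j<n. (\<Sum>k<n. h i k * g k j) = (if i = j then 1 else 0)"
    by (simp add: jmat_mult_eq_1_iff)
  have "h \<in> GL n" by (rule GL_I[of n h g]) (use hg in \<open>auto simp: h_def\<close>)
  moreover have "matmul n g h = one_mat_fun n" "matmul n h g = one_mat_fun n"
    using gh hg by (auto simp: matmul_def one_mat_fun_def fun_eq_iff)
  ultimately show thesis by (rule that)
qed

text \<open>Invertibility becomes the nonvanishing of one polynomial in the entries, so it can be
  imposed along a line of matrices together with other such conditions.\<close>

lemma GL_det: "g \<in> GL n \<longleftrightarrow> (\<forall>i j. n \<le> i \<or> n \<le> j \<longrightarrow> g i j = 0) \<and> det (jmat n g) \<noteq> 0"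
proof
  assume g: "g \<in> GL n"
  then obtain h where "\<forall>i<n. \<forall>j<n. (\<Sum>k<n. g i k * h k j) = (if i = j then 1 else 0)"
    unfolding GL_def by blast
  then have "jmat n g * jmat n h = 1\<^sub>m n" by (simp add: jmat_mult_eq_1_iff)
  then have "det (jmat n g) * det (jmat n h) = 1"
    using det_mult[OF jmat_carrier jmat_carrier, of n g h] by simp
  then show "(\<forall>i j. n \<le> i \<or> n \<le> j \<longrightarrow> g i j = 0) \<and> det (jmat n g) \<noteq> 0"
    using GL_zero[OF g] by auto
next
  assume *: "(\<forall>i j. n \<le> i \<or> n \<le> j \<longrightarrow> g i j = 0) \<and> det (jmat n g) \<noteq> 0"
  define B where "B = inverse (det (jmat n g)) \<cdot>\<^sub>m adj_mat (jmat n g)"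
  have B: "B \<in> carrier_mat n n" "jmat n g * B = 1\<^sub>m n"
    using adj_mat[OF jmat_carrier, of n g] *
    by (simp_all add: B_def mult_smult_distrib[of _ n n _ n]) (auto intro!: eq_matI)
  have "B = jmat n (\<lambda>i j. B $$ (i, j))" using B(1) by (intro eq_matI) (auto simp: jmat_def)
  with B(2) have "jmat n g * jmat n (\<lambda>i j. B $$ (i, j)) = 1\<^sub>m n" by simp
  then show "g \<in> GL n" using * unfolding jmat_mult_eq_1_iff
    by (intro GL_I[where h = "\<lambda>i j. B $$ (i, j)"]) auto
qed

lemma GL_one: "one_mat_fun n \<in> GL n"
  by (rule GL_I[of n _ "one_mat_fun n"])
    (auto simp: one_mat_fun_def sum.delta if_distrib[of "\<lambda>x. x * _"] cong: if_cong)

lemma jmat_matmul: "jmat n (matmul n g h) = jmat n g * jmat n h"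
  by (rule eq_matI) (auto simp: jmat_def matmul_def scalar_prod_def atLeast0LessThan)

lemma GL_matmul: "g \<in> GL n \<Longrightarrow> h \<in> GL n \<Longrightarrow> matmul n g h \<in> GL n"
  by (simp add: GL_det jmat_matmul det_mult[OF jmat_carrier jmat_carrier]) (simp add: matmul_def)

lemma GL_subst_inverse:
  assumes "g \<in> GL n"
  obtains h where "h \<in> GL n" "\<And>f. f \<in> PV {..<n} \<Longrightarrow> subst (lin n h) (subst (lin n g) f) = f"
    "\<And>f. f \<in> PV {..<n} \<Longrightarrow> subst (lin n g) (subst (lin n h) f) = f"
  using GL_inverse[OF assms] by (metis subst_lin_one subst_lin_subst_lin)

lemma graded_ideal_is_ideal: "graded_ideal n J \<Longrightarrow> is_ideal n J"
  and graded_ideal_homog_comp: "graded_ideal n J \<Longrightarrow> f \<in> J \<Longrightarrow> homog_comp d f \<in> J"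
  by (auto simp: graded_ideal_def)

lemma act_graded_ideal:
  assumes I: "graded_ideal n I" and g: "g \<in> GL n"
  shows "graded_ideal n (act n g I)"
proof -
  note II = graded_ideal_is_ideal[OF I]
  obtain h where h: "\<And>f. f \<in> PV {..<n} \<Longrightarrow> subst (lin n g) (subst (lin n h) f) = f"
    using GL_subst_inverse[OF g] by metis
  have "is_ideal n (act n g I)"
    unfolding is_ideal_def
  proof (intro conjI ballI)
    show "act n g I \<subseteq> P n" using ideal_PV[OF II] by (auto simp: act_eq P_eq_PV intro: subst_lin_PV)
    show "0 \<in> act n g I" using ideal_0[OF II] unfolding act_eq by (metis image_eqI subst.hom_zero)
    fix f assume f: "f \<in> act n g I"
    show "f + f' \<in> act n g I" if "f' \<in> act n g I" for f'
      using f that ideal_add[OF II] by (auto simp: act_eq subst.hom_add[symmetric])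
    show "k * f \<in> act n g I" if "k \<in> P n" for k
    proof -
      from f obtain f0 where f0: "f = subst (lin n g) f0" "f0 \<in> I" by (auto simp: act_eq)
      have "k * f = subst (lin n g) (subst (lin n h) k * f0)"
        using that h f0 by (simp add: subst.hom_mult P_eq_PV)
      moreover have "subst (lin n h) k * f0 \<in> I"
        using that f0 by (intro ideal_mult[OF II] subst_lin_PV) (auto simp: P_eq_PV)
      ultimately show ?thesis unfolding act_eq by blast
    qed
  qed
  moreover have "homog_comp d f \<in> act n g I" if "f \<in> act n g I" for f d
    using that graded_ideal_homog_comp[OF I] homog_comp_subst[of "lin n g", OF homog_lin, of d]
    by (auto simp: act_eq)
  ultimately show ?thesis by (simp add: graded_ideal_def)
qed

lemma act_matmul:
  assumes "I \<subseteq> PV {..<n}"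
  shows "act n h (act n g I) = act n (matmul n g h) I"
  unfolding act_eq image_image by (intro image_cong refl subst_lin_subst_lin subsetD[OF assms])

lemma prime_ideal_preimage:
  assumes Q: "is_prime_ideal n Q"
  shows "is_prime_ideal n {f\<in>P n. subst (lin n g) f \<in> Q}"
proof -
  note QI = prime_is_ideal[OF Q]
  have "is_ideal n {f\<in>P n. subst (lin n g) f \<in> Q}"
    unfolding is_ideal_def
    by (auto simp: P_eq_PV subst.hom_add subst.hom_mult
        intro: PV_add PV_mult ideal_0[OF QI] ideal_add[OF QI] ideal_mult[OF QI] subst_lin_PV)
  then show ?thesis
    using Q unfolding is_prime_ideal_def
    by (auto simp: P_eq_PV subst.hom_mult subst_lin_PV)
qed

section \<open>Cofinite coordinate sections and Noether normalization\<close>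

text \<open>The condition says that \<open>J + (x\<^sub>i | i \<in> D)\<close> contains all homogeneous polynomials of degree at least \<open>N\<close>:
  membership in that sum means agreeing with an element of \<open>J\<close> once the variables in \<open>D\<close> are set to zero.\<close>

definition cofinite_mod :: "nat \<Rightarrow> 'k::field mpoly set \<Rightarrow> nat set \<Rightarrow> nat \<Rightarrow> bool" where
  "cofinite_mod n J D N \<longleftrightarrow> (\<forall>d\<ge>N. \<forall>p\<in>PV {..<n}. homog d p \<longrightarrow> (\<exists>j\<in>J. zap D p = zap D j))"

text \<open>The witness may be replaced by its component of degree \<open>d\<close>, since setting
  variables to zero respects the grading. Rewriting by such witnesses then preserves the total
  degree.\<close>

lemma cofinite_modE:
  assumes "cofinite_mod n J D N" "graded_ideal n J" "p \<in> PV {..<n}" "homog d p" "d \<ge> N"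
  obtains j where "j \<in> J" "homog d j" "zap D p = zap D j"
proof -
  from assms obtain j where j: "j \<in> J" "zap D p = zap D j" unfolding cofinite_mod_def by blast
  have "zap D p = homog_comp d (zap D p)"
    using homog_zap[OF assms(4), of D] by (simp add: homog_comp_homog)
  also have "\<dots> = zap D (homog_comp d j)" by (simp add: j homog_comp_zap)
  finally show thesis
    using that[of "homog_comp d j"] graded_ideal_homog_comp[OF assms(2) j(1)] by simp
qed

lemma finite_monomials: "finite {\<nu>. keys \<nu> \<subseteq> {..<n} \<and> mdeg \<nu> \<le> N}" (is "finite ?S")
proof (rule finite_imageD)
  let ?T = "{f. \<forall>i. (i \<in> {..<n} \<longrightarrow> f i \<in> {..N}) \<and> (i \<notin> {..<n} \<longrightarrow> f i = (0::nat))}"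
  have "finite ?T" by (rule finite_set_of_finite_funs) auto
  moreover have "lookup ` ?S \<subseteq> ?T"
  proof (intro image_subsetI CollectI allI conjI impI)
    fix \<nu> i assume \<nu>: "\<nu> \<in> ?S"
    show "lookup \<nu> i \<in> {..N}" using lookup_le_mdeg[of \<nu> i] \<nu> by simp
    show "lookup \<nu> i = 0" if "i \<notin> {..<n}" using \<nu> that by (auto simp: in_keys_iff)
  qed
  ultimately show "finite (lookup ` ?S)" by (rule finite_subset[rotated])
  show "inj_on lookup ?S" by (intro inj_onI poly_mapping_eqI) auto
qed

text \<open>Graded Nakayama: the monomials of degree at most \<open>N\<close> generate. A monomial
  of larger degree is congruent modulo \<open>J\<close> to a form of the same degree all of whose
  terms contain a variable from \<open>D\<close>; pulling out that variable lowers the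
  degree.\<close>

lemma cofinite_mod_fin_gen:
  fixes J :: "'k::field mpoly set"
  assumes J: "graded_ideal n J" and D: "D \<subseteq> {..<n}" and cof: "cofinite_mod n J D N"
  shows "fin_gen_over n J D"
proof -
  note JI = graded_ideal_is_ideal[OF J]
  \<comment> \<open>The monomial 1 is left out because generator number 0 is reserved for
    it.\<close>
  let ?S = "{\<nu>. keys \<nu> \<subseteq> {..<n} \<and> mdeg \<nu> \<le> N} - {0}"
  have "finite ?S" using finite_monomials by blast
  then obtain h where h: "bij_betw h {0..<card ?S} ?S" using ex_bij_betw_nat_finite by blast
  define t where "t = Suc (card ?S)"
  define e :: "nat \<Rightarrow> 'k mpoly" where "e i = (case i of 0 \<Rightarrow> 1 | Suc i \<Rightarrow> single (h i) 1)" for i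
  have hS: "h i \<in> ?S" if "i < card ?S" for i using h that by (auto simp: bij_betw_def)
  have ePV: "e i \<in> PV {..<n}" if "i < t" for i
    using that hS[of "i - 1"] by (cases i) (auto simp: e_def t_def intro: PV_single)
  define G where "G = {f. \<exists>a. (\<forall>i<t. a i \<in> PV D) \<and> f - (\<Sum>i<t. a i * e i) \<in> J}"
  have GI: "f \<in> G" if "\<And>i. i < t \<Longrightarrow> a i \<in> PV D" "f - (\<Sum>i<t. a i * e i) \<in> J" for f a
    unfolding G_def using that by blast
  have GJ: "f \<in> G" if "f \<in> J" for f using that by (intro GI[of "\<lambda>_. 0"]) auto
  have G_add: "f + f' \<in> G" if "f \<in> G" "f' \<in> G" for f f'
  proof -
    from that obtain a a' where a: "\<forall>i<t. a i \<in> PV D" "f - (\<Sum>i<t. a i * e i) \<in> J"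
      and a': "\<forall>i<t. a' i \<in> PV D" "f' - (\<Sum>i<t. a' i * e i) \<in> J" unfolding G_def by blast
    show ?thesis
      using a a' ideal_add[OF JI a(2) a'(2)]
      by (intro GI[of "\<lambda>i. a i + a' i"]) (auto simp: algebra_simps sum.distrib intro: PV_add)
  qed
  have G_mult: "c * f \<in> G" if "f \<in> G" "c \<in> PV D" for f c
  proof -
    from that obtain a where a: "\<forall>i<t. a i \<in> PV D" "f - (\<Sum>i<t. a i * e i) \<in> J" unfolding G_def by blast
    have "c \<in> PV {..<n}" using that(2) PV_mono[OF D] by blast
    from ideal_mult[OF JI this a(2)] show ?thesis
      using a that by (intro GI[of "\<lambda>i. c * a i"]) (auto simp: algebra_simps sum_distrib_left intro: PV_mult)
  qed
  have G_sum: "(\<Sum>x\<in>A. F x) \<in> G" if "\<And>x. x \<in> A \<Longrightarrow> F x \<in> G" for A and F :: "(nat \<Rightarrow>\<^sub>0 nat) \<Rightarrow> 'k mpoly"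
    using that by (induction A rule: infinite_finite_induct) (auto intro: G_add GJ ideal_0[OF JI])
  have Ge: "e i \<in> G" if "i < t" for i
  proof (rule GI[of "\<lambda>k. if k = i then 1 else 0"])
    have "(\<Sum>k<t. (if k = i then 1 else 0) * e k) = e i"
      using that by (simp add: if_distrib[of "\<lambda>x. x * _"] cong: if_cong)
    then show "e i - (\<Sum>k<t. (if k = i then 1 else 0) * e k) \<in> J" using ideal_0[OF JI] by simp
  qed auto
  have "single \<nu> c \<in> G" if "keys \<nu> \<subseteq> {..<n}" for \<nu> c
    using that
  proof (induction "mdeg \<nu>" arbitrary: \<nu> c rule: less_induct)
    case less
    show ?case
    proof (cases "mdeg \<nu> \<le> N")
      case True
      have "\<exists>i<t. e i = single \<nu> 1"
      proof (cases "\<nu> = 0")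
        case True
        then show ?thesis by (intro exI[of _ 0]) (simp add: e_def t_def)
      next
        case False
        then have "\<nu> \<in> h ` {0..<card ?S}" using h True less.prems by (simp add: bij_betw_def)
        then obtain i where "i < card ?S" "\<nu> = h i" by auto
        then show ?thesis by (intro exI[of _ "Suc i"]) (simp add: e_def t_def)
      qed
      then have "single \<nu> 1 \<in> G" using Ge by metis
      from G_mult[OF this, of "single 0 c"] show ?thesis by (simp add: mult_single)
    next
      case False
      obtain j where j: "j \<in> J" "homog (mdeg \<nu>) j" "zap D (single \<nu> c) = zap D j"
        using cofinite_modE[OF cof J PV_single[OF less.prems] homog_single, of c] False by auto
      define r where "r = single \<nu> c - j"
      have r0: "zap D r = 0" by (simp add: r_def zap.hom_minus j)
      have rh: "homog (mdeg \<nu>) r" unfolding r_def by (intro homog_minus j) simp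
      have rP: "r \<in> PV {..<n}" unfolding r_def by (intro PV_minus PV_single less.prems ideal_PV[OF JI] j)
      have "single \<mu> (lookup r \<mu>) \<in> G" if \<mu>: "\<mu> \<in> keys r" for \<mu>
      proof -
        from r0 \<mu> obtain b where b: "b \<in> keys \<mu>" "b \<in> D" by (auto simp: zap_eq_0_iff)
        note eq = single_add_split[OF b(1)]
        have "mdeg \<mu> = mdeg \<nu>" using rh \<mu> by (simp add: homog_def)
        moreover have "mdeg \<mu> = Suc (mdeg (\<mu> - single b 1))" by (subst (1) eq) (simp add: mdeg_add)
        moreover have "keys (\<mu> - single b 1) \<subseteq> keys \<mu>" by (auto simp: in_keys_iff lookup_minus)
        then have "keys (\<mu> - single b 1) \<subseteq> {..<n}" using rP \<mu> by (auto simp: PV_def)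
        ultimately have "single (\<mu> - single b 1) (lookup r \<mu>) \<in> G" by (intro less.hyps) auto
        from G_mult[OF this PV_var[OF b(2)]] show ?thesis
          by (subst (1) eq) (simp add: var_def mult_single)
      qed
      then have "r \<in> G" using G_sum[of "keys r" "\<lambda>\<mu>. single \<mu> (lookup r \<mu>)"] by (simp add: poly_mapping_sum_single)
      from G_add[OF this GJ[OF j(1)]] show ?thesis by (simp add: r_def)
    qed
  qed
  then have G: "f \<in> G" if "f \<in> PV {..<n}" for f
    using G_sum[of "keys f" "\<lambda>\<mu>. single \<mu> (lookup f \<mu>)"] that
    by (auto simp: poly_mapping_sum_single PV_def)
  show ?thesis
    unfolding fin_gen_over_def
  proof (rule exI[of _ t], rule exI[of _ e], intro conjI ballI allI impI)
    show "0 < t" by (simp add: t_def)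
    show "e 0 = 1" by (simp add: e_def)
    show "\<exists>a. (\<forall>i<t. a i \<in> PV D) \<and> f - (\<Sum>i<t. a i * e i) \<in> J" if "f \<in> PV {..<n}" for f
      using G[OF that] by (simp add: G_def)
  qed (rule ePV)
qed

text \<open>The hypothesis on \<open>D\<close> says that \<open>g\<close> maps the ideal of the
  variables in \<open>D\<close> into that of the variables in \<open>D'\<close>. This serves for
  coordinate changes that keep \<open>D\<close> and for permutations that move it into a larger
  set.\<close>

lemma cofinite_mod_act:
  fixes J :: "'k::field mpoly set"
  assumes cof: "cofinite_mod n J D N" and g: "g \<in> GL n" and J: "is_ideal n J"
    and D: "\<And>i. i \<in> D \<Longrightarrow> zap D' (lin n g i) = 0"
  shows "cofinite_mod n (act n g J) D' N"
  unfolding cofinite_mod_def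
proof (intro allI impI ballI)
  fix d and p :: "'k mpoly" assume p: "d \<ge> N" "p \<in> PV {..<n}" "homog d p"
  obtain h where h: "\<And>f. f \<in> PV {..<n} \<Longrightarrow> subst (lin n g) (subst (lin n h) f) = f"
    using GL_subst_inverse[OF g] by metis
  obtain j where j: "j \<in> J" "zap D (subst (lin n h) p) = zap D j"
    using cof p subst_lin_PV homog_subst_lin unfolding cofinite_mod_def by metis
  have *: "zap D' (subst (lin n g) u) = zap D' (subst (lin n g) (zap D u))" for u
  proof (rule hom_ext[of "\<lambda>u. zap D' (subst (lin n g) u)" "\<lambda>u. zap D' (subst (lin n g) (zap D u))" u])
    show "comm_ring_hom (\<lambda>u. zap D' (subst (lin n g) u))"
      by (intro comm_ring_hom_compose[OF zap.comm_ring_hom_axioms] subst.comm_ring_hom_axioms)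
    show "comm_ring_hom (\<lambda>u. zap D' (subst (lin n g) (zap D u)))"
      by (intro comm_ring_hom_compose[OF zap.comm_ring_hom_axioms]
          comm_ring_hom_compose[OF subst.comm_ring_hom_axioms] zap.comm_ring_hom_axioms)
  qed (use D in \<open>auto simp flip: var_def simp del: One_nat_def\<close>)
  have "zap D' p = zap D' (subst (lin n g) (zap D (subst (lin n h) p)))"
    using h[OF p(2)] *[of "subst (lin n h) p"] by simp
  also have "\<dots> = zap D' (subst (lin n g) j)" unfolding j(2) *[symmetric] ..
  finally show "\<exists>j\<in>act n g J. zap D' p = zap D' j" using j(1) by (auto simp: act_eq)
qed

text \<open>Modulo \<open>J\<close> and the variables in \<open>D\<close>, polynomials of degree at least \<open>N + e\<close> are multiples of \<open>x\<^sub>b\<^sup>e\<close>, which is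
  itself zero.\<close>

lemma cofinite_mod_remove:
  fixes J :: "'k::field mpoly set"
  assumes cof: "cofinite_mod n J (insert b D) N" and J: "graded_ideal n J"
    and b: "b \<notin> D" "b < n" and j0: "j0 \<in> J" "zap D j0 = var b ^ e"
  shows "cofinite_mod n J D (N + e)"
  unfolding cofinite_mod_def
proof (intro allI impI ballI)
  fix d and p :: "'k mpoly" assume d: "d \<ge> N + e" and p: "p \<in> PV {..<n}" "homog d p"
  note JI = graded_ideal_is_ideal[OF J]
  have vb: "(var b ^ k :: 'k mpoly) \<in> PV {..<n}" for k using b by (intro PV_power) auto
  have zb: "zap D (var b ^ k) = (var b ^ k :: 'k mpoly)" for k using b by (simp add: zap.hom_power)
  \<comment> \<open>Each of the \<open>e\<close> rounds extracts one factor x_b and needs a cofactor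
    of degree at least \<open>N\<close>, hence the bound \<open>N + e\<close>.\<close>
  have "\<exists>j q. j \<in> J \<and> q \<in> PV {..<n} \<and> homog (d - k) q \<and> zap D p = zap D (j + var b ^ k * q)" if "k \<le> e" for k
    using that
  proof (induction k)
    case 0
    show ?case using p ideal_0[OF JI] by (intro exI[of _ 0] exI[of _ p]) simp
  next
    case (Suc k)
    then obtain j q where j: "j \<in> J" and q: "q \<in> PV {..<n}" "homog (d - k) q"
      and jq: "zap D p = zap D (j + var b ^ k * q)" by auto
    have "N \<le> d - k" using d Suc.prems by simp
    then obtain j1 where j1: "j1 \<in> J" "homog (d - k) j1" "zap (insert b D) q = zap (insert b D) j1"
      using cofinite_modE[OF cof J q] by blast
    define u where "u = zap D (q - j1)"
    have "zap {b} u = 0" using j1(3) by (simp add: u_def zap_zap zap.hom_minus)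
    then obtain q' where q': "u = var b * q'" "\<And>\<nu>. \<nu> \<in> keys q' \<Longrightarrow> \<nu> + single b 1 \<in> keys u"
      using var_div[of u b] by auto
    have "homog (d - k) u" unfolding u_def by (intro homog_zap homog_minus q j1)
    then have "Suc (mdeg \<nu>) = d - k" if "\<nu> \<in> keys q'" for \<nu>
      using q'(2)[OF that] by (auto simp: homog_def mdeg_add)
    then have "homog (d - Suc k) q'" by (fastforce simp: homog_def)
    moreover have "u \<in> PV {..<n}"
      unfolding u_def using zap_PV[OF PV_minus[OF q(1) ideal_PV[OF JI j1(1)]]] PV_mono[of "{..<n} - D" "{..<n}"] by auto
    then have "q' \<in> PV {..<n}" using PV_var_div[of u] q'(2) by blast
    moreover have "j + var b ^ k * j1 \<in> J" by (intro ideal_add[OF JI] ideal_mult[OF JI] vb j j1)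
    moreover have "zap D u = u" by (simp add: u_def zap_zap)
    then have "zap D (var b ^ k * q) = zap D (var b ^ k * j1 + var b ^ Suc k * q')"
      using q'(1) by (simp add: zap.hom_add zap.hom_mult zb u_def zap.hom_minus algebra_simps)
    then have "zap D p = zap D ((j + var b ^ k * j1) + var b ^ Suc k * q')"
      unfolding jq by (simp add: zap.hom_add add.assoc)
    ultimately show ?case by blast
  qed
  from this[of e] obtain j q where jq: "j \<in> J" "q \<in> PV {..<n}" "zap D p = zap D (j + var b ^ e * q)" by auto
  have "zap D p = zap D (j + j0 * q)"
    using jq(3) j0(2) by (simp add: zap.hom_add zap.hom_mult zb)
  moreover have "j + j0 * q \<in> J" by (intro ideal_add[OF JI] ideal_mult_right[OF JI] jq j0)
  ultimately show "\<exists>j\<in>J. zap D p = zap D j" by blast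
qed

section \<open>Points where a polynomial does not vanish, and monic relations\<close>

lemma pev_cong_vars:
  assumes "f \<in> PV V" "\<And>i. i \<in> V \<Longrightarrow> s i = s' i"
  shows "pev c s f = pev c s' f"
proof -
  have "monom_val s \<nu> = monom_val s' \<nu>" if "\<nu> \<in> keys f" for \<nu>
  proof -
    have "s i = s' i" if "i \<in> keys \<nu>" for i
      using assms that \<open>\<nu> \<in> keys f\<close> by (auto simp: PV_def subset_iff)
    then show ?thesis by (simp add: monom_val_def)
  qed
  then show ?thesis unfolding pev_def by (intro sum.cong) auto
qed

lemma const_poly_hom: "comm_ring_hom (\<lambda>c. [:c:])"
  by unfold_locales (auto simp: one_pCons)

lemma poly_eval_hom: "comm_ring_hom (\<lambda>p. poly p t)"
  by unfold_locales auto

text \<open>Characteristic 0 makes the field infinite. If the part of \<open>f\<close> free of the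
  variable \<open>j\<close> is nonzero, that variable is set to 0. Otherwise \<open>f\<close> is
  divisible by it, and a good point for the quotient is moved in direction \<open>j\<close> until
  the variable is nonzero as well.\<close>

lemma nonvanishing_point:
  fixes f :: "'k::field_char_0 mpoly"
  assumes "finite V" "f \<in> PV V" "f \<noteq> 0"
  shows "\<exists>a. pev (\<lambda>x. x) a f \<noteq> 0"
  using assms
proof (induction V arbitrary: f rule: finite_induct)
  case empty
  have f: "f = single 0 (lookup f 0)"
    using empty.prems(1) by (intro poly_mapping_eqI) (auto simp: PV_def lookup_single' in_keys_iff)
  then have "lookup f 0 \<noteq> 0" using empty.prems(2) by (metis single_zero)
  then show ?case by (subst f) simp
next
  case (insert j V)
  have "\<exists>a. pev (\<lambda>x. x) a f \<noteq> 0"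
    if "\<forall>\<nu>\<in>keys f. lookup \<nu> j < e" "f \<in> PV (insert j V)" "f \<noteq> 0" for e and f :: "'k mpoly"
    using that
  proof (induction e arbitrary: f)
    case 0
    then have "f = 0" by (intro poly_mapping_eqI) (auto simp: in_keys_iff)
    with 0 show ?case by simp
  next
    case (Suc e)
    obtain q where q: "f = var j * q + zap {j} f" "\<And>\<nu>. \<nu> \<in> keys q \<Longrightarrow> \<nu> + single j 1 \<in> keys f"
      using var_div[of f j] by blast
    have ev: "pev (\<lambda>x. x) a (var j * q + r) = a j * pev (\<lambda>x. x) a q + pev (\<lambda>x. x) a r" for a r
    proof -
      interpret pev: comm_ring_hom "pev (\<lambda>x. x) a" by (rule pev_hom[OF id_ring_hom])
      show ?thesis by (simp add: pev.hom_add pev.hom_mult var_def)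
    qed
    show ?case
    proof (cases "zap {j} f = 0")
      case False
      have z: "zap {j} f \<in> PV V" using zap_PV[OF Suc.prems(2), of "{j}"] insert.hyps by simp
      then obtain a where a: "pev (\<lambda>x. x) a (zap {j} f) \<noteq> 0" using insert.IH False by blast
      have "pev (\<lambda>x. x) (a(j := 0)) (zap {j} f) = pev (\<lambda>x. x) a (zap {j} f)"
        using insert.hyps by (intro pev_cong_vars[OF z]) auto
      then have "pev (\<lambda>x. x) (a(j := 0)) f \<noteq> 0"
        using a ev[of "a(j := 0)" "zap {j} f"] q(1) by simp
      then show ?thesis by blast
    next
      case True
      then have f: "f = var j * q" using q(1) by simp
      then have "q \<noteq> 0" using Suc.prems(3) by auto
      moreover have "\<forall>\<nu>\<in>keys q. lookup \<nu> j < e"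
        using Suc.prems(1) q(2) by (fastforce simp: lookup_add)
      ultimately obtain a where a: "pev (\<lambda>x. x) a q \<noteq> 0"
        using Suc.IH PV_var_div[OF Suc.prems(2) q(2)] by blast
      \<comment> \<open>The restriction of \<open>q\<close> to the line through \<open>a\<close> in
        direction \<open>j\<close>; multiplied by the coordinate it is still nonzero, hence has a
        nonzero value.\<close>
      define F where "F = pev (\<lambda>c. [:c:]) (\<lambda>i. if i = j then [:0, 1:] else [:a i:]) q"
      have F: "poly F t = pev (\<lambda>x. x) (a(j := t)) q" for t
      proof -
        have "(\<lambda>i. poly (if i = j then [:0, 1:] else [:a i:]) t) = a(j := t)" by auto
        then show ?thesis
          unfolding F_def by (subst hom_pev[OF poly_eval_hom const_poly_hom]) simp
      qed
      have "poly F (a j) \<noteq> 0" using a by (simp add: F)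
      then have "F \<noteq> 0" by auto
      then have "[:0, 1:] * F \<noteq> 0" by simp
      then obtain t where "poly ([:0, 1:] * F) t \<noteq> 0" using poly_all_0_iff_0 by blast
      then have "pev (\<lambda>x. x) (a(j := t)) f \<noteq> 0"
        using ev[of "a(j := t)" 0] by (simp add: f F pev_def[of _ _ 0])
      then show ?thesis by blast
    qed
  qed
  moreover have "\<forall>\<nu>\<in>keys f. lookup \<nu> j < Suc (\<Sum>\<nu>\<in>keys f. lookup \<nu> j)"
    using member_le_sum[of _ "keys f" "\<lambda>\<nu>. lookup \<nu> j"] by (auto simp: less_Suc_eq_le)
  ultimately show ?case using insert.prems by blast
qed

text \<open>The substitution x_i -> x_i + v_i x_b for i different from b, and x_b -> v_b x_b: the
  identity matrix with column \<open>b\<close> replaced by \<open>v\<close>.\<close>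

definition colmat :: "nat \<Rightarrow> nat \<Rightarrow> (nat \<Rightarrow> 'k::field) \<Rightarrow> nat \<Rightarrow> nat \<Rightarrow> 'k" where
  "colmat n b v i j = (if i < n \<and> j < n then (if j = b then v i else if i = j then 1 else 0) else 0)"

lemma colmat_GL:
  assumes b: "b < n" and v: "v b \<noteq> 0"
  shows "colmat n b v \<in> GL n"
proof (rule GL_I[of n _ "colmat n b (\<lambda>i. if i = b then 1 / v b else - v i / v b)"])
  fix i j assume ij: "i < n" "j < n"
  let ?w = "\<lambda>i. if i = b then 1 / v b else - v i / v b"
  have "(\<Sum>k<n. colmat n b v i k * colmat n b ?w k j)
      = (\<Sum>k<n. (if k = b then v b * 0 + v i * colmat n b ?w b j else 0)
          + (if k = i then (if i = b then 0 else colmat n b ?w i j) else 0))"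
    using ij by (intro sum.cong) (auto simp: colmat_def)
  also have "\<dots> = v i * colmat n b ?w b j + (if i = b then 0 else colmat n b ?w i j)"
    using ij b by (simp add: sum.distrib sum.delta)
  also have "\<dots> = (if i = j then 1 else 0)"
    using ij b v by (auto simp: colmat_def)
  finally show "(\<Sum>k<n. colmat n b v i k * colmat n b ?w k j) = (if i = j then 1 else 0)" .
qed (auto simp: colmat_def)

lemma homog_subst_scaled_var:
  fixes f :: "'k::field mpoly"
  assumes "homog e f"
  shows "subst (\<lambda>i. single 0 (a i) * x) f = single 0 (pev (\<lambda>x. x) a f) * x ^ e"
proof -
  interpret c: comm_ring_hom "single 0 :: 'k \<Rightarrow> 'k mpoly" by (rule const_hom)
  have m: "monom_val (\<lambda>i. single 0 (a i) * x) \<nu> = single 0 (monom_val a \<nu>) * x ^ mdeg \<nu>" for \<nu>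
    unfolding monom_val_def mdeg_def
    by (simp add: power_mult_distrib prod.distrib power_sum c.hom_prod c.hom_power)
  have "subst (\<lambda>i. single 0 (a i) * x) f
      = (\<Sum>\<nu>\<in>keys f. single 0 (lookup f \<nu> * monom_val a \<nu>) * x ^ e)"
    unfolding subst_eq_pev pev_def m using assms
    by (intro sum.cong refl) (auto simp: homog_def c.hom_mult mult.assoc)
  then show ?thesis by (simp add: pev_def[of _ a] c.hom_sum sum_distrib_right)
qed

text \<open>A homogeneous relation \<open>f\<close> among the coordinates in \<open>D\<close> becomes monic in some \<open>x\<^sub>b\<close> after a change
  of coordinates sending the \<open>b\<close>-th basis vector to a point where \<open>f\<close> does not vanish.\<close>

lemma cofinite_mod_reduce:
  fixes J :: "'k::field_char_0 mpoly set"
  assumes J: "graded_ideal n J" "1 \<notin> J" and D: "D \<subseteq> {..<n}" and cof: "cofinite_mod n J D N"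
    and dep: "\<not> vars_indep J D"
  obtains g b N' where "g \<in> GL n" "b \<in> D" "cofinite_mod n (act n g J) (D - {b}) N'"
proof -
  note JI = graded_ideal_is_ideal[OF J(1)]
  obtain f0 where f0: "f0 \<in> J" "f0 \<in> PV D" "f0 \<noteq> 0" using dep by (auto simp: vars_indep_def)
  obtain e where e: "homog_comp e f0 \<noteq> 0"
  proof (rule ccontr)
    assume "\<not> thesis"
    then have "homog_comp e f0 = 0" for e using that by blast
    then have "f0 = 0" using sum_homog_comp[of f0] by simp
    with f0(3) show False by simp
  qed
  define f where "f = homog_comp e f0"
  have f: "f \<in> J" "f \<in> PV D" "f \<noteq> 0" "homog e f"
    unfolding f_def by (fact graded_ideal_homog_comp[OF J(1) f0(1)] PV_homog_comp[OF f0(2)] e homog_homog_comp)+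
  obtain a where a: "pev (\<lambda>x. x) a f \<noteq> 0"
    using nonvanishing_point[OF finite_subset[OF D finite_lessThan] f(2,3)] by blast
  \<comment> \<open>If the point vanished on all of \<open>D\<close>, only a constant term could
    survive, so the form \<open>f\<close> would be a nonzero constant in the proper ideal
    \<open>J\<close>.\<close>
  have "\<exists>b\<in>D. a b \<noteq> 0"
  proof (rule ccontr)
    assume *: "\<not> ?thesis"
    have "\<not> (\<forall>\<nu>\<in>keys f. monom_val a \<nu> = 0)" 
    proof
      assume "\<forall>\<nu>\<in>keys f. monom_val a \<nu> = 0"
      then have "pev (\<lambda>x. x) a f = 0" unfolding pev_def by (intro sum.neutral) auto
      with a show False by simp
    qed
    then obtain \<nu> where \<nu>: "\<nu> \<in> keys f" "monom_val a \<nu> \<noteq> 0" by blast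
    have "i \<notin> keys \<nu>" for i
    proof
      assume i: "i \<in> keys \<nu>"
      then have "a i = 0" using * f(2) \<nu>(1) by (auto simp: PV_def)
      with i have "monom_val a \<nu> = 0"
        unfolding monom_val_def by (intro prod_zero) (auto simp: in_keys_iff power_0_left)
      with \<nu>(2) show False by simp
    qed
    then have "\<nu> = 0" by (intro poly_mapping_eqI) (auto simp: in_keys_iff)
    then have "e = 0" using f(4) \<nu>(1) by (auto simp: homog_def)
    then have f': "f = single 0 (lookup f 0)"
      using f(4) by (intro poly_mapping_eqI) (auto simp: homog_def lookup_single' in_keys_iff mdeg_eq_0)
    have "single 0 (inverse (lookup f 0)) * f \<in> J" by (intro ideal_mult[OF JI] f) simp
    moreover have "lookup f 0 \<noteq> 0" using f' f(3) by (metis single_zero)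
    ultimately have "1 \<in> J" by (subst (asm) (2) f') (simp add: mult_single)
    with J(2) show False by simp
  qed
  then obtain b where b: "b \<in> D" "a b \<noteq> 0" by blast
  define v where "v i = (if i \<in> D then a i else 0)" for i
  define g where "g = colmat n b v"
  have g: "g \<in> GL n" unfolding g_def using b D by (intro colmat_GL) (auto simp: v_def)
  have zl: "zap (D - {b}) (lin n g i) = single 0 (a i) * var b" if i: "i \<in> D" for i
  proof -
    have "zap (D - {b}) (lin n g i) = (\<Sum>j\<in>{..<n} - (D - {b}). if j = b then single 0 (a i) * var b else 0)"
      unfolding zap_lin using i D by (intro sum.cong) (auto simp: g_def colmat_def v_def)
    also have "\<dots> = single 0 (a i) * var b" using b D by (auto simp: sum.delta)
    finally show ?thesis .
  qed
  have "zap D (lin n g i) = 0" if "i \<in> D" for i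
    unfolding zap_lin using that D b by (intro sum.neutral) (auto simp: g_def colmat_def)
  then have cof': "cofinite_mod n (act n g J) (insert b (D - {b})) N"
    using cofinite_mod_act[OF cof g JI] b(1) by (simp add: insert_absorb)
  define j0 where "j0 = single 0 (inverse (pev (\<lambda>x. x) a f)) * subst (lin n g) f"
  have "zap (D - {b}) (subst (lin n g) f) = subst (\<lambda>i. zap (D - {b}) (lin n g i)) f"
    unfolding zap_def subst_subst ..
  also have "\<dots> = subst (\<lambda>i. single 0 (a i) * var b) f"
    unfolding subst_eq_pev using zl by (intro pev_cong_vars[OF f(2)])
  also have "\<dots> = single 0 (pev (\<lambda>x. x) a f) * var b ^ e" by (rule homog_subst_scaled_var[OF f(4)])
  finally have "zap (D - {b}) j0 = var b ^ e"
    using a by (simp add: j0_def zap.hom_mult mult.assoc[symmetric] mult_single)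
  moreover have "j0 \<in> act n g J"
    unfolding j0_def using f(1)
    by (intro ideal_mult[OF graded_ideal_is_ideal[OF act_graded_ideal[OF J(1) g]]]) (auto simp: act_eq)
  ultimately have "cofinite_mod n (act n g J) (D - {b}) (N + e)"
    using b(1) D by (intro cofinite_mod_remove[OF cof' act_graded_ideal[OF J(1) g]]) auto
  then show thesis using that g b(1) by blast
qed

section \<open>Normalization in prescribed coordinates\<close>

lemma one_notin_act:
  assumes I: "is_ideal n I" "1 \<notin> I" and g: "g \<in> GL n"
  shows "1 \<notin> act n g I"
proof
  assume "1 \<in> act n g I"
  then obtain f where f: "f \<in> I" "1 = subst (lin n g) f" by (auto simp: act_eq)
  obtain h where "\<And>f. f \<in> PV {..<n} \<Longrightarrow> subst (lin n h) (subst (lin n g) f) = f"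
    using GL_subst_inverse[OF g] by metis
  with f ideal_PV[OF I(1)] have "f = 1" by (metis subst.hom_one)
  with f I show False by simp
qed

text \<open>A chain of primes over g(I) is pulled back to \<open>I\<close> along the substitution;
  it stays strict because the substitution is bijective on the polynomials in n variables.\<close>

lemma krull_dim_ge_cofinite_indep:
  fixes I :: "'k::field mpoly set"
  assumes I: "graded_ideal n I" and g: "g \<in> GL n" and D: "D \<subseteq> {..<n}"
    and cof: "cofinite_mod n (act n g I) D N" and ind: "vars_indep (act n g I) D"
  shows "enat (card D) \<le> krull_dim n I"
proof -
  note J = act_graded_ideal[OF I g]
  obtain Q where Q: "\<forall>k\<le>card D. is_prime_ideal n (Q k) \<and> act n g I \<subseteq> Q k"
    "\<forall>k<card D. Q k \<subset> Q (Suc k)"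
    using exists_prime_chain[OF D graded_ideal_is_ideal[OF J] cofinite_mod_fin_gen[OF J D cof] ind] by blast
  obtain h where h: "\<And>f. f \<in> PV {..<n} \<Longrightarrow> subst (lin n g) (subst (lin n h) f) = f"
    using GL_subst_inverse[OF g] by metis
  define Q' where "Q' k = {f\<in>P n. subst (lin n g) f \<in> Q k}" for k
  have "is_prime_ideal n (Q' k) \<and> I \<subseteq> Q' k" if "k \<le> card D" for k
    using Q(1) that prime_ideal_preimage[of n "Q k" g] ideal_PV[OF graded_ideal_is_ideal[OF I]]
    by (auto simp: Q'_def P_eq_PV act_eq)
  moreover have "Q' k \<subset> Q' (Suc k)" if k: "k < card D" for k
  proof -
    obtain f where f: "f \<in> Q (Suc k)" "f \<notin> Q k" using Q(2) k by blast
    have fP: "f \<in> PV {..<n}" using f(1) Q(1) k by (intro ideal_PV[OF prime_is_ideal[of n "Q (Suc k)"]]) auto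
    have "subst (lin n h) f \<in> Q' (Suc k) - Q' k"
      using f fP h subst_lin_PV[OF fP] by (auto simp: Q'_def P_eq_PV)
    moreover have "Q' k \<subseteq> Q' (Suc k)" using Q(2) k by (auto simp: Q'_def)
    ultimately show ?thesis by blast
  qed
  ultimately show ?thesis
    unfolding krull_dim_def by (intro Sup_upper) blast
qed

text \<open>Take \<open>card D\<close> minimal over all coordinate systems; a relation among the
  variables of \<open>D\<close> would allow one of them to be dropped. The minimum exists since all
  variables together qualify: every form of positive degree vanishes once they are zero.\<close>

lemma noether_normalization:
  fixes I :: "'k::field_char_0 mpoly set"
  assumes I: "graded_ideal n I" "1 \<notin> I"
  obtains g D N where "g \<in> GL n" "D \<subseteq> {..<n}" "enat (card D) \<le> krull_dim n I"
    "cofinite_mod n (act n g I) D N"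
proof -
  note II = graded_ideal_is_ideal[OF I(1)]
  define S where "S k \<longleftrightarrow> (\<exists>g D N. g \<in> GL n \<and> D \<subseteq> {..<n} \<and> card D = k \<and> cofinite_mod n (act n g I) D N)" for k
  have "cofinite_mod n (act n (one_mat_fun n) I) {..<n} 1"
    unfolding cofinite_mod_def
  proof (intro allI impI ballI)
    fix d and p :: "'k mpoly" assume p: "1 \<le> d" "p \<in> PV {..<n}" "homog d p"
    have "keys \<nu> \<inter> {..<n} \<noteq> {}" if "\<nu> \<in> keys p" for \<nu>
    proof -
      have "\<nu> \<noteq> 0" using p that by (auto simp: homog_def)
      then have "keys \<nu> \<noteq> {}" by auto
      moreover have "keys \<nu> \<subseteq> {..<n}" using p(2) that by (simp add: PV_def)
      ultimately show ?thesis by blast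
    qed
    then have "zap {..<n} p = zap {..<n} 0" by (simp add: zap_eq_0_iff)
    then show "\<exists>j\<in>act n (one_mat_fun n) I. zap {..<n} p = zap {..<n} j"
      using ideal_0[OF graded_ideal_is_ideal[OF act_graded_ideal[OF I(1) GL_one]]] by blast
  qed
  then have "S n" unfolding S_def using GL_one by (metis card_lessThan order_refl)
  then have L: "S (LEAST k. S k)" by (rule LeastI)
  then obtain g D N where g: "g \<in> GL n" "D \<subseteq> {..<n}" "cofinite_mod n (act n g I) D N"
    and k: "card D = (LEAST k. S k)" unfolding S_def by blast
  note J = act_graded_ideal[OF I(1) g(1)]
  have "vars_indep (act n g I) D"
  proof (rule ccontr)
    assume "\<not> ?thesis"
    then obtain h b N' where h: "h \<in> GL n" "b \<in> D" "cofinite_mod n (act n h (act n g I)) (D - {b}) N'"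
      using cofinite_mod_reduce[OF J one_notin_act[OF II I(2) g(1)] g(2,3)] by blast
    have "act n h (act n g I) = act n (matmul n g h) I"
      using ideal_PV[OF II] by (intro act_matmul) auto
    with h(3) have "cofinite_mod n (act n (matmul n g h) I) (D - {b}) N'" by simp
    moreover have "D - {b} \<subseteq> {..<n}" using g(2) by blast
    ultimately have "S (card (D - {b}))" unfolding S_def using GL_matmul[OF g(1) h(1)] by metis
    then have "card D \<le> card (D - {b})" unfolding k by (rule Least_le)
    moreover have "card (D - {b}) < card D"
      using h(2) finite_subset[OF g(2)] by (intro psubset_card_mono) auto
    ultimately show False by simp
  qed
  from krull_dim_ge_cofinite_indep[OF I(1) g this] show thesis by (intro that[OF g(1,2) _ g(3)])
qed

lemma permutation_GL:
  assumes "bij_betw \<pi> {..<n} {..<n}"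
  shows "(\<lambda>i j. if i < n \<and> j = \<pi> i then 1 else 0) \<in> GL n"
proof (rule GL_I[where h = "\<lambda>i j. if j < n \<and> i = \<pi> j then 1 else 0"])
  have \<pi>: "\<pi> i < n" if "i < n" for i using assms that by (auto simp: bij_betw_def)
  show "(if i < n \<and> j = \<pi> i then 1 else 0) = 0" if "n \<le> i \<or> n \<le> j" for i j
    using that \<pi>[of i] by auto
  fix i j assume ij: "i < n" "j < n"
  then have inj: "\<pi> i = \<pi> j \<longleftrightarrow> i = j" using assms by (auto simp: bij_betw_def inj_on_def)
  have "(\<Sum>k<n. (if i < n \<and> k = \<pi> i then 1 else 0) * (if j < n \<and> k = \<pi> j then 1 else (0::'a)))
      = (\<Sum>k<n. if k = \<pi> i then (if i = j then 1 else 0) else 0)"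
    using ij inj by (intro sum.cong) auto
  also have "\<dots> = (if i = j then 1 else 0)" using \<pi>[OF ij(1)] by simp
  finally show "(\<Sum>k<n. (if i < n \<and> k = \<pi> i then 1 else 0) * (if j < n \<and> k = \<pi> j then 1 else (0::'a)))
      = (if i = j then 1 else 0)" .
qed

text \<open>The normalizing set has at most m elements, so a permutation of the coordinates carries
  it into \<open>D'\<close>; setting further variables to zero does no harm.\<close>

lemma noether_normalization_any_coordinates:
  fixes I :: "'k::field_char_0 mpoly set"
  assumes I: "graded_ideal n I" "1 \<notin> I" and m: "krull_dim n I \<le> enat m"
    and D': "D' \<subseteq> {..<n}" "card D' = m"
  obtains g N where "g \<in> GL n" "cofinite_mod n (act n g I) D' N"
proof -
  note II = graded_ideal_is_ideal[OF I(1)]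
  obtain g D N where g: "g \<in> GL n" "D \<subseteq> {..<n}" "cofinite_mod n (act n g I) D N"
    and c: "enat (card D) \<le> krull_dim n I" by (rule noether_normalization[OF I])
  from order_trans[OF c m]
  have "card D \<le> card D'" using D' by simp
  then obtain E where E: "E \<subseteq> D'" "card E = card D" using obtain_subset_with_card_n by metis
  have fin: "finite D" "finite E" using finite_subset[OF _ finite_lessThan] g(2) E(1) D'(1) by blast+
  obtain \<pi>1 where \<pi>1: "bij_betw \<pi>1 D E" using finite_same_card_bij[OF fin] E(2) by auto
  have "card ({..<n} - D) = card ({..<n} - E)"
    using g(2) E D' fin by (simp add: card_Diff_subset)
  then obtain \<pi>2 where \<pi>2: "bij_betw \<pi>2 ({..<n} - D) ({..<n} - E)"
    using finite_same_card_bij[of "{..<n} - D" "{..<n} - E"] by auto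
  define \<pi> where "\<pi> i = (if i \<in> D then \<pi>1 i else \<pi>2 i)" for i
  have "bij_betw \<pi> (D \<union> ({..<n} - D)) (E \<union> ({..<n} - E))"
    unfolding \<pi>_def by (rule bij_betw_disjoint_Un[OF \<pi>1 \<pi>2]) auto
  then have \<pi>: "bij_betw \<pi> {..<n} {..<n}" using g(2) E(1) D'(1) by (simp add: Un_absorb1)
  define h where "h = (\<lambda>i j. if i < n \<and> j = \<pi> i then 1 else (0::'k))"
  have h: "h \<in> GL n" unfolding h_def by (rule permutation_GL[OF \<pi>])
  have "zap D' (lin n h i) = 0" if "i \<in> D" for i
  proof -
    have "\<pi> i \<in> D'" using \<pi>1 that E(1) by (auto simp: \<pi>_def bij_betw_def)
    then show ?thesis unfolding zap_lin by (intro sum.neutral) (auto simp: h_def)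
  qed
  from cofinite_mod_act[OF g(3) h graded_ideal_is_ideal[OF act_graded_ideal[OF I(1) g(1)]] this]
  have "cofinite_mod n (act n (matmul n g h) I) D' N"
    using act_matmul[of I n h g] ideal_PV[OF II] by (simp add: subset_iff)
  then show thesis using that GL_matmul[OF g(1) h] by blast
qed

section \<open>Genericity\<close>

definition polyfun :: "((nat \<Rightarrow> nat \<Rightarrow> 'k::comm_ring_1) \<Rightarrow> 'k) \<Rightarrow> bool" where
  "polyfun \<phi> \<longleftrightarrow> (\<exists>p. \<forall>g. eval_mat p g = \<phi> g)"

lemma polyfun_const: "polyfun (\<lambda>_. c)"
  unfolding polyfun_def by (intro exI[of _ "single 0 c"]) (simp add: eval_mat_eq_pev)

lemma polyfun_entry: "polyfun (\<lambda>g. g i j)"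
  unfolding polyfun_def by (intro exI[of _ "single (single (i, j) 1) 1"]) (simp add: eval_mat_eq_pev)

lemma polyfun_add: "polyfun \<phi> \<Longrightarrow> polyfun \<psi> \<Longrightarrow> polyfun (\<lambda>g. \<phi> g + \<psi> g)"
  and polyfun_mult: "polyfun \<phi> \<Longrightarrow> polyfun \<psi> \<Longrightarrow> polyfun (\<lambda>g. \<phi> g * \<psi> g)"
proof -
  have *: "eval_mat (p + q) g = eval_mat p g + eval_mat q g" "eval_mat (p * q) g = eval_mat p g * eval_mat q g"
    for p q :: "((nat \<times> nat) \<Rightarrow>\<^sub>0 nat) \<Rightarrow>\<^sub>0 'a" and g
  proof -
    interpret e: comm_ring_hom "\<lambda>p. eval_mat p g" by (rule eval_mat_hom)
    show "eval_mat (p + q) g = eval_mat p g + eval_mat q g" "eval_mat (p * q) g = eval_mat p g * eval_mat q g"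
      by (simp_all add: e.hom_add e.hom_mult)
  qed
  show "polyfun \<phi> \<Longrightarrow> polyfun \<psi> \<Longrightarrow> polyfun (\<lambda>g. \<phi> g + \<psi> g)"
    "polyfun \<phi> \<Longrightarrow> polyfun \<psi> \<Longrightarrow> polyfun (\<lambda>g. \<phi> g * \<psi> g)"
    unfolding polyfun_def using * by metis+
qed

lemma polyfun_sum: "(\<And>i. i \<in> A \<Longrightarrow> polyfun (\<phi> i)) \<Longrightarrow> polyfun (\<lambda>g. \<Sum>i\<in>A. \<phi> i g)"
  by (induction A rule: infinite_finite_induct) (auto intro: polyfun_add polyfun_const)

lemma polyfun_prod: "(\<And>i. i \<in> A \<Longrightarrow> polyfun (\<phi> i)) \<Longrightarrow> polyfun (\<lambda>g. \<Prod>i\<in>A. \<phi> i g)"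
  by (induction A rule: infinite_finite_induct) (auto intro: polyfun_mult polyfun_const)

text \<open>Polynomials whose coefficients depend polynomially on the matrix. The finite set of
  monomials common to all \<open>g\<close> makes each coefficient of a product a finite sum with the
  same index set for every \<open>g\<close>.\<close>

definition polyfam :: "((nat \<Rightarrow> nat \<Rightarrow> 'k::comm_ring_1) \<Rightarrow> 'k mpoly) \<Rightarrow> bool" where
  "polyfam F \<longleftrightarrow> (\<exists>T. finite T \<and> (\<forall>g. keys (F g) \<subseteq> T)) \<and> (\<forall>\<nu>. polyfun (\<lambda>g. lookup (F g) \<nu>))"

lemma polyfam_const: "polyfam (\<lambda>_. f)"
  unfolding polyfam_def by (intro conjI allI polyfun_const exI[of _ "keys f"]) auto

lemma polyfam_add:
  assumes "polyfam F" "polyfam G" shows "polyfam (\<lambda>g. F g + G g)"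
proof -
  from assms obtain T T' where T: "finite T" "\<forall>g. keys (F g) \<subseteq> T" "finite T'" "\<forall>g. keys (G g) \<subseteq> T'"
    unfolding polyfam_def by auto
  have "keys (F g + G g) \<subseteq> T \<union> T'" for g using keys_add[of "F g" "G g"] T(2,4) by blast
  then have "finite (T \<union> T')" "\<forall>g. keys (F g + G g) \<subseteq> T \<union> T'" using T(1,3) by simp_all
  then show ?thesis
    using assms unfolding polyfam_def lookup_add by (intro conjI allI polyfun_add) blast+
qed

lemma lookup_mult_superset:
  fixes f g :: "'a::comm_monoid_add \<Rightarrow>\<^sub>0 'k::comm_ring_1"
  assumes "finite S" "keys f \<subseteq> S" "finite T" "keys g \<subseteq> T"
  shows "lookup (f * g) \<nu> = (\<Sum>a\<in>S. \<Sum>b\<in>T. (if a + b = \<nu> then 1 else 0) * (lookup f a * lookup g b))"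
proof -
  have "f = (\<Sum>a\<in>S. single a (lookup f a))" if "finite S" "keys f \<subseteq> S" for S and f :: "'a \<Rightarrow>\<^sub>0 'k"
    using that by (intro poly_mapping_eqI) (auto simp: lookup_sum lookup_single' sum.delta in_keys_iff)
  then have "f * g = (\<Sum>a\<in>S. single a (lookup f a)) * (\<Sum>b\<in>T. single b (lookup g b))"
    using assms by metis
  then show ?thesis
    by (simp add: sum_product mult_single lookup_sum lookup_single')
      (intro sum.cong refl, auto)
qed

lemma polyfam_mult:
  assumes "polyfam F" "polyfam G" shows "polyfam (\<lambda>g. F g * G g)"
proof -
  from assms obtain T T' where T: "finite T" "\<forall>g. keys (F g) \<subseteq> T" "finite T'" "\<forall>g. keys (G g) \<subseteq> T'"
    unfolding polyfam_def by auto
  have "finite ((\<lambda>(a, b). a + b) ` (T \<times> T'))" using T by simp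
  moreover have "\<forall>g. keys (F g * G g) \<subseteq> (\<lambda>(a, b). a + b) ` (T \<times> T')"
    using T by (fastforce elim!: keys_multE)
  moreover have "polyfun (\<lambda>g. lookup (F g * G g) \<nu>)" for \<nu>
    using assms T unfolding polyfam_def
    by (subst lookup_mult_superset[of T _ T']) (auto intro!: polyfun_sum polyfun_mult polyfun_const)
  ultimately show ?thesis unfolding polyfam_def by blast
qed

lemma polyfam_sum: "(\<And>i. i \<in> A \<Longrightarrow> polyfam (F i)) \<Longrightarrow> polyfam (\<lambda>g. \<Sum>i\<in>A. F i g)"
  by (induction A rule: infinite_finite_induct) (auto intro: polyfam_add polyfam_const)

lemma polyfam_prod: "(\<And>i. i \<in> A \<Longrightarrow> polyfam (F i)) \<Longrightarrow> polyfam (\<lambda>g. \<Prod>i\<in>A. F i g)"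
  by (induction A rule: infinite_finite_induct) (auto intro: polyfam_mult polyfam_const)

lemma polyfam_power: "polyfam F \<Longrightarrow> polyfam (\<lambda>g. F g ^ k)"
  by (induction k) (auto intro: polyfam_mult polyfam_const)

lemma polyfam_entry: "polyfam (\<lambda>g. single 0 (g i j))"
proof -
  have "polyfun (\<lambda>g. lookup (single 0 (g i j) :: 'a mpoly) \<nu>)" for \<nu>
    by (cases "\<nu> = 0") (auto simp: lookup_single' polyfun_entry polyfun_const)
  then show ?thesis unfolding polyfam_def by (auto intro!: exI[of _ "{0}"])
qed

lemma polyfam_subst_lin: "polyfam (\<lambda>g. subst (lin n g) f)"
  unfolding subst_def lin_def
  by (intro polyfam_sum polyfam_mult polyfam_prod polyfam_power polyfam_const polyfam_entry)

lemma polyfun_coeff: "polyfun (\<lambda>g. lookup (subst (lin n g) f) \<nu>)"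
  using polyfam_subst_lin unfolding polyfam_def by blast

lemma polyfun_det:
  assumes "\<And>i j. i < t \<Longrightarrow> j < t \<Longrightarrow> polyfun (\<lambda>g. M g i j)"
  shows "polyfun (\<lambda>g. det (jmat t (M g)))"
proof -
  have "det (jmat t (M g)) = (\<Sum>p | p permutes {0..<t}. signof p * (\<Prod>i = 0..<t. M g i (p i)))" for g
    unfolding det_def'[OF jmat_carrier] using permutes_in_image
    by (intro sum.cong arg_cong2[of _ _ _ _ "(*)"] prod.cong refl) (fastforce simp: jmat_def)
  moreover have "polyfun (\<lambda>g. \<Sum>p | p permutes {0..<t}. signof p * (\<Prod>i = 0..<t. M g i (p i)))"
    using assms permutes_in_image
    by (intro polyfun_sum polyfun_mult polyfun_prod polyfun_const) fastforce
  ultimately show ?thesis by simp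
qed

text \<open>On the line through \<open>g1\<close> and \<open>g2\<close> the determinant and both
  conditions become univariate polynomials, each nonzero at one of the two points; an infinite field
  contains a common non-root.\<close>

lemma GL_irreducible:
  fixes p1 p2 :: "((nat \<times> nat) \<Rightarrow>\<^sub>0 nat) \<Rightarrow>\<^sub>0 'k::field_char_0"
  assumes "g1 \<in> GL n" "eval_mat p1 g1 \<noteq> 0" "g2 \<in> GL n" "eval_mat p2 g2 \<noteq> 0"
  obtains g where "g \<in> GL n" "eval_mat p1 g \<noteq> 0" "eval_mat p2 g \<noteq> 0"
proof -
  define L where "L t i j = g1 i j + t * (g2 i j - g1 i j)" for t i j
  define F where "F = pev (\<lambda>c. [:c:]) (\<lambda>ij. [:g1 (fst ij) (snd ij), g2 (fst ij) (snd ij) - g1 (fst ij) (snd ij):])"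
  have F: "poly (F p) t = eval_mat p (L t)" for p t
    unfolding F_def eval_mat_eq_pev by (subst hom_pev[OF poly_eval_hom const_poly_hom]) (simp add: L_def)
  define E where "E = det (jmat n (\<lambda>i j. [:g1 i j, g2 i j - g1 i j:]))"
  have E: "poly E t = det (jmat n (L t))" for t
  proof -
    interpret e: comm_ring_hom "\<lambda>p. poly p t" by (rule poly_eval_hom)
    have "map_mat (\<lambda>p. poly p t) (jmat n (\<lambda>i j. [:g1 i j, g2 i j - g1 i j:])) = jmat n (L t)"
      by (rule eq_matI) (auto simp: jmat_def L_def)
    then show ?thesis unfolding E_def by (simp flip: e.hom_det)
  qed
  have L0: "L 0 = g1" "L 1 = g2" by (auto simp: L_def fun_eq_iff)
  have "poly E 0 \<noteq> 0" "poly (F p1) 0 \<noteq> 0" "poly (F p2) 1 \<noteq> 0"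
    using assms by (auto simp: E F L0 GL_det)
  then have "E * F p1 * F p2 \<noteq> 0" by auto
  then obtain t where "poly (E * F p1 * F p2) t \<noteq> 0" using poly_all_0_iff_0 by blast
  then have "det (jmat n (L t)) \<noteq> 0" "eval_mat p1 (L t) \<noteq> 0" "eval_mat p2 (L t) \<noteq> 0"
    by (auto simp: E F)
  moreover have "L t i j = 0" if "n \<le> i \<or> n \<le> j" for i j
    using that assms(1,3) by (simp add: L_def GL_zero)
  ultimately show thesis using that[of "L t"] by (simp add: GL_det)
qed

lemma generic_finite_Int:
  fixes R :: "'a \<Rightarrow> (nat \<Rightarrow> nat \<Rightarrow> 'k::field_char_0) \<Rightarrow> bool"
  assumes "finite X"
    and "\<And>x. x \<in> X \<Longrightarrow> \<exists>p. (\<exists>g\<in>GL n. eval_mat p g \<noteq> 0) \<and> (\<forall>g\<in>GL n. eval_mat p g \<noteq> 0 \<longrightarrow> R x g)"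
  shows "\<exists>p. (\<exists>g\<in>GL n. eval_mat p g \<noteq> 0) \<and> (\<forall>g\<in>GL n. eval_mat p g \<noteq> 0 \<longrightarrow> (\<forall>x\<in>X. R x g))"
  using assms
proof (induction X rule: finite_induct)
  case empty
  interpret e: comm_ring_hom "\<lambda>p. eval_mat p g" for g :: "nat \<Rightarrow> nat \<Rightarrow> 'k" by (rule eval_mat_hom)
  show ?case using GL_one by (intro exI[of _ 1]) auto
next
  case (insert x X)
  obtain p1 g1 where 1: "g1 \<in> GL n" "eval_mat p1 g1 \<noteq> 0" "\<forall>g\<in>GL n. eval_mat p1 g \<noteq> 0 \<longrightarrow> R x g"
    using insert.prems by blast
  obtain p2 g2 where 2: "g2 \<in> GL n" "eval_mat p2 g2 \<noteq> 0" "\<forall>g\<in>GL n. eval_mat p2 g \<noteq> 0 \<longrightarrow> (\<forall>x\<in>X. R x g)"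
    using insert by blast
  interpret e: comm_ring_hom "\<lambda>p. eval_mat p g" for g :: "nat \<Rightarrow> nat \<Rightarrow> 'k" by (rule eval_mat_hom)
  from GL_irreducible[OF 1(1,2) 2(1,2)]
  obtain g where "g \<in> GL n" "eval_mat p1 g \<noteq> 0" "eval_mat p2 g \<noteq> 0" .
  then show ?case using 1(3) 2(3) by (intro exI[of _ "p1 * p2"]) (auto simp: e.hom_mult)
qed

lemma mdeg_split: "N \<le> mdeg \<nu> \<Longrightarrow> \<exists>\<nu>1 \<nu>2. \<nu> = \<nu>1 + \<nu>2 \<and> mdeg \<nu>1 = N"
proof (induction N)
  case 0
  show ?case by (intro exI[of _ 0] exI[of _ \<nu>]) simp
next
  case (Suc N)
  then obtain \<nu>1 \<nu>2 where s: "\<nu> = \<nu>1 + \<nu>2" "mdeg \<nu>1 = N" by auto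
  then have "\<nu>2 \<noteq> 0" using Suc.prems by auto
  then obtain b where "b \<in> keys \<nu>2" by (metis keys_eq_empty ex_in_conv)
  from single_add_split[OF this] s(1) have "\<nu> = (\<nu>1 + single b 1) + (\<nu>2 - single b 1)"
    by (metis add.assoc)
  with s(2) show ?case by (intro exI[of _ "\<nu>1 + single b 1"] exI[of _ "\<nu>2 - single b 1"]) (simp add: mdeg_add)
qed

text \<open>Each monomial of degree at least \<open>N\<close> is a multiple of one of degree exactly
  \<open>N\<close>, and monomials meeting \<open>D\<close> become zero. Only finitely many monomials
  need testing, which is what makes the condition open.\<close>

lemma cofinite_mod_of_monomials:
  fixes J :: "'k::field mpoly set"
  assumes J: "is_ideal n J"
    and mono: "\<And>\<nu>. keys \<nu> \<subseteq> {..<n} - D \<Longrightarrow> mdeg \<nu> = N \<Longrightarrow> \<exists>j\<in>J. zap D (single \<nu> 1) = zap D j"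
  shows "cofinite_mod n J D N"
  unfolding cofinite_mod_def
proof (intro allI impI ballI)
  fix d and p :: "'k mpoly" assume p: "N \<le> d" "p \<in> PV {..<n}" "homog d p"
  have "\<exists>j\<in>J. zap D (single \<nu> (lookup p \<nu>)) = zap D j" if \<nu>: "\<nu> \<in> keys p" for \<nu>
  proof (cases "keys \<nu> \<inter> D = {}")
    case True
    have k: "keys \<nu> \<subseteq> {..<n}" "mdeg \<nu> = d" using p \<nu> by (auto simp: PV_def homog_def)
    then obtain \<nu>1 \<nu>2 where s: "\<nu> = \<nu>1 + \<nu>2" "mdeg \<nu>1 = N" using mdeg_split p(1) by blast
    then have "keys \<nu>1 \<subseteq> {..<n} - D" "keys \<nu>2 \<subseteq> {..<n}" using k True by (auto simp: keys_plus_nat)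
    then obtain j where j: "j \<in> J" "zap D (single \<nu>1 1) = zap D j" using mono s(2) by blast
    have "single \<nu> (lookup p \<nu>) = single \<nu>2 (lookup p \<nu>) * single \<nu>1 1"
      by (simp add: mult_single s(1) add.commute)
    then have "zap D (single \<nu> (lookup p \<nu>)) = zap D (single \<nu>2 (lookup p \<nu>) * j)"
      by (simp add: zap.hom_mult j(2))
    moreover have "single \<nu>2 (lookup p \<nu>) * j \<in> J"
      using \<open>keys \<nu>2 \<subseteq> {..<n}\<close> by (intro ideal_mult[OF J] j PV_single)
    ultimately show ?thesis by blast
  next
    case False
    then have "zap D (single \<nu> (lookup p \<nu>)) = zap D 0" by (simp add: zap_single)
    then show ?thesis using ideal_0[OF J] by blast
  qed
  then obtain j where j: "\<And>\<nu>. \<nu> \<in> keys p \<Longrightarrow> j \<nu> \<in> J"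
    "\<And>\<nu>. \<nu> \<in> keys p \<Longrightarrow> zap D (single \<nu> (lookup p \<nu>)) = zap D (j \<nu>)" by metis
  have "zap D p = (\<Sum>\<nu>\<in>keys p. zap D (single \<nu> (lookup p \<nu>)))"
    unfolding zap.hom_sum[symmetric] poly_mapping_sum_single ..
  also have "\<dots> = zap D (\<Sum>\<nu>\<in>keys p. j \<nu>)" unfolding zap.hom_sum using j(2) by simp
  finally show "\<exists>j\<in>J. zap D p = zap D j" using ideal_sum[OF J, of "keys p" j] j(1) by blast
qed

text \<open>The monomials of degree \<open>N\<close> off \<open>D\<close> are reduced to zero by polynomials \<open>F \<nu>\<close> of the ideal; the
  determinant of the coefficient matrix of the transformed \<open>F \<nu>\<close> is polynomial in \<open>g\<close> and equals \<open>1\<close> at \<open>g0\<close>.\<close>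

lemma cofinite_mod_open:
  fixes I :: "'k::field mpoly set"
  assumes I: "graded_ideal n I" and g0: "g0 \<in> GL n" and cof: "cofinite_mod n (act n g0 I) D N"
  shows "\<exists>p. (\<exists>g\<in>GL n. eval_mat p g \<noteq> 0) \<and>
    (\<forall>g\<in>GL n. eval_mat p g \<noteq> 0 \<longrightarrow> cofinite_mod n (act n g I) D N)"
proof -
  define T where "T = {\<nu>. keys \<nu> \<subseteq> {..<n} - D \<and> mdeg \<nu> = N}"
  have "finite T" unfolding T_def by (rule finite_subset[OF _ finite_monomials[of n N]]) auto
  then obtain h where h: "bij_betw h {0..<card T} T" using ex_bij_betw_nat_finite by blast
  define t where "t = card T"
  have hT: "h i \<in> T" if "i < t" for i using h that by (auto simp: bij_betw_def t_def)
  have hE: "\<exists>i<t. \<nu> = h i" if "\<nu> \<in> T" for \<nu>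
  proof -
    have "\<nu> \<in> h ` {0..<t}" using h that by (simp add: bij_betw_def t_def)
    then show ?thesis by auto
  qed
  have hinj: "h i = h k \<longleftrightarrow> i = k" if "i < t" "k < t" for i k
    using h that by (auto simp: bij_betw_def t_def inj_on_def)
  have "\<exists>f\<in>I. homog N f \<and> zap D (subst (lin n g0) f) = single \<nu> 1" if \<nu>: "\<nu> \<in> T" for \<nu>
  proof -
    have k: "keys \<nu> \<subseteq> {..<n}" "mdeg \<nu> = N" "keys \<nu> \<inter> D = {}" using \<nu> by (auto simp: T_def)
    obtain j where j: "j \<in> act n g0 I" "homog N j" "zap D (single \<nu> 1) = zap D j"
      using cofinite_modE[OF cof act_graded_ideal[OF I g0] PV_single[OF k(1)] homog_single, of 1] k(2) by auto
    then obtain f where f: "f \<in> I" "j = subst (lin n g0) f" by (auto simp: act_eq)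
    have "subst (lin n g0) (homog_comp N f) = j"
      using homog_comp_subst[of "lin n g0", OF homog_lin, of N f] homog_comp_homog[OF j(2)] f(2) by simp
    then show ?thesis
      using graded_ideal_homog_comp[OF I f(1)] j(3) k(3)
      by (intro bexI[of _ "homog_comp N f"]) (auto simp: zap_single)
  qed
  then obtain F where F: "\<And>\<nu>. \<nu> \<in> T \<Longrightarrow> F \<nu> \<in> I" "\<And>\<nu>. \<nu> \<in> T \<Longrightarrow> homog N (F \<nu>)"
    "\<And>\<nu>. \<nu> \<in> T \<Longrightarrow> zap D (subst (lin n g0) (F \<nu>)) = single \<nu> 1" by metis
  define M where "M g i k = lookup (subst (lin n g) (F (h i))) (h k)" for g i k
  have "polyfun (\<lambda>g. det (jmat t (M g)))" unfolding M_def by (intro polyfun_det polyfun_coeff)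
  then obtain p where p: "\<And>g. eval_mat p g = det (jmat t (M g))" unfolding polyfun_def by blast
  have "M g0 i k = (if i = k then 1 else 0)" if "i < t" "k < t" for i k
  proof -
    have "keys (h k) \<inter> D = {}" using hT[OF that(2)] by (auto simp: T_def)
    then have "M g0 i k = lookup (zap D (subst (lin n g0) (F (h i)))) (h k)" by (simp add: M_def lookup_zap)
    then show ?thesis using F(3)[OF hT[OF that(1)]] hinj[OF that] by (simp add: lookup_single')
  qed
  then have "jmat t (M g0) = 1\<^sub>m t" by (intro eq_matI) (auto simp: jmat_def)
  then have "eval_mat p g0 \<noteq> 0" by (simp add: p)
  moreover have "cofinite_mod n (act n g I) D N" if g: "g \<in> GL n" "eval_mat p g \<noteq> 0" for g
  proof (rule cofinite_mod_of_monomials)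
    note J = graded_ideal_is_ideal[OF act_graded_ideal[OF I g(1)]]
    show "is_ideal n (act n g I)" by (rule J)
    fix \<nu> assume "keys \<nu> \<subseteq> {..<n} - D" "mdeg \<nu> = N"
    then have \<nu>: "\<nu> \<in> T" by (simp add: T_def)
    then obtain l where l: "l < t" "\<nu> = h l" using hE by blast
    let ?M = "jmat t (M g)"
    define B where "B = inverse (det ?M) \<cdot>\<^sub>m adj_mat ?M"
    have B: "B \<in> carrier_mat t t" "B * ?M = 1\<^sub>m t"
      using adj_mat[OF jmat_carrier, of t "M g"] g(2)
      by (simp_all add: B_def p mult_smult_assoc_mat[of _ t t _ t]) (auto intro!: eq_matI)
    have Bk: "(\<Sum>i<t. B $$ (l, i) * M g i k) = (if l = k then 1 else 0)" if "k < t" for k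
    proof -
      have "(B * ?M) $$ (l, k) = (\<Sum>i<t. B $$ (l, i) * M g i k)"
        using B(1) l(1) that by (simp add: scalar_prod_def atLeast0LessThan jmat_def)
      then show ?thesis using B(2) l(1) that by simp
    qed
    \<comment> \<open>Row \<open>l\<close> of the inverse coefficient matrix combines the
      transformed forms so that, off \<open>D\<close>, only the monomial number \<open>l\<close>
      remains.\<close>
    define y where "y = (\<Sum>i<t. single 0 (B $$ (l, i)) * subst (lin n g) (F (h i)))"
    have y: "y \<in> act n g I"
      unfolding y_def using F(1)[OF hT] by (intro ideal_sum[OF J] ideal_mult[OF J]) (auto simp: act_eq)
    have "homog (0 + N) (single 0 (B $$ (l, i)) * subst (lin n g) (F (h i)))" if "i < t" for i
      using that by (intro homog_mult homog_const homog_subst_lin F hT)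
    then have yh: "homog N y" unfolding y_def by (intro homog_sum) auto
    have "lookup (zap D (single \<nu> 1)) \<mu> = lookup (zap D y) \<mu>" for \<mu>
    proof (cases "keys \<mu> \<inter> D = {}")
      case D: True
      show ?thesis
      proof (cases "\<mu> \<in> T")
        case True
        then obtain k where k: "k < t" "\<mu> = h k" using hE by blast
        have "lookup y \<mu> = (\<Sum>i<t. B $$ (l, i) * M g i k)"
          by (simp add: y_def lookup_sum lookup_const_mult M_def k)
        then show ?thesis using D Bk[OF k(1)] hinj[OF l(1) k(1)] l(2) k(2) by (simp add: lookup_zap lookup_single')
      next
        case False
        then have "\<mu> \<notin> keys y"
          using D yh ideal_PV[OF J y] by (auto simp: T_def homog_def PV_def)
        then show ?thesis using False \<nu> by (auto simp: lookup_zap lookup_single' in_keys_iff)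
      qed
    qed (simp add: lookup_zap)
    then have "zap D (single \<nu> 1) = zap D y" by (rule poly_mapping_eqI)
    then show "\<exists>j\<in>act n g I. zap D (single \<nu> 1) = zap D j" using y by blast
  qed
  ultimately show ?thesis using g0 by blast
qed

lemma generic_cofinite_mod:
  fixes I :: "'k::field_char_0 mpoly set"
  assumes I: "graded_ideal n I" "1 \<notin> I" and m: "krull_dim n I \<le> enat m"
  shows "\<exists>p. (\<exists>g\<in>GL n. eval_mat p g \<noteq> 0) \<and> (\<forall>g\<in>GL n. eval_mat p g \<noteq> 0 \<longrightarrow>
    (\<forall>D\<in>{D. D \<subseteq> {..<n} \<and> card D = m}. \<exists>N. cofinite_mod n (act n g I) D N))"
proof (rule generic_finite_Int)
  show "finite {D. D \<subseteq> {..<n} \<and> card D = m}" by simp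
  fix D assume D: "D \<in> {D. D \<subseteq> {..<n} \<and> card D = m}"
  then obtain g0 N where "g0 \<in> GL n" "cofinite_mod n (act n g0 I) D N"
    using noether_normalization_any_coordinates[OF I m] by blast
  from cofinite_mod_open[OF I(1) this]
  show "\<exists>p. (\<exists>g\<in>GL n. eval_mat p g \<noteq> 0) \<and>
    (\<forall>g\<in>GL n. eval_mat p g \<noteq> 0 \<longrightarrow> (\<exists>N. cofinite_mod n (act n g I) D N))" by blast
qed

section \<open>Initial forms\<close>

lemma keys_init_form: "keys (init_form \<omega> f) = {\<nu>\<in>keys f. \<forall>\<mu>\<in>keys f. wdeg \<omega> \<nu> \<le> wdeg \<omega> \<mu>}"
proof -
  have "lookup (init_form \<omega> f) \<mu> = (if \<mu> \<in> {\<nu>\<in>keys f. \<forall>\<mu>\<in>keys f. wdeg \<omega> \<nu> \<le> wdeg \<omega> \<mu>} then lookup f \<mu> else 0)" for \<mu>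
    unfolding init_form_def by (simp add: lookup_sum lookup_single')
  then have "\<mu> \<in> keys (init_form \<omega> f) \<longleftrightarrow> \<mu> \<in> {\<nu>\<in>keys f. \<forall>\<mu>\<in>keys f. wdeg \<omega> \<nu> \<le> wdeg \<omega> \<mu>}" for \<mu>
    unfolding in_keys_iff by (simp add: in_keys_iff)
  then show ?thesis by blast
qed

lemma wdeg_superset: "finite K \<Longrightarrow> keys \<nu> \<subseteq> K \<Longrightarrow> wdeg \<omega> \<nu> = (\<Sum>i\<in>K. \<omega> i * real (lookup \<nu> i))"
  unfolding wdeg_def by (rule sum.mono_neutral_left) (auto simp: in_keys_iff)

lemma wdeg_add: "wdeg \<omega> (\<nu> + \<mu>) = wdeg \<omega> \<nu> + wdeg \<omega> \<mu>"
  using wdeg_superset[of "keys \<nu> \<union> keys \<mu>"] by (simp add: keys_plus_nat lookup_add sum.distrib algebra_simps)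

lemma wdeg_ge: "(\<And>i. i \<in> keys \<nu> \<Longrightarrow> c \<le> \<omega> i) \<Longrightarrow> c * real (mdeg \<nu>) \<le> wdeg \<omega> \<nu>"
  unfolding wdeg_def mdeg_def by (auto simp: sum_distrib_left intro!: sum_mono mult_right_mono)

lemma wdeg_gt:
  assumes "\<And>i. i \<in> keys \<nu> \<Longrightarrow> c \<le> \<omega> i" "i \<in> keys \<nu>" "c < \<omega> i"
  shows "c * real (mdeg \<nu>) < wdeg \<omega> \<nu>"
  unfolding wdeg_def mdeg_def of_nat_sum sum_distrib_left
  by (rule sum_strict_mono_ex1) (use assms in \<open>auto simp: in_keys_iff intro!: mult_right_mono bexI[of _ i]\<close>)

lemma wdeg_eq: "(\<And>i. i \<in> keys \<nu> \<Longrightarrow> \<omega> i = c) \<Longrightarrow> wdeg \<omega> \<nu> = c * real (mdeg \<nu>)"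
  unfolding wdeg_def mdeg_def by (simp add: sum_distrib_left)

lemma cofinite_mod_init_monomial:
  fixes J :: "'k::field mpoly set"
  assumes J: "graded_ideal n J" and cof: "cofinite_mod n J D N" and i: "i < n" "i \<notin> D"
    and min: "\<And>k. k < n \<Longrightarrow> \<omega> i \<le> \<omega> k" and D: "\<And>k. k \<in> D \<Longrightarrow> \<omega> i < \<omega> k"
  shows "\<exists>f\<in>J. is_monomial (init_form \<omega> f)"
proof -
  let ?\<nu> = "single i N"
  have k: "keys ?\<nu> \<subseteq> {..<n}" "keys ?\<nu> \<inter> D = {}" using i by auto
  obtain j where j: "j \<in> J" "homog N j" "zap D (single ?\<nu> 1) = zap D j"
    using cofinite_modE[OF cof J PV_single[OF k(1)] homog_single, of 1] by auto
  have l: "lookup j \<mu> = (if \<mu> = ?\<nu> then 1 else 0)" if "keys \<mu> \<inter> D = {}" for \<mu>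
    using that arg_cong[OF j(3), of "\<lambda>f. lookup f \<mu>"] k(2) by (auto simp: lookup_zap lookup_single' split: if_splits)
  have \<nu>: "?\<nu> \<in> keys j" using l[OF k(2)] by (simp add: in_keys_iff)
  \<comment> \<open>All terms of \<open>j\<close> have degree \<open>N\<close>. Each term other than
    x_i^N contains a variable from \<open>D\<close>, whose weight is larger than \<omega>_i, while
    no weight is smaller.\<close>
  have "wdeg \<omega> ?\<nu> < wdeg \<omega> \<mu>" if \<mu>: "\<mu> \<in> keys j" "\<mu> \<noteq> ?\<nu>" for \<mu>
  proof -
    obtain b where b: "b \<in> keys \<mu>" "b \<in> D" using l[of \<mu>] \<mu> by (auto simp: in_keys_iff)
    have "keys \<mu> \<subseteq> {..<n}" using ideal_PV[OF graded_ideal_is_ideal[OF J] j(1)] \<mu>(1) by (auto simp: PV_def)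
    then have "\<omega> i * real (mdeg \<mu>) < wdeg \<omega> \<mu>" using b min D by (intro wdeg_gt[of _ _ _ b]) auto
    moreover have "mdeg \<mu> = N" using j(2) \<mu>(1) by (simp add: homog_def)
    moreover have "wdeg \<omega> ?\<nu> = \<omega> i * real N" by (simp add: wdeg_superset[of "{i}"])
    ultimately show ?thesis by simp
  qed
  then have "keys (init_form \<omega> j) = {?\<nu>}"
    unfolding keys_init_form using \<nu> by (auto simp: less_le_not_le)
  then show ?thesis using j(1) by (intro bexI[of _ j]) (simp_all add: is_monomial_def)
qed

section \<open>Few monomials span modulo an ideal with a monomial initial form\<close>

text \<open>Only the m - 1 exponents at indices in \<open>D\<close> other than \<open>i\<close> are
  unbounded; this gives order d^(m-1).\<close>

definition small_monoms :: "nat \<Rightarrow> nat \<Rightarrow> nat \<Rightarrow> (nat \<Rightarrow>\<^sub>0 nat) set" where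
  "small_monoms n m L = {\<mu>. keys \<mu> \<subseteq> {..<n} \<and>
     (\<exists>D i. D \<subseteq> {..<n} \<and> card D = m \<and> i \<in> D \<and> (\<forall>j\<in>insert i ({..<n} - D). lookup \<mu> j < L))}"

text \<open>Modulo the ideal a monomial \<open>x\<^sup>\<sigma> x\<^sup>q\<close> with \<open>\<sigma>\<close> dividing \<open>\<nu>\<close> is rewritten without lowering its weight. Either
  \<open>\<sigma>\<close> grows towards \<open>\<nu>\<close>, at which point the initial monomial \<open>x\<^sup>\<nu>\<close> is replaced by monomials of larger weight, or
  \<open>q\<close> omits a variable \<open>x\<^sub>i\<close> and is rewritten by finiteness over a set \<open>D\<close> of coordinates containing \<open>i\<close> and all
  coordinates of non-minimal weight.\<close>

lemma spanned_by_small_monoms: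
  fixes J :: "'k::field mpoly set"
  assumes J: "graded_ideal n J" and mn: "m \<le> n"
    and cof: "\<And>D. D \<subseteq> {..<n} \<Longrightarrow> card D = m \<Longrightarrow> \<exists>N. cofinite_mod n J D N"
    and c: "\<And>i. i < n \<Longrightarrow> c \<le> \<omega> i" and B: "card {i. i < n \<and> \<omega> i \<noteq> c} < m"
    and f: "f \<in> J" "keys (init_form \<omega> f) = {\<nu>}"
  obtains L where "\<And>\<mu>. keys \<mu> \<subseteq> {..<n} \<Longrightarrow>
    \<exists>j\<in>J. keys (single \<mu> 1 - j) \<subseteq> {\<kappa>\<in>small_monoms n m L. mdeg \<kappa> = mdeg \<mu>}"
proof -
  note JI = graded_ideal_is_ideal[OF J]
  let ?X = "{D. D \<subseteq> {..<n} \<and> card D = m}"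
  have "\<forall>D. \<exists>N. D \<in> ?X \<longrightarrow> cofinite_mod n J D N" using cof by auto
  from choice[OF this] obtain N' where N': "\<And>D. D \<in> ?X \<Longrightarrow> cofinite_mod n J D (N' D)" by auto
  \<comment> \<open>A common bound for all \<open>D\<close>: the finiteness condition persists when
    its bound is increased.\<close>
  define N where "N = (\<Sum>D\<in>?X. N' D)"
  have cofN: "cofinite_mod n J D N" if D: "D \<subseteq> {..<n}" "card D = m" for D
  proof -
    have "N' D \<le> N" unfolding N_def using D by (intro member_le_sum) auto
    then show ?thesis using N'[of D] D unfolding cofinite_mod_def by (auto dest: order_trans)
  qed
  have \<nu>f: "\<nu> \<in> keys f" "\<And>\<mu>. \<mu> \<in> keys f \<Longrightarrow> wdeg \<omega> \<nu> \<le> wdeg \<omega> \<mu>"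
    using f(2) unfolding keys_init_form by blast+
  have \<nu>min: "wdeg \<omega> \<nu> < wdeg \<omega> \<mu>" if "\<mu> \<in> keys f" "\<mu> \<noteq> \<nu>" for \<mu>
  proof (rule ccontr)
    assume "\<not> ?thesis"
    then have "\<mu> \<in> keys (init_form \<omega> f)" unfolding keys_init_form using that \<nu>f(2) by force
    then show False using f(2) that by simp
  qed
  have \<nu>n: "keys \<nu> \<subseteq> {..<n}" using \<nu>f(1) ideal_PV[OF JI f(1)] by (auto simp: PV_def)
  \<comment> \<open>The form \<open>f\<close> need not be homogeneous. Its component in the degree
    of \<open>\<nu>\<close> lies in \<open>J\<close> and has the same initial monomial; scaling
    makes the coefficient 1.\<close>
  define h where "h = single 0 (inverse (lookup f \<nu>)) * homog_comp (mdeg \<nu>) f"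
  have hJ: "h \<in> J" unfolding h_def by (intro ideal_mult[OF JI] graded_ideal_homog_comp[OF J] f) simp
  have lh: "lookup h \<mu> = (if mdeg \<mu> = mdeg \<nu> then inverse (lookup f \<nu>) * lookup f \<mu> else 0)" for \<mu>
    by (simp add: h_def lookup_const_mult lookup_homog_comp)
  have h\<nu>: "\<mu> \<in> keys f \<and> \<mu> \<noteq> \<nu> \<and> mdeg \<mu> = mdeg \<nu>" if "\<mu> \<in> keys (single \<nu> 1 - h)" for \<mu>
    using that \<nu>f(1) by (auto simp: in_keys_iff lookup_minus lookup_single' lh split: if_splits)
  \<comment> \<open>In an irreducible monomial, \<open>\<sigma>\<close> contributes at most
    \<open>mdeg \<nu>\<close> to an exponent, and \<open>q\<close> contributes less than
    \<open>N\<close> off \<open>D\<close> and nothing at \<open>i\<close>.\<close>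
  define L where "L = N + mdeg \<nu> + 1"
  show thesis
  proof (rule that[of L])
    fix \<mu>0 :: "nat \<Rightarrow>\<^sub>0 nat" assume \<mu>0: "keys \<mu>0 \<subseteq> {..<n}"
    define d where "d = mdeg \<mu>0"
    define Sm where "Sm = {\<kappa>\<in>small_monoms n m L. mdeg \<kappa> = d}"
    define X where "X = {p. \<exists>j\<in>J. keys (p - j) \<subseteq> Sm}"
    have XJ: "p \<in> X" if "p \<in> J" for p unfolding X_def using that by (auto intro!: bexI[of _ p])
    have Xadd: "p + q \<in> X" if "p \<in> X" "q \<in> X" for p q
    proof -
      from that obtain j k where "j \<in> J" "keys (p - j) \<subseteq> Sm" "k \<in> J" "keys (q - k) \<subseteq> Sm"
        unfolding X_def by blast
      moreover have "keys (p + q - (j + k)) \<subseteq> keys (p - j) \<union> keys (q - k)"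
        using keys_add[of "p - j" "q - k"] by (simp add: algebra_simps)
      ultimately show ?thesis unfolding X_def using ideal_add[OF JI] by blast
    qed
    have Xscale: "single 0 a * p \<in> X" if "p \<in> X" for a p
    proof -
      from that obtain j where j: "j \<in> J" "keys (p - j) \<subseteq> Sm" unfolding X_def by blast
      have "keys (single 0 a * p - single 0 a * j) \<subseteq> keys (p - j)"
        by (auto simp: in_keys_iff lookup_minus lookup_const_mult)
      moreover have "single 0 a * j \<in> J" by (intro ideal_mult[OF JI] j) simp
      ultimately show ?thesis unfolding X_def using j(2) by blast
    qed
    have X_keys: "p \<in> X" if "\<And>\<kappa>. \<kappa> \<in> keys p \<Longrightarrow> single \<kappa> 1 \<in> X" for p
    proof -
      have "(\<Sum>\<kappa>\<in>S. single \<kappa> (lookup p \<kappa>)) \<in> X" if "\<And>\<kappa>. \<kappa> \<in> S \<Longrightarrow> single \<kappa> 1 \<in> X" for S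
        using that
      proof (induction S rule: infinite_finite_induct)
        case (insert \<kappa> S)
        have "single 0 (lookup p \<kappa>) * single \<kappa> 1 \<in> X" using insert.prems by (intro Xscale) auto
        then show ?case using insert by (auto simp: mult_single intro!: Xadd)
      qed (auto intro: XJ ideal_0[OF JI])
      from this[of "keys p"] that show ?thesis by (simp add: poly_mapping_sum_single)
    qed
    \<comment> \<open>Outermost of three nested inductions: among the finitely many monomials of
      degree \<open>d\<close>, the number of those heavier than \<open>\<mu>\<close>
      decreases.\<close>
    have "single \<mu> 1 \<in> X" if "keys \<mu> \<subseteq> {..<n}" "mdeg \<mu> = d" for \<mu>
      using that
    proof (induction "card {\<kappa>. keys \<kappa> \<subseteq> {..<n} \<and> mdeg \<kappa> = d \<and> wdeg \<omega> \<mu> < wdeg \<omega> \<kappa>}" arbitrary: \<mu> rule: less_induct)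
      case (less \<mu>)
      have heavier: "single \<kappa> 1 \<in> X" if \<kappa>: "keys \<kappa> \<subseteq> {..<n}" "mdeg \<kappa> = d" "wdeg \<omega> \<mu> < wdeg \<omega> \<kappa>" for \<kappa>
      proof (rule less.hyps[OF _ \<kappa>(1,2)], rule psubset_card_mono)
        show "finite {\<kappa>. keys \<kappa> \<subseteq> {..<n} \<and> mdeg \<kappa> = d \<and> wdeg \<omega> \<mu> < wdeg \<omega> \<kappa>}"
          by (rule finite_subset[OF _ finite_monomials[of n d]]) auto
        show "{\<kappa>'. keys \<kappa>' \<subseteq> {..<n} \<and> mdeg \<kappa>' = d \<and> wdeg \<omega> \<kappa> < wdeg \<omega> \<kappa>'}
            \<subset> {\<kappa>. keys \<kappa> \<subseteq> {..<n} \<and> mdeg \<kappa> = d \<and> wdeg \<omega> \<mu> < wdeg \<omega> \<kappa>}"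
          using \<kappa> by force
      qed
      have "single (\<sigma> + q) 1 \<in> X"
        if "\<nu> = \<sigma> + \<rho>" "keys q \<subseteq> {..<n}" "mdeg (\<sigma> + q) = d" "wdeg \<omega> \<mu> \<le> wdeg \<omega> (\<sigma> + q)" for \<sigma> \<rho> q
        using that
      proof (induction "mdeg \<rho>" arbitrary: \<sigma> \<rho> q)
        case 0
        then have \<sigma>: "\<sigma> = \<nu>" by (simp add: mdeg_eq_0)
        have "(single \<nu> 1 - h) * single q 1 \<in> X"
        proof (rule X_keys)
          fix \<kappa> assume "\<kappa> \<in> keys ((single \<nu> 1 - h) * single q 1)"
          then obtain \<kappa>' where \<kappa>: "\<kappa> = \<kappa>' + q" "\<kappa>' \<in> keys (single \<nu> 1 - h)"
            by (auto elim!: keys_multE split: if_splits)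
          from h\<nu>[OF this(2)] have k: "\<kappa>' \<in> keys f" "\<kappa>' \<noteq> \<nu>" "mdeg \<kappa>' = mdeg \<nu>" by auto
          show "single \<kappa> 1 \<in> X"
          proof (rule heavier)
            show "keys \<kappa> \<subseteq> {..<n}"
              using k(1) ideal_PV[OF JI f(1)] "0.prems"(2) by (auto simp: \<kappa>(1) keys_plus_nat PV_def)
            show "mdeg \<kappa> = d" using "0.prems"(3) k(3) by (simp add: \<kappa>(1) mdeg_add \<sigma>)
            show "wdeg \<omega> \<mu> < wdeg \<omega> \<kappa>" using "0.prems"(4) \<nu>min[OF k(1,2)] by (simp add: \<kappa>(1) wdeg_add \<sigma>)
          qed
        qed
        moreover have "h * single q 1 \<in> X"
          using "0.prems"(2) by (intro XJ ideal_mult_right[OF JI] hJ PV_single)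
        ultimately have "(single \<nu> 1 - h) * single q 1 + h * single q 1 \<in> X" by (rule Xadd)
        then show ?case by (simp add: algebra_simps mult_single \<sigma>)
      next
        case (Suc k)
        note outer = Suc.hyps(1)
        have "\<rho> \<noteq> 0" using Suc.hyps(2) by auto
        then obtain i where i: "i \<in> keys \<rho>" by (metis keys_eq_empty ex_in_conv)
        then have "i < n" using \<nu>n Suc.prems(1) by (auto simp: keys_plus_nat)
        have \<sigma>n: "keys \<sigma> \<subseteq> {..<n}" using \<nu>n Suc.prems(1) by (simp add: keys_plus_nat)
        have \<sigma>\<nu>: "lookup \<sigma> j \<le> mdeg \<nu>" for j
          using lookup_le_mdeg[of \<nu> j] Suc.prems(1) by (simp add: lookup_add)
        \<comment> \<open>There is room for \<open>i\<close>: fewer than m coordinates have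
          non-minimal weight.\<close>
        let ?B = "insert i {i. i < n \<and> \<omega> i \<noteq> c}"
        have "card ?B \<le> m" using B card_insert_le_m1[of m "{i. i < n \<and> \<omega> i \<noteq> c}" i] by simp
        moreover have "?B \<subseteq> {..<n}" using \<open>i < n\<close> by auto
        ultimately obtain D where D: "?B \<subseteq> D" "D \<subseteq> {..<n}" "card D = m"
          using exists_subset_between[of ?B m "{..<n}"] mn by auto
        have offD: "\<omega> j = c" if "j < n" "j \<notin> D" for j using D(1) that by auto
        \<comment> \<open>Innermost induction, on the degree of \<open>q\<close> in the variables
          outside \<open>D\<close>, with \<open>\<sigma>\<close>, \<open>i\<close> and
          \<open>D\<close> fixed.\<close>
        from Suc.prems(2-4) show ?case
        proof (induction "\<Sum>j\<in>{..<n} - D. lookup q j" arbitrary: q rule: less_induct)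
          case (less q)
          consider "i \<in> keys q" | "i \<notin> keys q" "(\<Sum>j\<in>{..<n} - D. lookup q j) < N"
            | "N \<le> (\<Sum>j\<in>{..<n} - D. lookup q j)" by linarith
          then show ?case
          proof cases
            case 1
            \<comment> \<open>A factor x_i moves from \<open>q\<close> to \<open>\<sigma>\<close>:
              the monomial is unchanged, and the missing part \<open>\<rho>\<close> of
              \<open>\<nu>\<close> shrinks.\<close>
            have e: "\<sigma> + q = (\<sigma> + single i 1) + (q - single i 1)"
              using single_add_split[OF 1] by (metis add.assoc)
            have "single ((\<sigma> + single i 1) + (q - single i 1)) 1 \<in> X"
            proof (rule outer)
              show "k = mdeg (\<rho> - single i 1)"
                using Suc.hyps(2) arg_cong[OF single_add_split[OF i], of mdeg] by (simp add: mdeg_add)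
              show "\<nu> = \<sigma> + single i 1 + (\<rho> - single i 1)"
                using single_add_split[OF i] Suc.prems(1) by (metis add.assoc)
              show "keys (q - single i 1) \<subseteq> {..<n}"
                using less.prems(1) by (rule order_trans[rotated]) (auto simp: in_keys_iff lookup_minus)
            qed (use less.prems in \<open>simp_all only: e[symmetric]\<close>)
            then show ?thesis by (simp only: e[symmetric])
          next
            case 2
            have qN: "lookup q j < N" if "j \<in> {..<n} - D" for j
              using 2(2) member_le_sum[OF that, of "lookup q"] by simp
            have "lookup (\<sigma> + q) j < L" if "j \<in> insert i ({..<n} - D)" for j
              using 2(1) \<sigma>\<nu>[of j] that qN[of j] by (cases "j = i") (simp_all add: lookup_add L_def in_keys_iff)
            then have "\<sigma> + q \<in> Sm"
              unfolding Sm_def small_monoms_def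
              using \<sigma>n less.prems(1,2) D by (auto simp: keys_plus_nat intro!: exI[of _ D] exI[of _ i])
            then show ?thesis
              unfolding X_def using ideal_0[OF JI] by (intro CollectI bexI[of _ 0]) auto
          next
            case 3
            \<comment> \<open>Only the part \<open>\<delta>\<close> of \<open>q\<close> outside
              \<open>D\<close> is rewritten. The replacements have the same degree but contain a
              variable from \<open>D\<close>, so the degree outside \<open>D\<close> drops; the
              weight does not, since \<open>\<delta>\<close> involves only variables of minimal
              weight.\<close>
            define \<gamma> where "\<gamma> = (\<Sum>j\<in>keys q \<inter> D. single j (lookup q j))"
            have l\<gamma>: "lookup \<gamma> j = (if j \<in> D then lookup q j else 0)" for j
              by (auto simp: \<gamma>_def lookup_sum lookup_single' in_keys_iff)
            define \<delta> where "\<delta> = q - \<gamma>"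
            have l\<delta>: "lookup \<delta> j = (if j \<in> D then 0 else lookup q j)" for j
              by (simp add: \<delta>_def lookup_minus l\<gamma>)
            have q: "q = \<gamma> + \<delta>" by (intro poly_mapping_eqI) (simp add: lookup_add l\<gamma> l\<delta>)
            have kq: "keys \<gamma> \<subseteq> {..<n}" "keys \<delta> \<subseteq> {..<n}" using less.prems(1) by (simp_all add: q keys_plus_nat)
            have m\<delta>: "mdeg \<delta> = (\<Sum>j\<in>{..<n} - D. lookup q j)"
            proof -
              have "mdeg \<delta> = (\<Sum>j\<in>{..<n} - D. lookup \<delta> j)"
                using kq(2) by (intro mdeg_superset) (auto simp: in_keys_iff l\<delta> split: if_splits)
              then show ?thesis by (simp add: l\<delta>)
            qed
            obtain j where j: "j \<in> J" "homog (mdeg \<delta>) j" "zap D (single \<delta> 1) = zap D j"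
              using cofinite_modE[OF cofN[OF D(2,3)] J PV_single[OF kq(2)] homog_single, of 1] 3 m\<delta> by auto
            define r where "r = single \<delta> 1 - j"
            have r: "zap D r = 0" "homog (mdeg \<delta>) r" "r \<in> PV {..<n}"
              unfolding r_def using kq(2)
              by (auto simp: zap.hom_minus j(3) intro!: homog_minus j(2) PV_minus PV_single ideal_PV[OF JI j(1)])
            have "r * single (\<sigma> + \<gamma>) 1 \<in> X"
            proof (rule X_keys)
              fix \<kappa> assume "\<kappa> \<in> keys (r * single (\<sigma> + \<gamma>) 1)"
              then obtain \<kappa>' where \<kappa>: "\<kappa> = \<sigma> + (\<kappa>' + \<gamma>)" "\<kappa>' \<in> keys r"
                by (auto elim!: keys_multE simp: ac_simps split: if_splits)
              have k: "mdeg \<kappa>' = mdeg \<delta>" "keys \<kappa>' \<subseteq> {..<n}"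
                using r(2,3) \<kappa>(2) by (auto simp: homog_def PV_def)
              obtain b where b: "b \<in> keys \<kappa>'" "b \<in> D" using r(1) \<kappa>(2) by (auto simp: zap_eq_0_iff)
              have "(\<Sum>j\<in>{..<n} - D. lookup (\<kappa>' + \<gamma>) j) = (\<Sum>j\<in>{..<n} - D. lookup \<kappa>' j)"
                by (simp add: lookup_add l\<gamma>)
              also have "\<dots> < (\<Sum>j<n. lookup \<kappa>' j)"
                using b k(2) D(2) by (intro sum_strict_mono2[of _ _ b]) (auto simp: in_keys_iff)
              also have "\<dots> = (\<Sum>j\<in>{..<n} - D. lookup q j)"
                using k mdeg_superset[of "{..<n}" \<kappa>'] m\<delta> by simp
              finally have lt: "(\<Sum>j\<in>{..<n} - D. lookup (\<kappa>' + \<gamma>) j) < (\<Sum>j\<in>{..<n} - D. lookup q j)" .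
              have "wdeg \<omega> \<delta> = c * real (mdeg \<delta>)"
              proof (rule wdeg_eq)
                fix i assume "i \<in> keys \<delta>"
                moreover from this have "i \<notin> D" by (auto simp: in_keys_iff l\<delta>)
                moreover have "i < n" using kq(2) calculation(1) by blast
                ultimately show "\<omega> i = c" using offD by blast
              qed
              also have "\<dots> \<le> wdeg \<omega> \<kappa>'" unfolding k(1)[symmetric] using k(2) c by (intro wdeg_ge) auto
              finally have w: "wdeg \<omega> \<mu> \<le> wdeg \<omega> (\<sigma> + (\<kappa>' + \<gamma>))"
                using less.prems(3) by (simp add: q wdeg_add)
              show "single \<kappa> 1 \<in> X"
                unfolding \<kappa>(1)
                by (rule less.hyps[OF lt])
                  (use k kq less.prems w in \<open>auto simp: q keys_plus_nat mdeg_add\<close>)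
            qed
            moreover have "j * single (\<sigma> + \<gamma>) 1 \<in> X"
              using kq(1) \<sigma>n by (intro XJ ideal_mult_right[OF JI] j PV_single) (simp add: keys_plus_nat)
            ultimately have "r * single (\<sigma> + \<gamma>) 1 + j * single (\<sigma> + \<gamma>) 1 \<in> X" by (rule Xadd)
            then show ?thesis
              by (simp add: r_def algebra_simps mult_single) (simp add: q ac_simps)
          qed
        qed
      qed
      \<comment> \<open>Start with nothing collected towards \<open>\<nu>\<close>.\<close>
      from this[of 0 \<nu> \<mu>] less.prems show ?case by simp
    qed
    from this[OF \<mu>0] show "\<exists>j\<in>J. keys (single \<mu>0 1 - j) \<subseteq> {\<kappa>\<in>small_monoms n m L. mdeg \<kappa> = mdeg \<mu>0}"
      by (simp add: X_def d_def Sm_def)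
  qed
qed

text \<open>For fixed \<open>D\<close> and \<open>i\<close>, the exponents fit in a box with m - 1
  sides of length d + 1 and all other sides bounded in terms of \<open>L\<close>; there are finitely
  many pairs.\<close>

lemma card_small_monoms:
  "\<exists>K. \<forall>d. finite {\<mu>\<in>small_monoms n m L. mdeg \<mu> \<le> d} \<and>
     card {\<mu>\<in>small_monoms n m L. mdeg \<mu> \<le> d} \<le> K * (d + 1) ^ (m - 1)"
proof (intro exI allI conjI)
  fix d
  let ?I = "Pow {..<n} \<times> {..<n}"
  define S where "S = (\<lambda>(D, i). {\<mu>. (card D = m \<and> i \<in> D \<and> keys \<mu> \<subseteq> {..<n}) \<and> mdeg \<mu> \<le> d \<and>
    (\<forall>j\<in>insert i ({..<n} - D). lookup \<mu> j < L)})"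
  have fin: "finite (S x)" for x
    by (rule finite_subset[OF _ finite_monomials[of n d]]) (auto simp: S_def)
  have sub: "{\<mu>\<in>small_monoms n m L. mdeg \<mu> \<le> d} \<subseteq> (\<Union>x\<in>?I. S x)"
    unfolding small_monoms_def S_def by fastforce
  then show "finite {\<mu>\<in>small_monoms n m L. mdeg \<mu> \<le> d}"
    by (rule finite_subset) (auto intro: fin)
  have S: "card (S x) \<le> (L + 1) ^ n * (d + 1) ^ (m - 1)" if "x \<in> ?I" for x
  proof -
    obtain D i where x: "x = (D, i)" "D \<subseteq> {..<n}" "i < n" using \<open>x \<in> ?I\<close> by auto
    show ?thesis
    proof (cases "card D = m \<and> i \<in> D")
      case True
      let ?R = "\<lambda>j. if j \<in> D - {i} then {..d} else {..L}"
      have "card (S x) \<le> card (PiE {..<n} ?R)"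
      proof (rule card_inj_on_le[of "\<lambda>\<mu>. restrict (lookup \<mu>) {..<n}"])
        show "inj_on (\<lambda>\<mu>. restrict (lookup \<mu>) {..<n}) (S x)"
        proof (rule inj_onI)
          fix \<mu> \<kappa> assume *: "\<mu> \<in> S x" "\<kappa> \<in> S x" "restrict (lookup \<mu>) {..<n} = restrict (lookup \<kappa>) {..<n}"
          have "lookup \<mu> j = lookup \<kappa> j" for j
          proof (cases "j < n")
            case True
            then show ?thesis using fun_cong[OF *(3), of j] by simp
          next
            case False
            then have "j \<notin> keys \<mu>" "j \<notin> keys \<kappa>" using *(1,2) by (auto simp: S_def x)
            then show ?thesis by (simp add: in_keys_iff)
          qed
          then show "\<mu> = \<kappa>" by (intro poly_mapping_eqI) blast
        qed
        have "lookup \<mu> j \<in> ?R j" if "\<mu> \<in> S x" "j < n" for \<mu> j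
        proof (cases "j \<in> D - {i}")
          case True
          then show ?thesis using that(1) order_trans[OF lookup_le_mdeg[of \<mu> j]] by (simp add: S_def x)
        next
          case False
          then have "lookup \<mu> j < L" using that by (auto simp: S_def x)
          then show ?thesis using False by auto
        qed
        then show "(\<lambda>\<mu>. restrict (lookup \<mu>) {..<n}) ` S x \<subseteq> PiE {..<n} ?R"
          by (intro image_subsetI) (simp add: restrict_PiE_iff)
      qed (auto intro!: finite_PiE)
      also have "\<dots> = (\<Prod>j<n. if j \<in> D - {i} then d + 1 else L + 1)"
        by (subst card_PiE) (auto intro!: prod.cong)
      also have "\<dots> = (d + 1) ^ card ({..<n} \<inter> (D - {i})) * (L + 1) ^ card ({..<n} \<inter> - (D - {i}))"
        by (simp only: prod.If_cases[OF finite_lessThan] prod_constant Collect_mem_eq)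
      also have "{..<n} \<inter> (D - {i}) = D - {i}" using x by auto
      also have "card (D - {i}) = m - 1" using True by simp
      also have "card ({..<n} \<inter> - (D - {i})) \<le> n"
        using card_mono[of "{..<n}" "{..<n} \<inter> - (D - {i})"] by simp
      then have "(d + 1) ^ (m - 1) * (L + 1) ^ card ({..<n} \<inter> - (D - {i})) \<le> (L + 1) ^ n * (d + 1) ^ (m - 1)"
        by (simp add: mult.commute power_increasing)
      finally show ?thesis .
    qed (auto simp: S_def x)
  qed
  have "card {\<mu>\<in>small_monoms n m L. mdeg \<mu> \<le> d} \<le> card (\<Union>x\<in>?I. S x)"
    by (rule card_mono[OF _ sub]) (auto intro: fin)
  also have "\<dots> \<le> (\<Sum>x\<in>?I. card (S x))" by (rule card_UN_le) simp
  also have "\<dots> \<le> card ?I * ((L + 1) ^ n * (d + 1) ^ (m - 1))"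
    using sum_bounded_above[OF S, of ?I] by simp
  finally show "card {\<mu>\<in>small_monoms n m L. mdeg \<mu> \<le> d} \<le> card ?I * (L + 1) ^ n * (d + 1) ^ (m - 1)"
    by (simp add: mult.assoc)
qed

section \<open>Growth forced by algebraically independent elements\<close>

definition degree_le :: "nat \<Rightarrow> 'k::comm_ring_1 mpoly \<Rightarrow> bool" where
  "degree_le d f \<longleftrightarrow> (\<forall>\<nu>\<in>keys f. mdeg \<nu> \<le> d)"

lemma degree_le_mult: "degree_le d f \<Longrightarrow> degree_le e g \<Longrightarrow> degree_le (d + e) (f * g)"
  unfolding degree_le_def by (auto elim!: keys_multE simp: mdeg_add intro!: add_mono)

lemma degree_le_1 [simp]: "degree_le 0 1"
  by (simp add: degree_le_def)

lemma degree_le_power: "degree_le d f \<Longrightarrow> degree_le (k * d) (f ^ k)"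
  by (induction k) (auto intro: degree_le_mult)

lemma degree_le_prod: "(\<And>i. i \<in> A \<Longrightarrow> degree_le (d i) (F i)) \<Longrightarrow> degree_le (\<Sum>i\<in>A. d i) (\<Prod>i\<in>A. F i)"
  by (induction A rule: infinite_finite_induct) (auto intro: degree_le_mult)

text \<open>The \<open>(M + 1)\<^sup>m\<close> products of powers of algebraically independent elements with exponents at most \<open>M\<close> stay
  independent modulo \<open>J\<close>, but have degree linear in \<open>M\<close>, where only \<open>O(M\<^sup>m\<^sup>-\<^sup>1)\<close> small monomials are available.\<close>

lemma alg_indep_not_spanned_by_small_monoms:
  fixes J :: "'k::field mpoly set"
  assumes J: "is_ideal n J" and m: "0 < m" and F: "\<And>i. i < m \<Longrightarrow> F i \<in> PV {..<n}"
    and indep: "\<And>p. p \<in> PV {..<m} \<Longrightarrow> subst F p \<in> J \<Longrightarrow> p = 0"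
    and span: "\<And>\<mu>. keys \<mu> \<subseteq> {..<n} \<Longrightarrow>
      \<exists>j\<in>J. keys (single \<mu> 1 - j) \<subseteq> {\<kappa>\<in>small_monoms n m L. mdeg \<kappa> = mdeg \<mu>}"
  shows False
proof -
  obtain K where K: "\<And>d. finite {\<mu>\<in>small_monoms n m L. mdeg \<mu> \<le> d}"
    "\<And>d. card {\<mu>\<in>small_monoms n m L. mdeg \<mu> \<le> d} \<le> K * (d + 1) ^ (m - 1)"
    using card_small_monoms[of n m L] by blast
  \<comment> \<open>A crude common bound for the degrees of all the \<open>F i\<close>.\<close>
  define E where "E = (\<Sum>i<m. \<Sum>\<nu>\<in>keys (F i). mdeg \<nu>)"
  have FE: "degree_le E (F i)" if "i < m" for i
    unfolding degree_le_def
  proof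
    fix \<nu> assume "\<nu> \<in> keys (F i)"
    then have "mdeg \<nu> \<le> (\<Sum>\<nu>\<in>keys (F i). mdeg \<nu>)" by (intro member_le_sum) auto
    also have "\<dots> \<le> E" unfolding E_def using that by (intro member_le_sum) auto
    finally show "mdeg \<nu> \<le> E" .
  qed
  have reduce: "\<exists>j\<in>J. keys (p - j) \<subseteq> {\<mu>\<in>small_monoms n m L. mdeg \<mu> \<le> d}"
    if p: "p \<in> PV {..<n}" "degree_le d p" for p d
  proof -
    have "\<forall>\<nu>. \<exists>j. \<nu> \<in> keys p \<longrightarrow> j \<in> J \<and> keys (single \<nu> 1 - j) \<subseteq> {\<kappa>\<in>small_monoms n m L. mdeg \<kappa> = mdeg \<nu>}"
    proof
      fix \<nu>
      have "keys \<nu> \<subseteq> {..<n}" if "\<nu> \<in> keys p" using p(1) that by (simp add: PV_def)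
      then show "\<exists>j. \<nu> \<in> keys p \<longrightarrow> j \<in> J \<and> keys (single \<nu> 1 - j) \<subseteq> {\<kappa>\<in>small_monoms n m L. mdeg \<kappa> = mdeg \<nu>}"
        using span[of \<nu>] by blast
    qed
    from choice[OF this] obtain j where j: "\<And>\<nu>. \<nu> \<in> keys p \<Longrightarrow> j \<nu> \<in> J"
      "\<And>\<nu>. \<nu> \<in> keys p \<Longrightarrow> keys (single \<nu> 1 - j \<nu>) \<subseteq> {\<kappa>\<in>small_monoms n m L. mdeg \<kappa> = mdeg \<nu>}" by blast
    let ?j = "\<Sum>\<nu>\<in>keys p. single 0 (lookup p \<nu>) * j \<nu>"
    have "p - ?j = (\<Sum>\<nu>\<in>keys p. single \<nu> (lookup p \<nu>)) - ?j" by (simp only: poly_mapping_sum_single)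
    also have "\<dots> = (\<Sum>\<nu>\<in>keys p. single 0 (lookup p \<nu>) * (single \<nu> 1 - j \<nu>))"
      by (simp add: sum_subtractf algebra_simps mult_single)
    finally have e: "p - ?j = \<dots>" .
    have "keys (single 0 (lookup p \<nu>) * (single \<nu> 1 - j \<nu>)) \<subseteq> {\<mu>\<in>small_monoms n m L. mdeg \<mu> \<le> d}"
      if \<nu>: "\<nu> \<in> keys p" for \<nu>
    proof -
      have "keys (single 0 (lookup p \<nu>) * (single \<nu> 1 - j \<nu>)) \<subseteq> keys (single \<nu> 1 - j \<nu>)"
        by (auto simp: in_keys_iff lookup_const_mult)
      moreover have "mdeg \<nu> \<le> d" using p(2) \<nu> by (simp add: degree_le_def)
      ultimately show ?thesis using j(2)[OF \<nu>] by auto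
    qed
    then have "keys (p - ?j) \<subseteq> {\<mu>\<in>small_monoms n m L. mdeg \<mu> \<le> d}"
      unfolding e by (intro order_trans[OF keys_sum] UN_least)
    moreover have "?j \<in> J" using j(1) by (intro ideal_sum[OF J] ideal_mult[OF J]) auto
    ultimately show ?thesis by blast
  qed
  have bound: "(M + 1) ^ m \<le> K * (E * (m * M) + 1) ^ (m - 1)" for M
  proof (rule ccontr)
    assume *: "\<not> ?thesis"
    let ?P = "PiE {..<m} (\<lambda>_. {..M})"
    define mk where "mk g = (\<Sum>i<m. single i (g i))" for g :: "nat \<Rightarrow> nat"
    have lmk: "lookup (mk g) i = (if i < m then g i else 0)" for g i
      by (auto simp: mk_def lookup_sum lookup_single')
    define A where "A = mk ` ?P"
    have "inj_on mk ?P"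
    proof (rule inj_onI)
      fix g g' assume g: "g \<in> ?P" "g' \<in> ?P" "mk g = mk g'"
      show "g = g'"
      proof (rule PiE_ext[OF g(1,2)])
        fix i assume "i \<in> {..<m}"
        then show "g i = g' i" using arg_cong[OF g(3), of "\<lambda>\<mu>. lookup \<mu> i"] by (simp add: lmk)
      qed
    qed
    then have cardA: "card A = (M + 1) ^ m" unfolding A_def by (simp add: card_image card_PiE)
    have finA: "finite A" unfolding A_def by (intro finite_imageI finite_PiE) auto
    have A: "keys \<alpha> \<subseteq> {..<m}" "mdeg \<alpha> \<le> m * M" if "\<alpha> \<in> A" for \<alpha>
    proof -
      obtain g where g: "\<alpha> = mk g" "g \<in> ?P" using \<open>\<alpha> \<in> A\<close> by (auto simp: A_def)
      show k: "keys \<alpha> \<subseteq> {..<m}" by (auto simp: g in_keys_iff lmk split: if_splits)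
      have "mdeg \<alpha> = (\<Sum>i<m. lookup \<alpha> i)" using k by (intro mdeg_superset) auto
      also have "\<dots> \<le> (\<Sum>i<m. M)" using g(2) by (intro sum_mono) (auto simp: g(1) lmk PiE_def Pi_def)
      finally show "mdeg \<alpha> \<le> m * M" by simp
    qed
    have red: "\<exists>j\<in>J. keys (monom_val F \<alpha> - j) \<subseteq> {\<mu>\<in>small_monoms n m L. mdeg \<mu> \<le> E * (m * M)}"
      if \<alpha>: "\<alpha> \<in> A" for \<alpha>
    proof (rule reduce)
      have i: "i < m" if "i \<in> keys \<alpha>" for i using A(1)[OF \<alpha>] that by auto
      show "monom_val F \<alpha> \<in> PV {..<n}"
        unfolding monom_val_def using F i by (intro PV_prod PV_power) auto
      have "degree_le (\<Sum>i\<in>keys \<alpha>. lookup \<alpha> i * E) (monom_val F \<alpha>)"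
        unfolding monom_val_def using FE i by (intro degree_le_prod degree_le_power) auto
      moreover have "(\<Sum>i\<in>keys \<alpha>. lookup \<alpha> i * E) = E * mdeg \<alpha>"
        by (simp add: mdeg_def sum_distrib_left mult.commute)
      moreover have "E * mdeg \<alpha> \<le> E * (m * M)" using A(2)[OF \<alpha>] by simp
      ultimately show "degree_le (E * (m * M)) (monom_val F \<alpha>)"
        unfolding degree_le_def by (metis order_trans)
    qed
    have "card {\<mu>\<in>small_monoms n m L. mdeg \<mu> \<le> E * (m * M)} < card A"
      using * K(2)[of "E * (m * M)"] cardA by linarith
    then have "\<exists>a. (\<exists>\<alpha>\<in>A. a \<alpha> \<noteq> 0) \<and> (\<Sum>\<alpha>\<in>A. single 0 (a \<alpha>) * monom_val F \<alpha>) \<in> J"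
    proof (rule dependent_mod_ideal[OF J K(1) finA])
      fix \<alpha> assume "\<alpha> \<in> A"
      then show "\<exists>j\<in>J. keys (monom_val F \<alpha> - j) \<subseteq> {\<mu>\<in>small_monoms n m L. mdeg \<mu> \<le> E * (m * M)}"
        by (rule red)
    qed
    then obtain a where "(\<exists>\<alpha>\<in>A. a \<alpha> \<noteq> 0) \<and> (\<Sum>\<alpha>\<in>A. single 0 (a \<alpha>) * monom_val F \<alpha>) \<in> J"
      by (elim exE)
    then have a: "\<exists>\<alpha>\<in>A. a \<alpha> \<noteq> 0" "(\<Sum>\<alpha>\<in>A. single 0 (a \<alpha>) * monom_val F \<alpha>) \<in> J" by simp_all
    define p where "p = (\<Sum>\<alpha>\<in>A. single \<alpha> (a \<alpha>))"
    have "subst F p = (\<Sum>\<alpha>\<in>A. single 0 (a \<alpha>) * monom_val F \<alpha>)"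
      unfolding p_def subst.hom_sum by (simp add: subst_eq_pev pev_single)
    moreover have "p \<in> PV {..<m}" unfolding p_def using A(1) by (intro PV_sum PV_single)
    ultimately have "p = 0" using indep a(2) by simp
    moreover have "lookup p \<alpha> = a \<alpha>" if "\<alpha> \<in> A" for \<alpha>
      using that finA by (simp add: p_def lookup_sum lookup_single')
    ultimately show False using a(1) by auto
  qed
  \<comment> \<open>Since E m M + 1 is at most (E m + 1)(M + 1), this choice turns the upper bound
    into M (M + 1)^(m-1), which is less than (M + 1)^m.\<close>
  define M where "M = K * (E * m + 1) ^ (m - 1)"
  have "(M + 1) * (M + 1) ^ (m - 1) = (M + 1) ^ m" using m by (cases m) auto
  also have "\<dots> \<le> K * (E * (m * M) + 1) ^ (m - 1)" by (rule bound)
  also have "\<dots> \<le> K * ((E * m + 1) * (M + 1)) ^ (m - 1)"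
    by (intro mult_left_mono power_mono) (auto simp: algebra_simps)
  also have "\<dots> = M * (M + 1) ^ (m - 1)" by (simp only: M_def power_mult_distrib mult.assoc)
  finally show False by simp
qed

lemma exists_alg_indep_mod:
  fixes I :: "'k::field mpoly set"
  assumes m: "enat m \<le> krull_dim n I" "0 < m"
  obtains f where "\<And>i. i < m \<Longrightarrow> f i \<in> PV {..<n}"
    "\<And>p. p \<in> PV {..<m} \<Longrightarrow> subst f p \<in> I \<Longrightarrow> p = 0"
proof -
  let ?S = "{enat d | d. \<exists>Q :: nat \<Rightarrow> 'k mpoly set.
      (\<forall>k\<le>d. is_prime_ideal n (Q k) \<and> I \<subseteq> Q k) \<and> (\<forall>k<d. Q k \<subset> Q (Suc k))}"
  have "\<exists>x\<in>?S. enat m \<le> x"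
  proof (rule ccontr)
    assume *: "\<not> ?thesis"
    \<comment> \<open>If all chains were shorter than m, their supremum would be at most m - 1; with
      0 < m this is a proper decrease.\<close>
    have "x \<le> enat (m - 1)" if "x \<in> ?S" for x
    proof -
      have "x < enat m" using * that by (meson not_le)
      then show ?thesis by (cases x) auto
    qed
    then have "Sup ?S \<le> enat (m - 1)" by (rule Sup_least)
    from order_trans[OF m(1)[unfolded krull_dim_def] this] have "enat m \<le> enat (m - 1)" .
    with m(2) show False by simp
  qed
  then obtain x where x: "x \<in> ?S" "enat m \<le> x" by (elim bexE)
  from x(1) obtain d and Q :: "nat \<Rightarrow> 'k mpoly set" where "x = enat d"
    "\<forall>k\<le>d. is_prime_ideal n (Q k) \<and> I \<subseteq> Q k" "\<forall>k<d. Q k \<subset> Q (Suc k)"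
    by (elim CollectE exE conjE)
  with x(2) have d: "m \<le> d" and Q: "\<And>k. k \<le> d \<Longrightarrow> is_prime_ideal n (Q k)" "\<And>k. k \<le> d \<Longrightarrow> I \<subseteq> Q k"
    "\<And>k. k < d \<Longrightarrow> Q k \<subset> Q (Suc k)" by simp_all
  have "\<forall>k. \<exists>f. k < d \<longrightarrow> f \<in> Q (Suc k) - Q k" using Q(3) by blast
  from choice[OF this] obtain f where f: "\<And>k. k < d \<Longrightarrow> f k \<in> Q (Suc k) - Q k" by blast
  show thesis
  proof (rule that[of f])
    show "f i \<in> PV {..<n}" if "i < m" for i
      using f[of i] ideal_PV[OF prime_is_ideal[OF Q(1)[of "Suc i"]]] that d by auto
    show "p = 0" if p: "p \<in> PV {..<m}" "subst f p \<in> I" for p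
    proof (rule chain_alg_indep[of d n Q f 0])
      have "{..<m} \<subseteq> {0..<d}" using d by auto
      then show "p \<in> PV {0..<d}" using p(1) PV_mono by blast
      show "subst f p \<in> Q 0" using p(2) Q(2)[of 0] by auto
    qed (use Q(1,3) f in auto)
  qed
qed

section \<open>The skeleton and the generic tropical variety\<close>

text \<open>Among the sets A whose cone contains \<open>\<omega>\<close>, the set of all minimal
  coordinates is the largest and so gives the smallest dimension. It is non-empty because the
  minimum over 0 < n coordinates is attained.\<close>

lemma in_W_skel_iff:
  assumes "0 < n"
  shows "\<omega> \<in> W_skel n m \<longleftrightarrow> \<omega> \<in> Rn n \<and> n - card {i. i < n \<and> \<omega> i = Min (\<omega> ` {..<n})} + 1 \<le> m"
proof
  assume "\<omega> \<in> W_skel n m"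
  then obtain A where A: "\<omega> \<in> cone n A" "A \<subseteq> {..<n}" "n - card A + 1 \<le> m" unfolding W_skel_def by blast
  then have "card A \<le> card {i. i < n \<and> \<omega> i = Min (\<omega> ` {..<n})}"
    by (intro card_mono) (auto simp: cone_def)
  then show "\<omega> \<in> Rn n \<and> n - card {i. i < n \<and> \<omega> i = Min (\<omega> ` {..<n})} + 1 \<le> m"
    using A by (auto simp: cone_def)
next
  assume \<omega>: "\<omega> \<in> Rn n \<and> n - card {i. i < n \<and> \<omega> i = Min (\<omega> ` {..<n})} + 1 \<le> m"
  let ?A = "{i. i < n \<and> \<omega> i = Min (\<omega> ` {..<n})}"
  have "Min (\<omega> ` {..<n}) \<in> \<omega> ` {..<n}" using assms by (intro Min_in) auto
  then have "?A \<noteq> {}" by auto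
  moreover have "\<omega> \<in> cone n ?A" using \<omega> by (auto simp: cone_def)
  ultimately show "\<omega> \<in> W_skel n m" 
    unfolding W_skel_def using \<omega> by (intro UnionI[of "cone n ?A"] CollectI exI[of _ ?A]) auto
qed

text \<open>Both sides are decided by the number of coordinates of non-minimal weight: with m or
  more of them a set \<open>D\<close> fits inside, and with fewer the growth argument
  applies.\<close>

lemma trop_generic:
  fixes I :: "'k::field mpoly set"
  assumes I: "graded_ideal n I" and dim: "krull_dim n I = enat m" and m: "m < n" and g: "g \<in> GL n"
    and cof: "\<And>D. D \<subseteq> {..<n} \<Longrightarrow> card D = m \<Longrightarrow> \<exists>N. cofinite_mod n (act n g I) D N"
  shows "trop n (act n g I) = W_skel n m"
proof (rule Set.set_eqI)
  fix \<omega> :: "nat \<Rightarrow> real"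
  note J = act_graded_ideal[OF I g]
  note II = graded_ideal_is_ideal[OF I]
  have n: "0 < n" using m by simp
  define c where "c = Min (\<omega> ` {..<n})"
  let ?A = "{i. i < n \<and> \<omega> i = c}"
  let ?B = "{i. i < n \<and> \<omega> i \<noteq> c}"
  have c: "c \<le> \<omega> i" if "i < n" for i unfolding c_def using that by (intro Min_le) auto
  have "c \<in> \<omega> ` {..<n}" unfolding c_def using n by (intro Min_in) auto
  then obtain i0 where i0: "i0 < n" "\<omega> i0 = c" by auto
  have B: "?B = {..<n} - ?A" by auto
  then have cB: "card ?B = n - card ?A" by (subst B, subst card_Diff_subset) auto
  show "\<omega> \<in> trop n (act n g I) \<longleftrightarrow> \<omega> \<in> W_skel n m"
  proof
    assume t: "\<omega> \<in> trop n (act n g I)"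
    have "card ?B + 1 \<le> m"
    proof (rule ccontr)
      assume "\<not> ?thesis"
      then obtain D where D: "D \<subseteq> ?B" "card D = m"
        using obtain_subset_with_card_n[of m ?B] by auto
      then have Dn: "D \<subseteq> {..<n}" by auto
      obtain N where "cofinite_mod n (act n g I) D N" using cof[OF Dn D(2)] by blast
      from cofinite_mod_init_monomial[OF J this i0(1), of \<omega>]
      have "\<exists>f\<in>act n g I. is_monomial (init_form \<omega> f)"
        using D(1) i0 c by (force simp: less_le)
      then show False using t by (auto simp: trop_def)
    qed
    then show "\<omega> \<in> W_skel n m"
      using t cB unfolding in_W_skel_iff[OF n] c_def by (simp add: trop_def)
  next
    assume w: "\<omega> \<in> W_skel n m"
    then have \<omega>: "\<omega> \<in> Rn n" and cm: "card ?B < m"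
      using cB unfolding in_W_skel_iff[OF n] c_def by auto
    obtain f where f: "\<And>i. i < m \<Longrightarrow> f i \<in> PV {..<n}"
      "\<And>p. p \<in> PV {..<m} \<Longrightarrow> subst f p \<in> I \<Longrightarrow> p = 0"
      using exists_alg_indep_mod[of m n I] dim cm by (metis gr_implies_not0 neq0_conv order_refl)
    obtain h where h: "\<And>f. f \<in> PV {..<n} \<Longrightarrow> subst (lin n h) (subst (lin n g) f) = f"
      using GL_subst_inverse[OF g] by metis
    have "\<not> is_monomial (init_form \<omega> u)" if u: "u \<in> act n g I" for u
    proof
      assume "is_monomial (init_form \<omega> u)"
      then obtain \<nu> where "keys (init_form \<omega> u) = {\<nu>}" unfolding is_monomial_def by (rule card_1_singletonE)
      from spanned_by_small_monoms[OF J less_imp_le[OF m] cof c cm u this]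
      obtain L where L: "\<And>\<mu>. keys \<mu> \<subseteq> {..<n} \<Longrightarrow>
        \<exists>j\<in>act n g I. keys (single \<mu> 1 - j) \<subseteq> {\<kappa>\<in>small_monoms n m L. mdeg \<kappa> = mdeg \<mu>}" by blast
      show False
      \<comment> \<open>The elements independent modulo \<open>I\<close> are carried to g(I) by the
        substitution, and a relation there is carried back by its inverse.\<close>
      proof (rule alg_indep_not_spanned_by_small_monoms[OF graded_ideal_is_ideal[OF J] _ _ _ L])
        show "0 < m" using cm by simp
        show "subst (lin n g) (f i) \<in> PV {..<n}" if "i < m" for i
          using f(1)[OF that] by (rule subst_lin_PV)
        fix p assume p: "p \<in> PV {..<m}" "subst (\<lambda>i. subst (lin n g) (f i)) p \<in> act n g I"
        then obtain v where v: "v \<in> I" "subst (lin n g) (subst f p) = subst (lin n g) v"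
          by (auto simp: act_eq subst_subst)
        have "subst f p \<in> PV {..<n}" using f(1) by (intro PV_subst[OF p(1)]) auto
        then have "subst f p = v" using v h ideal_PV[OF II v(1)] by metis
        then show "p = 0" using f(2)[OF p(1)] v(1) by simp
      qed
    qed
    then show "\<omega> \<in> trop n (act n g I)" using \<omega> by (simp add: trop_def)
  qed
qed

theorem theorem8p3:
  fixes I :: "'k::{alg_closed_field, field_char_0} mpoly set"
    and n m :: nat
  assumes "is_prime_ideal n I"
    and "graded_ideal n I"
    and "krull_dim n I = enat m"
    and "m < n"
  shows "gtrop n I = W_skel n m"
proof -
  have "1 \<notin> I" using assms(1) by (simp add: is_prime_ideal_def)
  from generic_cofinite_mod[OF assms(2) this, of m] assms(3)
  obtain p where p: "\<exists>g\<in>GL n. eval_mat p g \<noteq> 0"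
    "\<And>g D. g \<in> GL n \<Longrightarrow> eval_mat p g \<noteq> 0 \<Longrightarrow> D \<subseteq> {..<n} \<Longrightarrow> card D = m
      \<Longrightarrow> \<exists>N. cofinite_mod n (act n g I) D N" by auto
  define U where "U = {g\<in>GL n. \<exists>q\<in>{p}. eval_mat q g \<noteq> 0}"
  have U: "zariski_open_GL n U" "U \<noteq> {}" using p(1) unfolding zariski_open_GL_def U_def by auto
  have tU: "trop n (act n g I) = W_skel n m" if "g \<in> U" for g
    using that p(2) by (intro trop_generic[OF assms(2,3,4)]) (auto simp: U_def)
  show ?thesis
    unfolding gtrop_def
  proof (rule the_equality)
    show "\<exists>U. zariski_open_GL n U \<and> U \<noteq> {} \<and> (\<forall>g\<in>U. trop n (act n g I) = W_skel n m)"
      using U tU by blast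
    fix S assume "\<exists>U. zariski_open_GL n U \<and> U \<noteq> {} \<and> (\<forall>g\<in>U. trop n (act n g I) = S)"
    then obtain V where V: "zariski_open_GL n V" "V \<noteq> {}" "\<And>g. g \<in> V \<Longrightarrow> trop n (act n g I) = S" by blast
    then obtain F where F: "V = {g\<in>GL n. \<exists>q\<in>F. eval_mat q g \<noteq> 0}" unfolding zariski_open_GL_def by blast
    then obtain q g2 where q: "q \<in> F" "g2 \<in> GL n" "eval_mat q g2 \<noteq> 0" using V(2) by auto
    obtain g1 where g1: "g1 \<in> GL n" "eval_mat p g1 \<noteq> 0" using p(1) by blast
    \<comment> \<open>Uniqueness for the description: any competing open set \<open>V\<close> shares
      a matrix with \<open>U\<close>, and the tropical variety at that matrix is both
      \<open>S\<close> and the skeleton.\<close>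
    obtain g where "g \<in> GL n" "eval_mat p g \<noteq> 0" "eval_mat q g \<noteq> 0"
      by (rule GL_irreducible[OF g1 q(2,3)])
    then have "g \<in> U" "g \<in> V" using q(1) by (auto simp: U_def F)
    then show "S = W_skel n m" using tU V(3) by metis
  qed
qed

end
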